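(* Let $(f_\beta)_{\beta\in[0,\infty)}$ be the family of skew products described in the context, where $(\Theta,\mathcal{B},m)$ is a probability space, $\gamma:\Theta\to\Theta$ is a bi-measurable bijection for which $m$ is invariant and ergodic, $A:\Theta\to\mathrm{SL}(2,\mathbb{R})$ is measurable and bounded, and $h:[0,\infty)\to[0,\infty)$ is $\mathcal{C}^2$, strictly increasing, strictly concave, bounded, with $h(0)=0$, $h'(0)=1$ and $\sup_{x\ge0}h(x)\le\left(\sup_{\theta\in\Theta}\|A(\theta)\|\right)^{-1}$. Let $\beta_1^m:=e^{-\lambda_m(A)}$ and $\beta_2^m:=e^{\lambda_m(A)}$. Then there exists a $\gamma$-invariant set $\Theta_0\subseteq\Theta$ of full measure (not depending on $\beta$) such that for all $\theta\in\Theta_0$ the following hold. (a) If $\beta<\beta_1^m$, then $\mathcal{A}_\beta(\theta)=\{0\}$ and $\lim_{n\to\infty}f^n_{\beta,\theta}(v)=0$ for all $v\in\mathbb{R}^2$. (b) If $\beta_1^m<\beta<\beta_2^m$, then $\mathcal{A}_\beta(\theta)$ is a line segment of positive length. More precisely, there exist measurable functions $\alpha_u,\alpha_s:\Theta_0\to[0,\frac12)$, not depending on $\beta$, such that for $\alpha\in[0,\frac12)$ one has $r_\beta(\theta,\alpha)>0$ if and only if $\alpha=\alpha_u(\theta)$, we have $$\mathcal{A}_\beta(\theta)=\{rv(\alpha_u(\theta))\mid |r|\le r_\beta(\theta,\alpha_u(\theta))\},$$ and the graph of the set-valued function $$\Psi_\beta(\theta)=\{\pm r_\beta(\theta,\alpha_u(\theta))v(\alpha_u(\theta))\}$$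 is a random two-point forward attractor with domain of attraction $\mathcal{D}=\{(\theta,v)\mid\theta\in\Theta_0,\ v\in\mathbb{R}^2\setminus\mathbb{R}v(\alpha_s(\theta))\}$, in the sense that $$\lim_{n\to\infty}d\left(f^n_{\beta,\theta}(v),\Psi_\beta(\gamma^n\theta)\right)=0\quad\text{for all }(\theta,v)\in\mathcal{D}.$$ (c) If $\beta>\beta_2^m$, then the map $\alpha\mapsto r_\beta(\theta,\alpha)$ is strictly positive and continuous. The set $\mathcal{T}_\beta$ defined by $$\mathcal{T}_\beta(\theta)=\partial\mathcal{A}_\beta(\theta)=\{r_\beta(\theta,\alpha)v(\alpha)\mid\alpha\in[0,1)\}$$ is the global pullback attractor outside $\Theta\times\{0\}$; more precisely, for all $\delta>0$ there exists an $f_\beta$-forward invariant random compact set $\mathcal{K}_{\beta,\delta}$ (not depending on $\theta\in\Theta_0$) which contains $\Theta_0\times\left(\overline{B_1(0)}\setminus B_\delta(0)\right)$ and satisfies $$\mathcal{T}_\beta(\theta)=\bigcap_{n\in\mathbb{N}}f^n_{\beta,\gamma^{-n}\theta}\left(\mathcal{K}_{\beta,\delta}(\gamma^{-n}\theta)\right).$$ When moreover $\lambda_m(A)>0$, the random forward attractor $\Psi_\beta(\theta)=\{\pm r_\beta(\theta,\alpha_u(\theta))v(\alpha_u(\theta))\}$ still exists, with $\Psi_\beta(\theta)\subseteq\mathcal{T}_\beta(\theta)$, and $\lim_{n\to\infty}d(f^n_{\beta,\theta}(v),\Psi_\beta(\gamma^n\theta))=0$ remains true for all $(\theta,v)\in\mathcal{D}$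 (with the same functions $\alpha_u,\alpha_s$ as in (b)).
   Context: For $\beta\in[0,\infty)$ the map $f_\beta:\Theta\times\mathbb{R}^2\to\Theta\times\mathbb{R}^2$ is $f_\beta(\theta,v)=(\gamma\theta,f_{\beta,\theta}(v))$ with $f_{\beta,\theta}(v)=h(\beta\|v\|)A(\theta)\frac{v}{\|v\|}$ if $v\ne0$ and $f_{\beta,\theta}(0)=0$ (Euclidean norm; operator norm on matrices). $f^n_{\beta,\theta}=f_{\beta,\gamma^{n-1}\theta}\circ\cdots\circ f_{\beta,\theta}$ denotes the fibre map of the $n$-th iterate. $B_\delta(0)$ is the open $\delta$-ball in $\mathbb{R}^2$; the bound on $\sup h$ gives $f_\beta(\Theta\times\mathbb{R}^2)\subseteq\Theta\times\overline{B_1(0)}$. The global attractor is $\mathcal{A}_\beta=\bigcap_{n\in\mathbb{N}}f^n_\beta(\Theta\times\overline{B_1(0)})$, with fibres $\mathcal{A}_\beta(\theta)=\{x\in\mathbb{R}^2\mid(\theta,x)\in\mathcal{A}_\beta\}$ (same notation for fibres of other subsets of $\Theta\times\mathbb{R}^2$). With $v(\alpha)=(\cos2\pi\alpha,\sin2\pi\alpha)^t$, it has the form $\mathcal{A}_\beta=\{(\theta,rv(\alpha))\mid\theta\in\Theta,\alpha\in[0,1),r\in[0,r_\beta(\theta,\alpha)]\}$, where $r_\beta:\Theta\times\mathbb{R}\to[0,\infty)$, $r_\beta(\theta,\alpha)=\max\{r\ge0\mid rv(\alpha)\in\mathcal{A}_\beta(\theta)\}$, is measurable, and is $\frac12$-periodic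 and upper semi-continuous in $\alpha$. The Lyapunov exponent is $\lambda_m(A)=\lim_{n\to\infty}\frac1n\int_\Theta\log\|A_n(\theta)\|\,dm(\theta)$, $A_n(\theta)=A(\gamma^{n-1}\theta)\cdots A(\theta)$. $d(x,S)$ is the Euclidean distance from a point to a set. A set $K\subseteq\Theta\times\mathbb{R}^2$ is a random compact set if $K(\theta)$ is compact for $m$-a.e. $\theta$ and $\theta\mapsto d(x,K(\theta))$ is measurable for all $x\in\mathbb{R}^2$; it is $f_\beta$-forward invariant if $f_{\beta,\theta}(K(\theta))\subseteq K(\gamma\theta)$ for $m$-a.e. $\theta$. *)

theory Defs
  imports "HOL-Probability.Probability"
begin

section \<open>Base dynamics\<close>

text \<open>Throughout, \<open>space M\<close> plays the role of \<open>\<Theta>\<close>.\<close>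

definition bimeasurable_bij :: "'a measure \<Rightarrow> ('a \<Rightarrow> 'a) \<Rightarrow> bool" where
  "bimeasurable_bij M \<gamma> \<longleftrightarrow>
     bij_betw \<gamma> (space M) (space M) \<and> \<gamma> \<in> measurable M M \<and>
     inv_into (space M) \<gamma> \<in> measurable M M"

definition invariant_ergodic :: "'a measure \<Rightarrow> ('a \<Rightarrow> 'a) \<Rightarrow> bool" where
  "invariant_ergodic M \<gamma> \<longleftrightarrow>
     \<gamma> \<in> measurable M M \<and> distr M M \<gamma> = M \<and>
     (\<forall>B\<in>sets M. \<gamma> -` B \<inter> space M = B \<longrightarrow> measure M B = 0 \<or> measure M B = 1)"

section \<open>Matrix cocycle and Lyapunov exponent\<close>

definition opnorm :: "real^2^2 \<Rightarrow> real" where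
  "opnorm B = onorm (\<lambda>v. B *v v)"

primrec cocycle :: "('a \<Rightarrow> 'a) \<Rightarrow> ('a \<Rightarrow> real^2^2) \<Rightarrow> nat \<Rightarrow> 'a \<Rightarrow> real^2^2" where
  "cocycle \<gamma> A 0 \<theta> = mat 1"
| "cocycle \<gamma> A (Suc n) \<theta> = A ((\<gamma> ^^ n) \<theta>) ** cocycle \<gamma> A n \<theta>"

definition lyapunov :: "'a measure \<Rightarrow> ('a \<Rightarrow> 'a) \<Rightarrow> ('a \<Rightarrow> real^2^2) \<Rightarrow> real" where
  "lyapunov M \<gamma> A = lim (\<lambda>n. (1 / real n) * (\<integral>\<theta>. ln (opnorm (cocycle \<gamma> A n \<theta>)) \<partial>M))"

section \<open>The skew product\<close>

definition strictly_concave_on :: "real set \<Rightarrow> (real \<Rightarrow> real) \<Rightarrow> bool" where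
  "strictly_concave_on S h \<longleftrightarrow> convex S \<and>
     (\<forall>x\<in>S. \<forall>y\<in>S. \<forall>t. x \<noteq> y \<and> 0 < t \<and> t < 1 \<longrightarrow>
        (1 - t) * h x + t * h y < h ((1 - t) * x + t * y))"

definition fibre_map ::
    "('a \<Rightarrow> real^2^2) \<Rightarrow> (real \<Rightarrow> real) \<Rightarrow> real \<Rightarrow> 'a \<Rightarrow> real^2 \<Rightarrow> real^2" where
  "fibre_map A h \<beta> \<theta> v =
     (if v = 0 then 0 else h (\<beta> * norm v) *\<^sub>R (A \<theta> *v (v /\<^sub>R norm v)))"

definition skew ::
    "('a \<Rightarrow> 'a) \<Rightarrow> ('a \<Rightarrow> real^2^2) \<Rightarrow> (real \<Rightarrow> real) \<Rightarrow> real \<Rightarrow> 'a \<times> (real^2) \<Rightarrow> 'a \<times> (real^2)" where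
  "skew \<gamma> A h \<beta> = (\<lambda>(\<theta>, v). (\<gamma> \<theta>, fibre_map A h \<beta> \<theta> v))"

primrec fibre_iter ::
    "('a \<Rightarrow> 'a) \<Rightarrow> ('a \<Rightarrow> real^2^2) \<Rightarrow> (real \<Rightarrow> real) \<Rightarrow> real \<Rightarrow> nat \<Rightarrow> 'a \<Rightarrow> real^2 \<Rightarrow> real^2" where
  "fibre_iter \<gamma> A h \<beta> 0 \<theta> v = v"
| "fibre_iter \<gamma> A h \<beta> (Suc n) \<theta> v =
     fibre_map A h \<beta> ((\<gamma> ^^ n) \<theta>) (fibre_iter \<gamma> A h \<beta> n \<theta> v)"

definition fibre :: "('a \<times> (real^2)) set \<Rightarrow> 'a \<Rightarrow> (real^2) set" where
  "fibre K \<theta> = {x. (\<theta>, x) \<in> K}"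

definition attractor ::
    "'a measure \<Rightarrow> ('a \<Rightarrow> 'a) \<Rightarrow> ('a \<Rightarrow> real^2^2) \<Rightarrow> (real \<Rightarrow> real) \<Rightarrow> real \<Rightarrow> ('a \<times> (real^2)) set" where
  "attractor M \<gamma> A h \<beta> = (\<Inter>n. (skew \<gamma> A h \<beta> ^^ n) ` (space M \<times> cball 0 1))"

definition dir :: "real \<Rightarrow> real^2" where
  "dir \<alpha> = vector [cos (2 * pi * \<alpha>), sin (2 * pi * \<alpha>)]"

definition radius ::
    "'a measure \<Rightarrow> ('a \<Rightarrow> 'a) \<Rightarrow> ('a \<Rightarrow> real^2^2) \<Rightarrow> (real \<Rightarrow> real) \<Rightarrow> real \<Rightarrow> 'a \<Rightarrow> real \<Rightarrow> real" where
  "radius M \<gamma> A h \<beta> \<theta> \<alpha> =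
     (GREATEST r. 0 \<le> r \<and> r *\<^sub>R dir \<alpha> \<in> fibre (attractor M \<gamma> A h \<beta>) \<theta>)"

section \<open>Random compact sets and forward attractors\<close>

definition random_compact_set :: "'a measure \<Rightarrow> ('a \<times> (real^2)) set \<Rightarrow> bool" where
  "random_compact_set M K \<longleftrightarrow>
     K \<subseteq> space M \<times> UNIV \<and> (AE \<theta> in M. compact (fibre K \<theta>)) \<and>
     (\<forall>x. (\<lambda>\<theta>. infdist x (fibre K \<theta>)) \<in> borel_measurable M)"

definition forward_invariant ::
    "'a measure \<Rightarrow> ('a \<Rightarrow> 'a) \<Rightarrow> ('a \<Rightarrow> real^2^2) \<Rightarrow> (real \<Rightarrow> real) \<Rightarrow> real \<Rightarrow> ('a \<times> (real^2)) set \<Rightarrow> bool" where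
  "forward_invariant M \<gamma> A h \<beta> K \<longleftrightarrow>
     (AE \<theta> in M. fibre_map A h \<beta> \<theta> ` fibre K \<theta> \<subseteq> fibre K (\<gamma> \<theta>))"

definition Psi ::
    "'a measure \<Rightarrow> ('a \<Rightarrow> 'a) \<Rightarrow> ('a \<Rightarrow> real^2^2) \<Rightarrow> (real \<Rightarrow> real) \<Rightarrow> ('a \<Rightarrow> real) \<Rightarrow> real
      \<Rightarrow> 'a \<Rightarrow> (real^2) set" where
  "Psi M \<gamma> A h \<alpha>\<^sub>u \<beta> \<theta> =
     {radius M \<gamma> A h \<beta> \<theta> (\<alpha>\<^sub>u \<theta>) *\<^sub>R dir (\<alpha>\<^sub>u \<theta>),
      - (radius M \<gamma> A h \<beta> \<theta> (\<alpha>\<^sub>u \<theta>) *\<^sub>R dir (\<alpha>\<^sub>u \<theta>))}"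

definition attraction_domain :: "'a set \<Rightarrow> ('a \<Rightarrow> real) \<Rightarrow> ('a \<times> (real^2)) set" where
  "attraction_domain \<Theta>\<^sub>0 \<alpha>\<^sub>s =
     {(\<theta>, v). \<theta> \<in> \<Theta>\<^sub>0 \<and> v \<notin> range (\<lambda>t. t *\<^sub>R dir (\<alpha>\<^sub>s \<theta>))}"

text \<open>The set-valued function \<open>\<Psi>\<close> is only considered over the full-measure set \<open>\<Theta>\<^sub>0\<close>; being
  random therefore refers to the trace of \<open>M\<close> on \<open>\<Theta>\<^sub>0\<close>. Being an attractor is meant in the sense
  that fibre distances converge to zero for all points of \<open>D\<close>.\<close>

definition random_two_point_forward_attractor ::
    "'a measure \<Rightarrow> ('a \<Rightarrow> 'a) \<Rightarrow> ('a \<Rightarrow> real^2^2) \<Rightarrow> (real \<Rightarrow> real) \<Rightarrow> real \<Rightarrow> 'a set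
      \<Rightarrow> ('a \<Rightarrow> (real^2) set) \<Rightarrow> ('a \<times> (real^2)) set \<Rightarrow> bool" where
  "random_two_point_forward_attractor M \<gamma> A h \<beta> \<Theta>\<^sub>0 \<Psi> D \<longleftrightarrow>
     random_compact_set (restrict_space M \<Theta>\<^sub>0) (Sigma \<Theta>\<^sub>0 \<Psi>) \<and>
     (\<forall>\<theta>\<in>\<Theta>\<^sub>0. card (\<Psi> \<theta>) = 2) \<and>
     (\<forall>(\<theta>, v)\<in>D.
        (\<lambda>n. infdist (fibre_iter \<gamma> A h \<beta> n \<theta> v) (\<Psi> ((\<gamma> ^^ n) \<theta>))) \<longlonglongrightarrow> 0)"

end

theory Submission
  imports Defs "HOL-Real_Asymp.Real_Asymp"
begin

text \<open>On every ray the fibre map acts as \<open>r \<mapsto> h(\<beta>r)\<close> times the expansion of the linear cocycle, while the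
  directions move projectively. By Kingman's theorem \<open>\<parallel>A\<^sub>n\<parallel>\<close> grows forwards and backwards at the rate
  \<open>\<lambda>\<close>; since \<open>h(\<beta>r)\<close> is at most \<open>\<beta>r\<close> and close to \<open>\<beta>r\<close> for small \<open>r\<close>, this decides along each direction
  whether radii of pulled back orbits collapse or stay bounded below. Strict concavity makes
  \<open>log r \<mapsto> log h(\<beta>r)\<close> a strict contraction, uniformly where \<open>r\<close> is bounded below; by recurrence orbits
  visit such places infinitely often, so radii over the same directions synchronise. This gives continuity of
  \<open>r\<^sub>\<beta>\<close>, the pullback attractor and the forward attraction. If \<open>\<lambda> > 0\<close>, the two invariant directions are the
  limits of the most contracted directions of \<open>A\<^sub>n\<close> in forward and backward time. Null sets are
  independent of \<open>\<beta>\<close> because only rates \<open>q\<close> from a countable set enter the recurrence statements.\<close>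

section \<open>Real two-by-two matrices\<close>

text \<open>No singular value decomposition or splitting theorem is used. The squared length of the
  image of a unit vector is affine in its doubled angle (\<open>norm_mv_dir\<close>), and invariance
  of the area form \<open>cross2\<close> under determinant 1 converts contraction of one direction
  into expansion of the transversal ones. The obstacle is that the constants in all exponential
  bounds depend on the base point, so nothing is uniform along an orbit. Pullback radii are
  therefore indexed by the direction of arrival (\<open>rad\<close>): orbits compared at a fixed ray
  have the same past directions, the linear factors cancel in their logarithmic distance, and only
  the number of visits to places with a common constant matters. In forward time an orbit and the
  attracting point lie over different directions and the factors do not cancel; they differ by a
  convergent quotient, which acts as a vanishing drift (\<open>damped_sequence_tendsto_0\<close>).
  The inverse cocycle is an instance of the same locale, so unstable objects are the stable ones of
  the inverse system.\<close>

definition cross2 :: "real^2 \<Rightarrow> real^2 \<Rightarrow> real" where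
  "cross2 v w = v$1 * w$2 - v$2 * w$1"

text \<open>The adjugate, which is the inverse as soon as the determinant is 1. Its entries are
  those of \<open>P\<close> up to sign, so measurability costs nothing.\<close>

definition adj2 :: "real^2^2 \<Rightarrow> real^2^2" where
  "adj2 P = vector [vector [P$2$2, - P$1$2], vector [- P$2$1, P$1$1]]"

text \<open>The squared Frobenius norm, which is the sum of the two squared singular values.\<close>

definition sqn :: "real^2^2 \<Rightarrow> real" where
  "sqn P = (P$1$1)\<^sup>2 + (P$1$2)\<^sup>2 + (P$2$1)\<^sup>2 + (P$2$2)\<^sup>2"

text \<open>Twice the traceless part of the Gram matrix \<open>transpose P ** P\<close>, read as a
  complex number. Its modulus is the gap between the squared singular values and its argument is
  twice the angle of the most expanded direction, so the most contracted one belongs to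
  \<open>- sgn (dz P)\<close>.\<close>

definition dz :: "real^2^2 \<Rightarrow> complex" where
  "dz P = Complex ((P$1$1)\<^sup>2 + (P$2$1)\<^sup>2 - (P$1$2)\<^sup>2 - (P$2$2)\<^sup>2) (2 * (P$1$1 * P$1$2 + P$2$1 * P$2$2))"

lemma mv2: "(P *v v)$1 = P$1$1 * v$1 + P$1$2 * v$2" "(P *v v)$2 = P$2$1 * v$1 + P$2$2 * v$2"
  for P :: "real^2^2"
  by (simp_all add: matrix_vector_mult_def sum_2)

lemma norm2_sq: "(norm v)\<^sup>2 = (v$1)\<^sup>2 + (v$2)\<^sup>2" for v :: "real^2"
  by (simp add: norm_vec_def L2_set_def sum_2)

lemma vec2_eq_iff: "v = w \<longleftrightarrow> v$1 = w$1 \<and> v$2 = w$2" for v w :: "'b^2"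
  by (simp add: vec_eq_iff forall_2)

lemma dir_nth [simp]: "dir \<alpha> $ 1 = cos (2*pi*\<alpha>)" "dir \<alpha> $ 2 = sin (2*pi*\<alpha>)"
  by (simp_all add: dir_def)

lemma norm_dir [simp]: "norm (dir \<alpha>) = 1"
  using norm2_sq[of "dir \<alpha>"] by (simp add: power2_eq_1_iff) (smt (verit) norm_ge_zero)

lemma dir_nonzero [simp]: "dir \<alpha> \<noteq> 0"
  by (metis norm_dir norm_zero zero_neq_one)

lemma exists_dir:
  assumes "norm v = 1"
  shows "\<exists>\<alpha>\<in>{0..<1}. v = dir \<alpha>"
proof -
  have "(v$1)\<^sup>2 + (v$2)\<^sup>2 = 1" using norm2_sq[of v] assms by simp
  then obtain t where t: "0 \<le> t" "t < 2*pi" "v$1 = cos t" "v$2 = sin t"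
    using sincos_total_2pi by metis
  have "t / (2*pi) \<in> {0..<1}" using t by (auto simp: field_simps)
  moreover have "v = dir (t/(2*pi))" using t by (simp add: vec2_eq_iff)
  ultimately show ?thesis by blast
qed

lemma dir_cross: "cross2 (dir \<alpha>) (dir \<beta>) = sin (2 * pi * (\<beta> - \<alpha>))"
  by (simp add: cross2_def right_diff_distrib sin_diff)

text \<open>The angle 2 pi (\<beta> - \<alpha>) lies strictly between - pi and pi, where the sine
  vanishes only at 0. Hence [0, 1/2) parametrises the lines through the origin without
  repetition.\<close>

lemma dir_parallel_eq:
  assumes "\<alpha> \<in> {0..<1/2}" "\<beta> \<in> {0..<1/2}" "cross2 (dir \<alpha>) (dir \<beta>) = 0"
  shows "\<alpha> = \<beta>"
proof (rule ccontr)
  assume ne: "\<alpha> \<noteq> \<beta>"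
  have s: "sin (2 * pi * (\<beta> - \<alpha>)) = 0" using assms(3) dir_cross by simp
  have d: "\<bar>\<beta> - \<alpha>\<bar> < 1/2" using assms(1,2) by (simp add: abs_if)
  have "\<bar>2 * pi * (\<beta> - \<alpha>)\<bar> = 2 * pi * \<bar>\<beta> - \<alpha>\<bar>" by (simp add: abs_mult)
  also have "\<dots> < 2 * pi * (1/2)" by (rule mult_strict_left_mono[OF d]) simp
  finally have b: "\<bar>2 * pi * (\<beta> - \<alpha>)\<bar> < pi" by simp
  show False
  proof (cases "\<beta> > \<alpha>")
    case True
    then have "0 < 2 * pi * (\<beta> - \<alpha>)" by simp
    then show False using b s sin_gt_zero[of "2 * pi * (\<beta> - \<alpha>)"] by linarith
  next
    case False
    then have "2 * pi * (\<beta> - \<alpha>) < 0" using ne by (simp add: mult_less_0_iff)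
    then show False using b s sin_gt_zero[of "-(2 * pi * (\<beta> - \<alpha>))"]
      by (simp only: sin_minus) linarith
  qed
qed

text \<open>Double-angle formulas turn the quadratic form of the Gram matrix into an affine function
  on the unit circle. Extremal directions then come from Cauchy-Schwarz, without any
  diagonalisation.\<close>

lemma norm_mv_dir:
  "(norm (P *v dir \<alpha>))\<^sup>2 = (sqn P + dz P \<bullet> cis (4*pi*\<alpha>)) / 2"
proof -
  define t where "t = 2*pi*\<alpha>"
  define C S a b c d where "C = cos t" and "S = sin t" and
    "a = P$1$1" and "b = P$1$2" and "c = P$2$1" and "d = P$2$2"
  note defs = C_def S_def a_def b_def c_def d_def
  have t2: "4*pi*\<alpha> = 2*t" by (simp add: t_def)
  have re: "cos (4*pi*\<alpha>) = C\<^sup>2 - S\<^sup>2" and im: "sin (4*pi*\<alpha>) = 2 * S * C"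
    unfolding t2 defs by (simp_all add: cos_double sin_double)
  have "2 * ((a*C + b*S)\<^sup>2 + (c*C + d*S)\<^sup>2) = (C\<^sup>2 + S\<^sup>2) * (a\<^sup>2 + b\<^sup>2 + c\<^sup>2 + d\<^sup>2) +
      ((a\<^sup>2 + c\<^sup>2 - b\<^sup>2 - d\<^sup>2) * (C\<^sup>2 - S\<^sup>2) + 2 * (a*b + c*d) * (2*S*C))"
    by algebra
  moreover have "C\<^sup>2 + S\<^sup>2 = 1" by (simp add: defs)
  ultimately show ?thesis
    unfolding norm2_sq mv2 dir_nth inner_complex_def cis.simps re im sqn_def dz_def complex.sel
      t_def[symmetric] defs[symmetric] by simp
qed

text \<open>The two numbers \<open>(sqn P + norm (dz P)) / 2\<close> and
  \<open>(sqn P - norm (dz P)) / 2\<close> are the squared singular values: their product is the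
  squared determinant.\<close>

lemma norm_dz_sq: "(norm (dz P))\<^sup>2 = (sqn P)\<^sup>2 - 4 * (det P)\<^sup>2"
proof -
  define a b c d where "a = P$1$1" and "b = P$1$2" and "c = P$2$1" and "d = P$2$2"
  have "(a\<^sup>2 + c\<^sup>2 - b\<^sup>2 - d\<^sup>2)\<^sup>2 + (2 * (a*b + c*d))\<^sup>2 = (a\<^sup>2 + b\<^sup>2 + c\<^sup>2 + d\<^sup>2)\<^sup>2 - 4 * (a*d - b*c)\<^sup>2"
    by (simp add: power2_eq_square algebra_simps)
  then show ?thesis
    by (simp add: dz_def sqn_def cmod_power2 det_2 a_def b_def c_def d_def)
qed

lemma sqn_nonneg: "0 \<le> sqn P" by (simp add: sqn_def)

lemma norm_dz_le: "norm (dz P) \<le> sqn P"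
  by (rule power2_le_imp_le[OF _ sqn_nonneg]) (simp add: norm_dz_sq)

lemma norm_mv_le: "norm (P *v v) \<le> opnorm P * norm v"
  unfolding opnorm_def by (rule onorm) (rule matrix_vector_mul_bounded_linear)

lemma opnorm_nonneg: "0 \<le> opnorm P"
  unfolding opnorm_def by (rule onorm_pos_le) (rule matrix_vector_mul_bounded_linear)

lemma opnorm_le: "(\<And>v. norm (P *v v) \<le> b * norm v) \<Longrightarrow> opnorm P \<le> b"
  unfolding opnorm_def by (rule onorm_le)

lemma opnorm_mult: "opnorm (P ** Q) \<le> opnorm P * opnorm Q"
proof (rule opnorm_le)
  fix v
  have "norm ((P ** Q) *v v) \<le> opnorm P * norm (Q *v v)"
    by (simp add: norm_mv_le flip: matrix_vector_mul_assoc)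
  also have "\<dots> \<le> opnorm P * (opnorm Q * norm v)"
    by (intro mult_left_mono norm_mv_le opnorm_nonneg)
  finally show "norm ((P ** Q) *v v) \<le> opnorm P * opnorm Q * norm v" by (simp add: mult.assoc)
qed

lemma opnorm_mat_1 [simp]: "opnorm (mat 1) = 1"
proof (rule antisym)
  show "opnorm (mat 1) \<le> 1" by (rule opnorm_le) simp
  show "1 \<le> opnorm (mat 1)" using norm_mv_le[of "mat 1" "dir 0"] by simp
qed

lemma opnorm_sq: "(opnorm P)\<^sup>2 = (sqn P + norm (dz P)) / 2"
proof (rule antisym)
  have unit: "(norm (P *v u))\<^sup>2 \<le> (sqn P + norm (dz P)) / 2" if u: "norm u = 1" for u
  proof -
    obtain \<alpha> where "u = dir \<alpha>" using exists_dir[OF u] by blast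
    moreover have "dz P \<bullet> cis (4*pi*\<alpha>) \<le> norm (dz P)"
      using norm_cauchy_schwarz[of "dz P" "cis (4*pi*\<alpha>)"] by simp
    ultimately show ?thesis by (simp add: norm_mv_dir)
  qed
  have "opnorm P \<le> sqrt ((sqn P + norm (dz P)) / 2)"
  proof (rule opnorm_le)
    fix v
    show "norm (P *v v) \<le> sqrt ((sqn P + norm (dz P)) / 2) * norm v"
    proof (cases "v = 0")
      case False
      have "norm (P *v (v /\<^sub>R norm v)) \<le> sqrt ((sqn P + norm (dz P)) / 2)"
        by (rule real_le_rsqrt, rule unit) (use False in simp)
      moreover have "norm (P *v (v /\<^sub>R norm v)) = norm (P *v v) / norm v"
        by (simp add: matrix_vector_mult_scaleR divide_inverse)
      ultimately show ?thesis using False by (simp add: divide_le_eq)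
    qed simp
  qed
  then show "(opnorm P)\<^sup>2 \<le> (sqn P + norm (dz P)) / 2"
    using sqn_nonneg[of P] by (metis abs_of_nonneg opnorm_nonneg real_sqrt_abs real_sqrt_le_iff)
  \<comment> \<open>Equality in Cauchy-Schwarz: the direction with parameter t / (4 pi) aligns
    \<open>cis\<close> with \<open>dz P\<close>; if \<open>dz P = 0\<close>, every direction is
    extremal.\<close>
  define t where "t = Arg (dz P)"
  have "dz P \<bullet> cis t = norm (dz P)"
  proof (cases "dz P = 0")
    case False
    then have "cis t = dz P /\<^sub>R norm (dz P)" by (simp add: t_def cis_Arg sgn_div_norm)
    then show ?thesis using False by (simp add: dot_square_norm power2_eq_square)
  qed simp
  then have "(sqn P + norm (dz P)) / 2 = (norm (P *v dir (t / (4*pi))))\<^sup>2"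
    by (simp add: norm_mv_dir)
  also have "\<dots> \<le> (opnorm P)\<^sup>2"
    using norm_mv_le[of P "dir (t / (4*pi))"] by (intro power_mono) auto
  finally show "(sqn P + norm (dz P)) / 2 \<le> (opnorm P)\<^sup>2" .
qed

lemma opnorm_eq: "opnorm P = sqrt ((sqn P + norm (dz P)) / 2)"
  using opnorm_sq opnorm_nonneg by (metis real_sqrt_unique)

lemma opnorm_sq_le_sqn: "(opnorm P)\<^sup>2 \<le> sqn P" and sqn_le_opnorm_sq: "sqn P \<le> 2 * (opnorm P)\<^sup>2"
  using opnorm_sq[of P] norm_dz_le[of P] by (simp_all add: field_simps)

lemma cross2_mv: "cross2 (P *v v) (P *v w) = det P * cross2 v w"
  unfolding cross2_def mv2 det_2 by (simp add: algebra_simps)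

text \<open>Lagrange's identity: the missing square is that of the inner product. Together with
  \<open>cross2_mv\<close> it bounds one image length from below when the other is small.\<close>

lemma abs_cross2_le: "\<bar>cross2 v w\<bar> \<le> norm v * norm w"
proof -
  have "(cross2 v w)\<^sup>2 \<le> (norm v * norm w)\<^sup>2"
  proof -
    have "(norm v * norm w)\<^sup>2 - (cross2 v w)\<^sup>2 = (v$1*w$1 + v$2*w$2)\<^sup>2"
      unfolding power_mult_distrib norm2_sq cross2_def by (simp add: power2_eq_square algebra_simps)
    then show ?thesis by (metis diff_ge_0_iff_ge zero_le_power2)
  qed
  then show ?thesis by (metis abs_le_square_iff abs_mult abs_norm_cancel)
qed

lemma cross2_eq_0D:
  assumes "cross2 v w = 0" "w \<noteq> 0"
  shows "\<exists>t. v = t *\<^sub>R w"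
proof (cases "w$1 = 0")
  case True
  then have "w$2 \<noteq> 0" using assms by (auto simp: vec2_eq_iff)
  then have "v = (v$2 / w$2) *\<^sub>R w" using assms True by (auto simp: vec2_eq_iff cross2_def)
  then show ?thesis by blast
next
  case False
  then have "v = (v$1 / w$1) *\<^sub>R w" using assms by (auto simp: vec2_eq_iff cross2_def field_simps)
  then show ?thesis by blast
qed

text \<open>The coefficients are those of Cramer's rule.\<close>

lemma cross2_basis:
  assumes "cross2 e s \<noteq> 0"
  shows "\<exists>a b. v = a *\<^sub>R e + b *\<^sub>R s"
proof -
  have "v = (cross2 v s / cross2 e s) *\<^sub>R e + (cross2 e v / cross2 e s) *\<^sub>R s"
    using assms unfolding vec2_eq_iff
    by (simp add: divide_simps) (simp add: cross2_def algebra_simps)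
  then show ?thesis by blast
qed

text \<open>Test against the rotation of \<open>u\<close> by a right angle: this is \<open>opnorm (inverse P) \<le> opnorm P\<close>.\<close>

lemma norm_le_opnorm_mv:
  assumes "det P = 1"
  shows "norm u \<le> opnorm P * norm (P *v u)"
proof (cases "u = 0")
  case False
  define x :: "real^2" where "x = vector [u$2, - u$1]"
  have nx: "norm x = norm u"
    using norm2_sq[of x] norm2_sq[of u] unfolding x_def
    by (metis (no_types, opaque_lifting) add.commute norm_ge_zero power2_eq_iff_nonneg power2_minus vector_2)
  have "(norm u)\<^sup>2 = \<bar>cross2 x u\<bar>"
    unfolding norm2_sq by (simp add: x_def cross2_def power2_eq_square)
  also have "\<dots> = \<bar>cross2 (P *v x) (P *v u)\<bar>" by (simp add: cross2_mv assms)
  also have "\<dots> \<le> norm (P *v x) * norm (P *v u)" by (rule abs_cross2_le)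
  also have "\<dots> \<le> opnorm P * norm u * norm (P *v u)"
    using norm_mv_le[of P x] nx by (simp add: mult_right_mono)
  finally show ?thesis using False by (simp add: power2_eq_square mult.commute mult.left_commute)
qed simp

lemma opnorm_ge_1:
  assumes "det P = 1" shows "1 \<le> opnorm P"
proof -
  have "1 \<le> opnorm P * norm (P *v dir 0)" using norm_le_opnorm_mv[OF assms, of "dir 0"] by simp
  also have "\<dots> \<le> opnorm P * opnorm P"
    using norm_mv_le[of P "dir 0"] opnorm_nonneg by (intro mult_left_mono) auto
  finally show ?thesis using opnorm_nonneg by (metis one_power2 power2_eq_square power2_le_imp_le)
qed

lemma adj2_nth [simp]:
  "adj2 P $ 1 $ 1 = P$2$2" "adj2 P $ 1 $ 2 = - P$1$2" "adj2 P $ 2 $ 1 = - P$2$1" "adj2 P $ 2 $ 2 = P$1$1"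
  by (simp_all add: adj2_def)

lemma det_adj2 [simp]: "det (adj2 P) = det P"
  by (simp add: det_2)

lemma mv_adj2:
  assumes "det P = 1" shows "P *v (adj2 P *v w) = w"
proof -
  have "P$1$1 * (P$2$2 * w$1 + - P$1$2 * w$2) + P$1$2 * (- P$2$1 * w$1 + P$1$1 * w$2) =
      (P$1$1 * P$2$2 - P$1$2 * P$2$1) * w$1"
    "P$2$1 * (P$2$2 * w$1 + - P$1$2 * w$2) + P$2$2 * (- P$2$1 * w$1 + P$1$1 * w$2) =
      (P$1$1 * P$2$2 - P$1$2 * P$2$1) * w$2"
    by (simp_all add: algebra_simps)
  then show ?thesis using assms unfolding vec2_eq_iff mv2 adj2_nth det_2 by simp
qed

lemma adj2_adj2 [simp]: "adj2 (adj2 P) = P"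
  by (simp add: vec2_eq_iff)

lemma adj2_mv: "det P = 1 \<Longrightarrow> adj2 P *v (P *v w) = w"
  using mv_adj2[of "adj2 P"] by simp

lemma mv_nonzero: "det P = 1 \<Longrightarrow> w \<noteq> 0 \<Longrightarrow> P *v w \<noteq> 0" for P :: "real^2^2"
  using adj2_mv[of P w] by auto

text \<open>By \<open>opnorm_eq\<close> and \<open>norm_dz_sq\<close> the norm depends on
  \<open>sqn\<close> and \<open>det\<close> only, and \<open>adj2\<close> preserves both. It makes
  the forward and the inverse cocycle grow at the same rate.\<close>

lemma opnorm_adj2: "opnorm (adj2 P) = opnorm P"
proof -
  have sq: "sqn (adj2 P) = sqn P" unfolding sqn_def adj2_nth by simp
  have "(norm (dz (adj2 P)))\<^sup>2 = (norm (dz P))\<^sup>2"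
    unfolding norm_dz_sq sq det_adj2 ..
  then have "norm (dz (adj2 P)) = norm (dz P)"
    by (rule power2_eq_imp_eq) (rule norm_ge_zero)+
  then show ?thesis unfolding opnorm_eq sq by simp
qed

section \<open>Measurability of vectors, matrices and their norms\<close>

lemma borel_measurable_vec2:
  fixes f :: "'a \<Rightarrow> 'b::euclidean_space^2"
  shows "f \<in> borel_measurable M \<longleftrightarrow> (\<lambda>x. f x $ 1) \<in> borel_measurable M \<and> (\<lambda>x. f x $ 2) \<in> borel_measurable M"
proof
  assume f: "f \<in> borel_measurable M"
  have "(\<lambda>x. f x $ i) \<in> borel_measurable M" for i
    by (rule measurable_compose[OF f, of "\<lambda>v. v $ i"])
       (intro borel_measurable_continuous_onI continuous_intros)
  then show "(\<lambda>x. f x $ 1) \<in> borel_measurable M \<and> (\<lambda>x. f x $ 2) \<in> borel_measurable M" by blast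
next
  assume a: "(\<lambda>x. f x $ 1) \<in> borel_measurable M \<and> (\<lambda>x. f x $ 2) \<in> borel_measurable M"
  show "f \<in> borel_measurable M"
    unfolding borel_measurable_euclidean_space[of f]
  proof
    fix b :: "'b^2" assume "b \<in> Basis"
    have "(\<lambda>x. f x \<bullet> b) = (\<lambda>x. f x $ 1 \<bullet> b $ 1 + f x $ 2 \<bullet> b $ 2)"
      by (simp add: inner_vec_def sum_2)
    then show "(\<lambda>x. f x \<bullet> b) \<in> borel_measurable M"
      using a by (auto intro!: borel_measurable_add borel_measurable_inner)
  qed
qed

lemma borel_measurable_mat2:
  fixes f :: "'a \<Rightarrow> real^2^2"
  shows "f \<in> borel_measurable M \<longleftrightarrow>
    (\<lambda>x. f x $ 1 $ 1) \<in> borel_measurable M \<and> (\<lambda>x. f x $ 1 $ 2) \<in> borel_measurable M \<and>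
    (\<lambda>x. f x $ 2 $ 1) \<in> borel_measurable M \<and> (\<lambda>x. f x $ 2 $ 2) \<in> borel_measurable M"
  by (auto simp: borel_measurable_vec2)

lemma borel_measurable_mm [measurable]:
  fixes f g :: "'a \<Rightarrow> real^2^2"
  assumes "f \<in> borel_measurable M" "g \<in> borel_measurable M"
  shows "(\<lambda>x. f x ** g x) \<in> borel_measurable M"
  using assms unfolding borel_measurable_mat2 matrix_matrix_mult_def sum_2 vec_lambda_beta
  by (auto intro!: borel_measurable_add borel_measurable_times)

lemma borel_measurable_mv [measurable]:
  fixes f :: "'a \<Rightarrow> real^2^2" and g :: "'a \<Rightarrow> real^2"
  assumes "f \<in> borel_measurable M" "g \<in> borel_measurable M"
  shows "(\<lambda>x. f x *v g x) \<in> borel_measurable M"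
  using assms unfolding borel_measurable_vec2 mv2
  by (auto intro!: borel_measurable_add borel_measurable_times)

lemma borel_measurable_adj2 [measurable]:
  "f \<in> borel_measurable M \<Longrightarrow> (\<lambda>x. adj2 (f x)) \<in> borel_measurable M"
  by (simp add: borel_measurable_mat2)

lemma borel_measurable_sqn [measurable]:
  "f \<in> borel_measurable M \<Longrightarrow> (\<lambda>x. sqn (f x)) \<in> borel_measurable M"
  unfolding sqn_def borel_measurable_mat2 by (auto intro!: borel_measurable_add borel_measurable_power)

lemma borel_measurable_dz [measurable]:
  "f \<in> borel_measurable M \<Longrightarrow> (\<lambda>x. dz (f x)) \<in> borel_measurable M"
  unfolding dz_def borel_measurable_mat2 Complex_eq
  by (auto intro!: borel_measurable_add borel_measurable_diff borel_measurable_times borel_measurable_power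
      borel_measurable_of_real)

text \<open>The closed form \<open>opnorm_eq\<close> replaces the supremum over uncountably many
  vectors.\<close>

lemma borel_measurable_opnorm [measurable]:
  "f \<in> borel_measurable M \<Longrightarrow> (\<lambda>x. opnorm (f x)) \<in> borel_measurable M"
  unfolding opnorm_eq by (simp add: borel_measurable_sqn borel_measurable_dz)

lemma borel_measurable_dir [measurable]:
  "f \<in> borel_measurable M \<Longrightarrow> (\<lambda>x. dir (f x)) \<in> borel_measurable M"
  by (simp add: borel_measurable_vec2)

lemma adj2_mult: "adj2 P ** adj2 Q = adj2 (Q ** P)"
  by (simp add: vec2_eq_iff matrix_matrix_mult_def sum_2 adj2_def algebra_simps)

lemma continuous_on_mv: "continuous_on S (\<lambda>w. P *v w)" for P :: "real^2^2"
  by (intro linear_continuous_on matrix_vector_mul_bounded_linear)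

section \<open>Bounded subadditive and Birkhoff ergodic theorems\<close>

locale ergodic_system = prob_space M for M :: "'a measure" +
  fixes T :: "'a \<Rightarrow> 'a"
  assumes inv_erg: "invariant_ergodic M T"
begin

lemma T_measurable [measurable]: "T \<in> measurable M M"
  and distr_T: "distr M M T = M"
  using inv_erg by (auto simp: invariant_ergodic_def)

lemma T_pow_measurable [measurable]: "(T ^^ n) \<in> measurable M M"
  by (rule measurable_compose_n) (rule T_measurable)

lemma T_space: "x \<in> space M \<Longrightarrow> (T ^^ n) x \<in> space M"
  by (rule measurable_space[OF T_pow_measurable])

lemma distr_T_pow: "distr M M (T ^^ n) = M"
proof (induction n)
  case 0
  show ?case by (simp add: distr_id id_def)
next
  case (Suc n)
  have "distr M M (T \<circ> T ^^ n) = distr (distr M M (T ^^ n)) M T"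
    by (simp only: distr_distr[OF T_measurable T_pow_measurable])
  then show ?case using Suc distr_T by (simp only: funpow.simps)
qed

lemma integral_T_pow:
  fixes f :: "'a \<Rightarrow> real"
  assumes "f \<in> borel_measurable M"
  shows "(\<integral>x. f ((T ^^ n) x) \<partial>M) = (\<integral>x. f x \<partial>M)"
  using integral_distr[OF T_pow_measurable assms, of n] distr_T_pow by simp

lemma prob_T_vimage:
  assumes "B \<in> sets M" shows "prob (T -` B \<inter> space M) = prob B"
  using measure_distr[OF T_measurable assms] distr_T by simp

lemma AE_T_pow:
  assumes "AE x in M. P x" shows "AE x in M. P ((T ^^ n) x)"
proof -
  have "AE x in distr M M (T ^^ n). P x" using assms unfolding distr_T_pow .
  then show ?thesis by (rule AE_distrD[OF T_pow_measurable])
qed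

text \<open>The iterated preimages of \<open>B\<close> increase and all have the measure of
  \<open>B\<close>. Their union is strictly invariant, so ergodicity applies to it.\<close>

lemma prob_01_of_subinvariant:
  assumes B: "B \<in> sets M" and sub: "B \<subseteq> T -` B \<inter> space M"
  shows "prob B = 0 \<or> prob B = 1"
proof -
  define U where "U n = (T ^^ n) -` B \<inter> space M" for n
  have U: "U n \<in> sets M" for n unfolding U_def using B by measurable
  have USuc: "U (Suc n) = T -` U n \<inter> space M" for n
    using measurable_space[OF T_measurable] by (auto simp: U_def funpow_swap1)
  have "U n \<subseteq> U (Suc n)" for n using sub by (auto simp: U_def)
  then have inc: "incseq U" by (simp add: incseq_SucI)
  have pU: "prob (U n) = prob B" for n
  proof (induction n)
    case 0 then show ?case using sets.sets_into_space[OF B] by (simp add: U_def Int_absorb2)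
  next
    case (Suc n) then show ?case using prob_T_vimage[OF U] by (simp add: USuc)
  qed
  have "(\<lambda>n. prob (U n)) \<longlonglongrightarrow> prob (\<Union>n. U n)"
    by (rule finite_Lim_measure_incseq) (use U inc in auto)
  then have "prob (\<Union>n. U n) = prob B" by (simp add: pU LIMSEQ_const_iff)
  moreover have "T -` (\<Union>n. U n) \<inter> space M = (\<Union>n. U n)"
  proof -
    have "T -` (\<Union>n. U n) \<inter> space M = (\<Union>n. U (Suc n))" by (auto simp: USuc)
    also have "\<dots> = (\<Union>n. U n)"
      using \<open>\<And>n. U n \<subseteq> U (Suc n)\<close> by blast
    finally show ?thesis .
  qed
  moreover have "(\<Union>n. U n) \<in> sets M" using U by blast
  ultimately show ?thesis using inv_erg unfolding invariant_ergodic_def by metis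
qed

end

lemma sum_lessThan_add: "(\<Sum>k<l + m. f k) = (\<Sum>k<l. f k) + (\<Sum>k<m. f (k + l))"
  for f :: "nat \<Rightarrow> real"
  by (induction m) (simp_all add: algebra_simps)

text \<open>The greedy decomposition in the Katznelson--Weiss proof of Kingman's theorem: outside \<open>B\<close> jump
  ahead by a good block, inside \<open>B\<close> by a single step.\<close>

lemma subadditive_greedy:
  fixes g :: "nat \<Rightarrow> 'a \<Rightarrow> real" and L t :: real
  assumes inv: "\<And>x. x \<in> X \<Longrightarrow> T x \<in> X"
    and le: "\<And>n x. x \<in> X \<Longrightarrow> g n x \<le> L * n"
    and sub: "\<And>m n x. x \<in> X \<Longrightarrow> g (m + n) x \<le> g m x + g n ((T ^^ m) x)"
    and good: "\<And>x. x \<in> X \<Longrightarrow> x \<notin> B \<Longrightarrow> \<exists>l\<in>{1..N}. g l x \<le> l * t"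
    and "0 \<le> t" "0 \<le> L" "x \<in> X"
  shows "g n x \<le> n * t + L * (\<Sum>k<n. indicator B ((T ^^ k) x)) + L * N"
  using \<open>x \<in> X\<close>
proof (induction n arbitrary: x rule: less_induct)
  case (less n)
  have invn: "(T ^^ k) x \<in> X" for k
    by (induction k) (auto simp: inv less.prems)
  have ind: "0 \<le> (\<Sum>k<m. indicator B ((T ^^ k) y) :: real)" for m y
    by (intro sum_nonneg) simp
  have split: "(\<Sum>k<n. indicator B ((T ^^ k) x) :: real) =
      (\<Sum>k<l. indicator B ((T ^^ k) x)) + (\<Sum>k<n-l. indicator B ((T ^^ k) ((T ^^ l) x)))"
    if "l \<le> n" for l
  proof -
    have "(\<Sum>k<n. indicator B ((T ^^ k) x) :: real) = (\<Sum>k<l + (n-l). indicator B ((T ^^ k) x))"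
      using that by simp
    also have "\<dots> = (\<Sum>k<l. indicator B ((T ^^ k) x)) + (\<Sum>k<n-l. indicator B ((T ^^ (k + l)) x))"
      by (rule sum_lessThan_add)
    finally show ?thesis by (simp add: funpow_add)
  qed
  show ?case
  proof (cases "n \<le> N")
    case True
    have "g n x \<le> L * n" using le less.prems .
    also have "\<dots> \<le> L * N" using True \<open>0 \<le> L\<close> by (simp add: mult_left_mono)
    finally show ?thesis using ind[where m=n and y=x] \<open>0 \<le> t\<close> \<open>0 \<le> L\<close>
      by (smt (verit) mult_nonneg_nonneg of_nat_0_le_iff)
  next
    case False
    \<comment> \<open>\<open>max 1 N\<close> rather than \<open>N\<close>: the single step taken
      inside \<open>B\<close> must be admissible also when \<open>N = 0\<close>.\<close>
    obtain l where l: "l \<in> {1..max 1 N}" and gl: "g l x \<le> l * t + L * (\<Sum>k<l. indicator B ((T ^^ k) x))"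
    proof (cases "x \<in> B")
      case True
      have "g 1 x \<le> 1 * t + L * (\<Sum>k<1. indicator B ((T ^^ k) x))"
        using le[OF less.prems, of 1] \<open>0 \<le> t\<close> True by simp
      then show ?thesis using that[of 1] by simp
    next
      case False
      then obtain l where "l \<in> {1..N}" "g l x \<le> l * t" using good less.prems by blast
      moreover from this have "g l x \<le> l * t + L * (\<Sum>k<l. indicator B ((T ^^ k) x))"
        using ind[where m=l and y=x] \<open>0 \<le> L\<close> by (smt (verit) mult_nonneg_nonneg)
      ultimately show ?thesis using that[of l] by auto
    qed
    have ln: "1 \<le> l" "l \<le> n" using l False by auto
    have "g n x \<le> g l x + g (n - l) ((T ^^ l) x)"
      using sub[OF less.prems, of l "n - l"] ln by simp
    also have "g (n - l) ((T ^^ l) x) \<le>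
        (n - l) * t + L * (\<Sum>k<n-l. indicator B ((T ^^ k) ((T ^^ l) x))) + L * N"
      using less.IH[of "n - l" "(T ^^ l) x"] ln invn by simp
    finally show ?thesis using gl ln by (simp add: split[OF ln(2)] algebra_simps of_nat_diff)
  qed
qed

locale bounded_subadditive = ergodic_system +
  fixes g :: "nat \<Rightarrow> 'a \<Rightarrow> real" and L :: real
  assumes g_measurable [measurable]: "\<And>n. g n \<in> borel_measurable M"
    and g_nonneg: "\<And>n x. x \<in> space M \<Longrightarrow> 0 \<le> g n x"
    and g_le: "\<And>n x. x \<in> space M \<Longrightarrow> g n x \<le> L * n"
    and g_sub: "\<And>m n x. x \<in> space M \<Longrightarrow> g (m + n) x \<le> g m x + g n ((T ^^ m) x)"
begin

lemma L_nonneg: "0 \<le> L"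
proof -
  obtain x where "x \<in> space M" using not_empty by blast
  then show ?thesis using g_nonneg[of x 1] g_le[of x 1] by simp
qed

definition low :: "'a \<Rightarrow> ereal" where
  "low x = liminf (\<lambda>n. ereal (g n x / n))"

lemma low_measurable [measurable]: "low \<in> borel_measurable M"
  unfolding low_def by measurable

text \<open>Dropping the first iterate costs at most \<open>L\<close>, which disappears after
  division by n. Subadditivity gives this direction only, which is why the zero-one law is proved
  for subinvariant sets.\<close>

lemma low_subinvariant:
  assumes x: "x \<in> space M" shows "low x \<le> low (T x)"
proof -
  have "ereal (g (Suc n) x / Suc n) \<le> ereal (L / Suc n) + ereal (g n (T x) / n)" for n
  proof -
    have "g (Suc n) x \<le> L + g n (T x)"
      using g_sub[OF x, of 1 n] g_le[OF x, of 1] by simp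
    then have "g (Suc n) x / Suc n \<le> L / Suc n + g n (T x) / Suc n"
      by (simp add: divide_right_mono flip: add_divide_distrib)
    \<comment> \<open>Division by zero yields 0, so index 0 is treated apart: \<open>g 0\<close> is
      squeezed between 0 and \<open>L * 0\<close>.\<close>
    also have "g n (T x) / Suc n \<le> g n (T x) / n"
    proof (cases "n = 0")
      case True
      have "T x \<in> space M" using T_space[OF x, of 1] by simp
      then have "g 0 (T x) = 0" using g_nonneg[of "T x" 0] g_le[of "T x" 0] by simp
      then show ?thesis using True by simp
    next
      case False
      then show ?thesis
        using g_nonneg[of "T x" n] T_space[OF x, of 1] by (intro divide_left_mono) auto
    qed
    finally show ?thesis by simp
  qed
  then have "liminf (\<lambda>n. ereal (g (Suc n) x / Suc n)) \<le>
      liminf (\<lambda>n. ereal (L / Suc n) + ereal (g n (T x) / n))"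
    by (intro Liminf_mono) simp
  also have "\<dots> = 0 + low (T x)"
    unfolding low_def
  proof (rule ereal_liminf_lim_add)
    show "(\<lambda>n. ereal (L / Suc n)) \<longlonglongrightarrow> 0"
      unfolding zero_ereal_def lim_ereal by real_asymp
  qed simp
  finally show ?thesis
    unfolding low_def using liminf_shift[of "\<lambda>n. ereal (g n x / n)"] by simp
qed

lemma low_nonneg:
  assumes "x \<in> space M" shows "0 \<le> low x"
  unfolding low_def by (rule Liminf_bounded) (use assms in \<open>simp add: g_nonneg\<close>)

lemma low_le:
  assumes x: "x \<in> space M" shows "low x \<le> L"
proof -
  have "low x \<le> liminf (\<lambda>n. ereal L)"
    unfolding low_def
  proof (rule Liminf_mono, rule always_eventually, rule allI)
    fix n show "ereal (g n x / n) \<le> ereal L"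
      using g_le[OF x, of n] L_nonneg by (cases "n = 0") (auto simp: divide_le_eq)
  qed
  then show ?thesis by (simp add: Liminf_const)
qed

text \<open>Superlevel sets of \<open>low\<close> are subinvariant, hence of measure 0 or 1. The
  constant is the supremum of the levels of measure 1.\<close>

lemma low_constant:
  obtains c where "0 \<le> c" "\<And>t. t < c \<Longrightarrow> AE x in M. ereal t < low x"
    "\<And>t. c < t \<Longrightarrow> AE x in M. low x \<le> ereal t"
proof -
  define V where "V t = {x \<in> space M. ereal t < low x}" for t :: real
  have V [measurable]: "V t \<in> sets M" for t unfolding V_def by measurable
  have V01: "prob (V t) = 0 \<or> prob (V t) = 1" for t
  proof (rule prob_01_of_subinvariant[OF V])
    show "V t \<subseteq> T -` V t \<inter> space M"
      using low_subinvariant T_space[of _ 1] by (auto simp: V_def intro: less_le_trans)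
  qed
  define S where "S = {t. prob (V t) = 1}"
  have ub: "t \<le> L" if "t \<in> S" for t
  proof (rule ccontr)
    assume "\<not> t \<le> L"
    then have "\<not> ereal t < low x" if "x \<in> space M" for x
      using low_le[OF that] by (metis ereal_less_eq(3) leD order_less_le_trans order_less_imp_le)
    then have "V t = {}" by (auto simp: V_def)
    then show False using that by (simp add: S_def)
  qed
  have neg: "t \<in> S" if "t < 0" for t
  proof -
    have "V t = space M" using low_nonneg that by (auto simp: V_def intro: less_le_trans[of _ 0])
    then show ?thesis by (simp add: S_def prob_space)
  qed
  have bdd: "bdd_above S" using ub by (rule bdd_aboveI)
  have ne: "S \<noteq> {}" using neg[of "-1"] by auto
  show thesis
  proof (rule that[of "Sup S"])
    show "0 \<le> Sup S"
    proof (rule field_le_epsilon)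
      fix e :: real assume "0 < e"
      then have "- e \<le> Sup S" by (intro cSup_upper neg bdd) simp
      then show "0 \<le> Sup S + e" by simp
    qed
    show "AE x in M. ereal t < low x" if t: "t < Sup S" for t
    proof -
      obtain s where "s \<in> S" "t < s" by (rule less_cSupE[OF t ne])
      then have "AE x in M. x \<in> V s" by (simp add: S_def prob_eq_1)
      then show ?thesis
      proof eventually_elim
        case (elim x)
        then show ?case using \<open>t < s\<close> by (auto simp: V_def intro: less_trans[of _ "ereal s"])
      qed
    qed
    show "AE x in M. low x \<le> ereal t" if "Sup S < t" for t
    proof -
      have "t \<notin> S" using that cSup_upper[OF _ bdd] by fastforce
      then have "prob (V t) = 0" using V01 by (auto simp: S_def)
      then have "AE x in M. x \<notin> V t" by (simp add: prob_eq_0)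
      moreover have "AE x in M. x \<in> space M" by simp
      ultimately show ?thesis by eventually_elim (auto simp: V_def)
    qed
  qed
qed

text \<open>The set \<open>B N\<close> consists of the points without a block of length at most
  \<open>N\<close> whose average is close to the liminf. These sets decrease to a null set, so one
  of them is small, and the greedy decomposition is run with it.\<close>

lemma two_sided_bounds:
  obtains c where "0 \<le> c" "\<And>t. t < c \<Longrightarrow> AE x in M. ereal t < low x"
    "\<And>e. 0 < e \<Longrightarrow> \<exists>B N. B \<in> sets M \<and> prob B < e \<and>
      (\<forall>x\<in>space M. \<forall>n. g n x \<le> n * (c + e) + L * (\<Sum>k<n. indicator B ((T ^^ k) x)) + L * real N)"
proof -
  obtain c where c: "0 \<le> c" "\<And>t. t < c \<Longrightarrow> AE x in M. ereal t < low x"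
    "\<And>t. c < t \<Longrightarrow> AE x in M. low x \<le> ereal t"
    using low_constant by blast
  show thesis
  proof (rule that[OF c(1,2)])
    fix e :: real assume e: "0 < e"
    define B where "B N = {x \<in> space M. \<forall>l\<in>{1..N}. l * (c + e) < g l x}" for N :: nat
    have B [measurable]: "B N \<in> sets M" for N unfolding B_def by measurable
    have "(\<lambda>N. prob (B N)) \<longlonglongrightarrow> prob (\<Inter>N. B N)"
      by (rule finite_Lim_measure_decseq) (auto simp: B_def decseq_def)
    moreover have "prob (\<Inter>N. B N) = 0"
    proof -
      have "AE x in M. low x \<le> ereal (c + e/2)" using c(3)[of "c + e/2"] e by simp
      then have "AE x in M. x \<notin> (\<Inter>N. B N)"
      proof eventually_elim
        case (elim x)
        show ?case
        proof
          assume "x \<in> (\<Inter>N. B N)"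
          then have "\<forall>l\<in>{1..N}. l * (c + e) < g l x" for N
            unfolding B_def by blast
          then have *: "l * (c + e) < g l x" if "1 \<le> l" for l :: nat
            using that by (meson atLeastAtMost_iff order_refl)
          have "ereal (c + e) \<le> low x"
            unfolding low_def
          proof (rule Liminf_bounded, rule eventually_sequentiallyI[of 1])
            fix l :: nat assume "1 \<le> l"
            then show "ereal (c + e) \<le> ereal (g l x / l)"
              using *[of l] by (simp add: field_simps)
          qed
          then have "ereal (c + e) \<le> ereal (c + e/2)" using elim by (rule order_trans)
          then show False using e by simp
        qed
      qed
      then show ?thesis by (subst prob_eq_0) auto
    qed
    ultimately have "\<forall>\<^sub>F N in sequentially. prob (B N) < e"
      using order_tendstoD(2) e by metis
    then obtain N where N: "prob (B N) < e" by (auto simp: eventually_sequentially)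
    have "g n x \<le> n * (c + e) + L * (\<Sum>k<n. indicator (B N) ((T ^^ k) x)) + L * N"
      if "x \<in> space M" for n x
    proof (rule subadditive_greedy[of "space M"])
      show "\<exists>l\<in>{1..N}. g l y \<le> l * (c + e)" if "y \<in> space M" "y \<notin> B N" for y
        using that by (auto simp: B_def not_less)
    qed (use that T_space[of _ 1] g_le g_sub L_nonneg c(1) e in auto)
    then show "\<exists>B N. B \<in> sets M \<and> prob B < e \<and>
      (\<forall>x\<in>space M. \<forall>n. g n x \<le> n * (c + e) + L * (\<Sum>k<n. indicator B ((T ^^ k) x)) + L * real N)"
      using B N by blast
  qed
qed

end

section \<open>Birkhoff averages and recurrence\<close>

context ergodic_system
begin

text \<open>Birkhoff sums are additive, hence subadditive. Integrating their greedy upper bound and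
  dividing by n shows that the integral does not exceed the almost sure value of the liminf. This
  precedes the subadditive theorem, which needs the visit frequency of the bad set.\<close>

lemma birkhoff_lower:
  fixes f :: "'a \<Rightarrow> real"
  assumes f [measurable]: "f \<in> borel_measurable M"
    and bd: "\<And>x. x \<in> space M \<Longrightarrow> 0 \<le> f x \<and> f x \<le> L" and "0 < e"
  shows "AE x in M. \<forall>\<^sub>F n in sequentially. (\<integral>y. f y \<partial>M) - e < (\<Sum>k<n. f ((T ^^ k) x)) / n"
proof -
  define g where "g n x = (\<Sum>k<n. f ((T ^^ k) x))" for n x
  interpret bounded_subadditive M T g L
  proof
    show "g n x \<le> L * n" if "x \<in> space M" for n x
      using sum_bounded_above[of "{..<n}" "\<lambda>k. f ((T ^^ k) x)" L] bd T_space[OF that]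
      by (simp add: g_def mult.commute)
    show "g (m + n) x \<le> g m x + g n ((T ^^ m) x)" for m n x
      by (simp add: g_def sum_lessThan_add funpow_add)
    show "g n \<in> borel_measurable M" for n unfolding g_def by measurable
    show "0 \<le> g n x" if "x \<in> space M" for n x
      unfolding g_def using bd T_space[OF that] by (simp add: sum_nonneg)
  qed
  obtain c where c: "\<And>t. t < c \<Longrightarrow> AE x in M. ereal t < low x"
    "\<And>e. 0 < e \<Longrightarrow> \<exists>B N. B \<in> sets M \<and> prob B < e \<and>
      (\<forall>x\<in>space M. \<forall>n. g n x \<le> n * (c + e) + L * (\<Sum>k<n. indicator B ((T ^^ k) x)) + L * real N)"
    using two_sided_bounds by metis
  have intf: "integrable M f"
    by (rule integrable_const_bound[of _ L]) (use bd in auto)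
  have intfT: "integrable M (\<lambda>x. f ((T ^^ k) x))" for k
    by (rule integrable_const_bound[of _ L]) (use bd T_space in auto)
  have "(\<integral>y. f y \<partial>M) \<le> c + (1 + L) * e'" if e': "0 < e'" for e'
  proof -
    obtain B N where B [measurable]: "B \<in> sets M" and pB: "prob B < e'"
      and gb: "\<And>x n. x \<in> space M \<Longrightarrow> g n x \<le> n * (c + e') + L * (\<Sum>k<n. indicator B ((T ^^ k) x)) + L * real N"
      using c(2)[OF e'] by blast
    have intB: "integrable M (\<lambda>x. indicat_real B ((T ^^ k) x))" for k
      by (rule integrable_const_bound[of _ 1]) auto
    have "n * (\<integral>y. f y \<partial>M) \<le> n * (c + e') + L * (n * prob B) + L * N" for n :: nat
    proof -
      have "n * (\<integral>y. f y \<partial>M) = (\<integral>x. g n x \<partial>M)"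
        by (simp add: g_def Bochner_Integration.integral_sum intfT integral_T_pow)
      also have "\<dots> \<le> (\<integral>x. n * (c + e') + L * (\<Sum>k<n. indicator B ((T ^^ k) x)) + L * real N \<partial>M)"
      proof (rule integral_mono)
        show "integrable M (g n)" unfolding g_def by (intro Bochner_Integration.integrable_sum intfT)
        show "integrable M (\<lambda>x. n * (c + e') + L * (\<Sum>k<n. indicator B ((T ^^ k) x)) + L * real N)"
          by (intro Bochner_Integration.integrable_add integrable_mult_right Bochner_Integration.integrable_sum intB integrable_const)
      qed (rule gb)
      also have "\<dots> = n * (c + e') + L * (\<Sum>k<n. \<integral>x. indicator B ((T ^^ k) x) \<partial>M) + L * N"
        by (simp add: intB prob_space Bochner_Integration.integral_sum)
      also have "(\<Sum>k<n. \<integral>x. indicator B ((T ^^ k) x) \<partial>M) = n * prob B"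
        using integral_T_pow[of "indicat_real B"] by simp
      finally show ?thesis .
    qed
    then have "(\<integral>y. f y \<partial>M) \<le> c + e' + L * prob B + L * N / n" if "0 < n" for n :: nat
      using that by (simp add: field_simps)
    then have "\<forall>n\<ge>1. (\<integral>y. f y \<partial>M) \<le> c + e' + L * prob B + L * N / real n" by simp
    moreover have "(\<lambda>n. c + e' + L * prob B + L * N / real n) \<longlonglongrightarrow> c + e' + L * prob B + 0"
      by (intro tendsto_add tendsto_const) real_asymp
    ultimately have "(\<integral>y. f y \<partial>M) \<le> c + e' + L * prob B + 0"
      by (intro LIMSEQ_le_const) auto
    also have "\<dots> \<le> c + (1 + L) * e'"
      using pB L_nonneg by (simp add: algebra_simps mult_left_mono)
    finally show ?thesis .
  qed
  note bound = this
  have le: "(\<integral>y. f y \<partial>M) \<le> c"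
  proof (rule field_le_epsilon)
    fix d :: real assume d: "0 < d"
    have "0 < d / (1 + L)" "(1 + L) * (d / (1 + L)) = d" using d L_nonneg by (auto simp: field_simps)
    then show "(\<integral>y. f y \<partial>M) \<le> c + d" using bound[of "d / (1 + L)"] by metis
  qed
  have "(\<integral>y. f y \<partial>M) - e < c" using le \<open>0 < e\<close> by linarith
  then have "AE x in M. ereal ((\<integral>y. f y \<partial>M) - e) < low x" by (rule c(1))
  then show ?thesis
  proof eventually_elim
    case (elim x)
    then show ?case
      unfolding low_def by (auto dest!: less_LiminfD simp: g_def)
  qed
qed

text \<open>The lower bound is applied to \<open>f\<close> and to \<open>L - f\<close>, which again
  takes values between 0 and \<open>L\<close>.\<close>

lemma birkhoff_bounded:
  fixes f :: "'a \<Rightarrow> real"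
  assumes f [measurable]: "f \<in> borel_measurable M"
    and bd: "\<And>x. x \<in> space M \<Longrightarrow> 0 \<le> f x \<and> f x \<le> L"
  shows "AE x in M. (\<lambda>n. (\<Sum>k<n. f ((T ^^ k) x)) / n) \<longlonglongrightarrow> (\<integral>y. f y \<partial>M)"
proof -
  define I where "I = (\<integral>y. f y \<partial>M)"
  have int: "integrable M f"
    by (rule integrable_const_bound[of _ L]) (use bd in auto)
  have I2: "(\<integral>y. L - f y \<partial>M) = L - I" using int by (simp add: I_def prob_space)
  have "AE x in M. \<forall>j. (\<forall>\<^sub>F n in sequentially. I - inverse (Suc j) < (\<Sum>k<n. f ((T ^^ k) x)) / n)
      \<and> (\<forall>\<^sub>F n in sequentially. L - I - inverse (Suc j) < (\<Sum>k<n. L - f ((T ^^ k) x)) / n)"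
    unfolding AE_all_countable
  proof (intro allI AE_conjI)
    fix j
    show "AE x in M. \<forall>\<^sub>F n in sequentially. I - inverse (Suc j) < (\<Sum>k<n. f ((T ^^ k) x)) / n"
      unfolding I_def by (rule birkhoff_lower[OF f bd]) auto
    show "AE x in M. \<forall>\<^sub>F n in sequentially. L - I - inverse (Suc j) < (\<Sum>k<n. L - f ((T ^^ k) x)) / n"
      unfolding I2[symmetric] by (rule birkhoff_lower[where L=L]) (use bd in auto)
  qed
  then show ?thesis
    unfolding I_def[symmetric]
  proof eventually_elim
    case (elim x)
    show ?case
    proof (rule LIMSEQ_I)
      fix r :: real assume "0 < r"
      then obtain j where j: "inverse (Suc j) < r" using reals_Archimedean by blast
      have "\<forall>\<^sub>F n in sequentially. norm ((\<Sum>k<n. f ((T ^^ k) x)) / n - I) < r"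
        using elim[rule_format, of j, THEN conjunct1] elim[rule_format, of j, THEN conjunct2]
          eventually_gt_at_top[of 0]
      proof eventually_elim
        case (elim n)
        then have "(\<Sum>k<n. L - f ((T ^^ k) x)) / n = L - (\<Sum>k<n. f ((T ^^ k) x)) / n"
          by (simp add: sum_subtractf field_simps)
        then show ?case using elim j by auto
      qed
      then show "\<exists>no. \<forall>n\<ge>no. norm ((\<Sum>k<n. f ((T ^^ k) x)) / n - I) < r"
        by (simp add: eventually_sequentially)
    qed
  qed
qed

text \<open>Finitely many visits would give visit frequency 0, while the ergodic averages of the
  indicator converge to \<open>prob B\<close>.\<close>

lemma AE_infinitely_often:
  assumes B [measurable]: "B \<in> sets M" and pos: "0 < prob B"
  shows "AE x in M. infinite {k. (T ^^ k) x \<in> B}"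
proof -
  have "AE x in M. (\<lambda>n. (\<Sum>k<n. indicator B ((T ^^ k) x)) / n) \<longlonglongrightarrow> (\<integral>y. indicat_real B y \<partial>M)"
    by (rule birkhoff_bounded[where L=1]) auto
  then show ?thesis
  proof eventually_elim
    case (elim x)
    show ?case
    proof
      assume fin: "finite {k. (T ^^ k) x \<in> B}"
      define K where "K = real (card {k. (T ^^ k) x \<in> B})"
      have "(\<lambda>n. (\<Sum>k<n. indicator B ((T ^^ k) x)) / n) \<longlonglongrightarrow> (0::real)"
      proof (rule tendsto_sandwich[OF _ _ tendsto_const])
        show "\<forall>\<^sub>F n in sequentially. 0 \<le> (\<Sum>k<n. indicat_real B ((T ^^ k) x)) / n"
          by (intro always_eventually allI divide_nonneg_nonneg sum_nonneg) auto
        have "(\<Sum>k<n. indicat_real B ((T ^^ k) x)) \<le> K" for n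
        proof -
          have "(\<Sum>k<n. indicat_real B ((T ^^ k) x)) = card ({..<n} \<inter> {k. (T ^^ k) x \<in> B})"
            by (simp add: indicator_def sum.If_cases)
          also have "\<dots> \<le> K" unfolding K_def of_nat_le_iff by (intro card_mono fin) auto
          finally show ?thesis .
        qed
        then show "\<forall>\<^sub>F n in sequentially. (\<Sum>k<n. indicat_real B ((T ^^ k) x)) / n \<le> K / n"
          by (intro always_eventually allI divide_right_mono) auto
        show "(\<lambda>n. K / real n) \<longlonglongrightarrow> 0" by real_asymp
      qed
      then have "(\<integral>y. indicat_real B y \<partial>M) = 0" using elim LIMSEQ_unique by blast
      then show False using pos by simp
    qed
  qed
qed

text \<open>One set of a countable cover has positive measure. Applied to the sets where a bound
  holds with constant j, it turns constants depending on the point into one constant valid at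
  infinitely many times of almost every orbit.\<close>

lemma recurrence:
  assumes S: "\<And>j::nat. S j \<in> sets M" and cover: "AE x in M. \<exists>j. x \<in> S j"
  shows "\<exists>j. AE x in M. infinite {k. (T ^^ k) x \<in> S j}"
proof -
  have "\<exists>j. 0 < prob (S j)"
  proof (rule ccontr)
    assume "\<nexists>j. 0 < prob (S j)"
    then have "prob (S j) = 0" for j using measure_nonneg[of M "S j"] by (metis antisym_conv2)
    then have "AE x in M. x \<notin> S j" for j using S prob_eq_0 by blast
    then have "AE x in M. \<forall>j. x \<notin> S j" by (simp add: AE_all_countable)
    with cover have "AE x in M. False" by eventually_elim blast
    then show False by simp
  qed
  then show ?thesis using AE_infinitely_often S by blast
qed

end

text \<open>The lower bound is the one for \<open>low\<close>. For the upper bound, the ergodic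
  theorem replaces the visit counts in the greedy estimate by \<open>prob B\<close>, which is as
  small as desired.\<close>

theorem (in bounded_subadditive) subadditive_ergodic:
  obtains c where "0 \<le> c" "AE x in M. (\<lambda>n. g n x / n) \<longlonglongrightarrow> c"
    "(\<lambda>n. (\<integral>x. g n x \<partial>M) / n) \<longlonglongrightarrow> c"
proof -
  obtain c where c: "0 \<le> c" "\<And>t. t < c \<Longrightarrow> AE x in M. ereal t < low x"
    "\<And>e. 0 < e \<Longrightarrow> \<exists>B N. B \<in> sets M \<and> prob B < e \<and>
      (\<forall>x\<in>space M. \<forall>n. g n x \<le> n * (c + e) + L * (\<Sum>k<n. indicator B ((T ^^ k) x)) + L * real N)"
    using two_sided_bounds by metis
  have up: "AE x in M. \<forall>\<^sub>F n in sequentially. g n x / n < c + d" if d: "0 < d" for d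
  proof -
    \<comment> \<open>Chosen such that (1 + L) e < d: one e for the block averages and at most L e
      for the visits to \<open>B\<close>.\<close>
    define e where "e = d / (2 * (2 + L))"
    have e: "0 < e" using d L_nonneg by (simp add: e_def)
    obtain B N where B [measurable]: "B \<in> sets M" and pB: "prob B < e"
      and gb: "\<And>x n. x \<in> space M \<Longrightarrow> g n x \<le> n * (c + e) + L * (\<Sum>k<n. indicator B ((T ^^ k) x)) + L * real N"
      using c(3)[OF e] by blast
    have lt: "c + e + L * prob B + 0 < c + d"
    proof -
      have "e + L * prob B \<le> (1 + L) * e" using pB L_nonneg by (simp add: algebra_simps mult_left_mono)
      also have "\<dots> < (2 * (2 + L)) * e" using e L_nonneg by (intro mult_strict_right_mono) auto
      also have "\<dots> = d" using L_nonneg by (simp add: e_def)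
      finally show ?thesis by simp
    qed
    have "AE x in M. (\<lambda>n. (\<Sum>k<n. indicator B ((T ^^ k) x)) / n) \<longlonglongrightarrow> (\<integral>y. indicat_real B y \<partial>M)"
      by (rule birkhoff_bounded[where L=1]) auto
    moreover have "AE x in M. x \<in> space M" by simp
    ultimately show ?thesis
    proof eventually_elim
      case (elim x)
      have "(\<lambda>n. c + e + L * ((\<Sum>k<n. indicator B ((T ^^ k) x)) / n) + L * N / n) \<longlonglongrightarrow> c + e + L * prob B + 0"
      proof (intro tendsto_add tendsto_mult tendsto_const)
        show "(\<lambda>n. (\<Sum>k<n. indicator B ((T ^^ k) x)) / n) \<longlonglongrightarrow> prob B"
          using elim(1) B by simp
        show "(\<lambda>n. L * N / real n) \<longlonglongrightarrow> 0" by real_asymp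
      qed
      from order_tendstoD(2)[OF this lt] eventually_gt_at_top[of 0] show ?case
      proof eventually_elim
        case (elim n)
        have "g n x / n \<le> c + e + L * ((\<Sum>k<n. indicator B ((T ^^ k) x)) / n) + L * N / n"
          using gb[OF \<open>x \<in> space M\<close>, of n] elim(2) by (simp add: field_simps)
        then show ?case using elim(1) by linarith
      qed
    qed
  qed
  have "AE x in M. \<forall>j. ereal (c - inverse (Suc j)) < low x \<and> (\<forall>\<^sub>F n in sequentially. g n x / n < c + inverse (Suc j))"
    unfolding AE_all_countable by (intro allI AE_conjI c(2) up) auto
  then have lim: "AE x in M. (\<lambda>n. g n x / n) \<longlonglongrightarrow> c"
  proof eventually_elim
    case (elim x)
    show ?case
    proof (rule LIMSEQ_I)
      fix r :: real assume "0 < r"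
      then obtain j where j: "inverse (Suc j) < r" using reals_Archimedean by blast
      have "\<forall>\<^sub>F n in sequentially. c - inverse (Suc j) < g n x / n"
        using elim[rule_format, of j, THEN conjunct1] unfolding low_def by (auto dest!: less_LiminfD)
      with elim[rule_format, of j, THEN conjunct2]
      have "\<forall>\<^sub>F n in sequentially. norm (g n x / n - c) < r"
        by eventually_elim (use j in auto)
      then show "\<exists>no. \<forall>n\<ge>no. norm (g n x / n - c) < r"
        by (simp add: eventually_sequentially)
    qed
  qed
  \<comment> \<open>The quotients are bounded by \<open>L\<close>, so dominated convergence
    identifies \<open>c\<close> with the limit of the integrals, which is the form in which
    \<open>lyapunov\<close> is defined.\<close>
  have "(\<lambda>n. \<integral>x. g n x / n \<partial>M) \<longlonglongrightarrow> (\<integral>x. c \<partial>M)"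
  proof (rule integral_dominated_convergence[where w="\<lambda>x. L"])
    show "AE x in M. norm (g n x / n) \<le> L" for n
      using g_nonneg g_le[of _ n] L_nonneg by (cases "n = 0") (auto simp: divide_le_eq)
  qed (use lim in auto)
  then have "(\<lambda>n. (\<integral>x. g n x \<partial>M) / n) \<longlonglongrightarrow> c" by (simp add: prob_space)
  then show thesis using that c(1) lim by blast
qed

section \<open>The most contracted direction of a matrix product\<close>

text \<open>With the tail written as \<open>q ^ n - q ^ (n + k)\<close> the telescoping estimate
  goes through by induction on k. The rate is recorded along with the limit because
  \<open>stable_direction\<close> squares it.\<close>

lemma geometric_steps_converge:
  fixes x :: "nat \<Rightarrow> 'a::banach"
  assumes step: "\<And>n. n \<ge> n0 \<Longrightarrow> norm (x (Suc n) - x n) \<le> a * q ^ n"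
    and q: "0 < q" "q < 1"
  obtains l where "x \<longlonglongrightarrow> l" "\<And>n. n \<ge> n0 \<Longrightarrow> norm (x n - l) \<le> a / (1 - q) * q ^ n"
proof -
  have "0 \<le> a * q ^ n0" using order_trans[OF norm_ge_zero step[of n0]] by simp
  then have a: "0 \<le> a" using zero_less_power[OF q(1), of n0] by (simp add: zero_le_mult_iff)
  have bound: "norm (x (n + k) - x n) \<le> a / (1 - q) * (q ^ n - q ^ (n + k))" if "n \<ge> n0" for n k
  proof (induction k)
    case (Suc k)
    have "norm (x (n + Suc k) - x n) \<le> norm (x (Suc (n + k)) - x (n + k)) + norm (x (n + k) - x n)"
      using norm_triangle_ineq[of "x (Suc (n + k)) - x (n + k)" "x (n + k) - x n"] by simp
    also have "\<dots> \<le> a * q ^ (n + k) + a / (1 - q) * (q ^ n - q ^ (n + k))"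
      using step[of "n + k"] that Suc by (intro add_mono) auto
    also have "\<dots> = a / (1 - q) * (q ^ n - q ^ (n + Suc k))"
    proof -
      have "a * q ^ (n + k) = a / (1 - q) * ((1 - q) * q ^ (n + k))" using q by simp
      then show ?thesis by (simp add: algebra_simps)
    qed
    finally show ?case .
  qed simp
  have bound': "norm (x m - x n) \<le> a / (1 - q) * q ^ n" if "n \<ge> n0" "m \<ge> n" for n m
  proof -
    have "norm (x m - x n) \<le> a / (1 - q) * (q ^ n - q ^ m)"
      using bound[OF that(1), of "m - n"] that(2) by simp
    also have "\<dots> \<le> a / (1 - q) * q ^ n"
      using a q by (intro mult_left_mono) auto
    finally show ?thesis .
  qed
  have lim0: "(\<lambda>n. a / (1 - q) * q ^ n) \<longlonglongrightarrow> 0"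
    using q by (intro tendsto_mult_right_zero LIMSEQ_power_zero) auto
  have "Cauchy x"
  proof (rule metric_CauchyI)
    fix e :: real assume "0 < e"
    then have "\<forall>\<^sub>F n in sequentially. a / (1 - q) * q ^ n < e/2"
      by (intro order_tendstoD(2)[OF lim0]) simp
    then obtain N0 where N0: "\<And>n. n \<ge> N0 \<Longrightarrow> a / (1 - q) * q ^ n < e/2"
      by (auto simp: eventually_sequentially)
    define N where "N = max N0 n0"
    have "dist (x m) (x N) < e/2" if "m \<ge> N" for m
    proof -
      have "norm (x m - x N) \<le> a / (1 - q) * q ^ N" using bound'[of N m] that by (simp add: N_def)
      also have "\<dots> < e/2" using N0[of N] by (simp add: N_def)
      finally show ?thesis by (simp add: dist_norm)
    qed
    then show "\<exists>M. \<forall>m\<ge>M. \<forall>n\<ge>M. dist (x m) (x n) < e"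
      by (metis dist_triangle_half_l)
  qed
  then obtain l where l: "x \<longlonglongrightarrow> l" using Cauchy_convergent convergent_def by blast
  show thesis
  proof (rule that[OF l])
    fix n assume n: "n \<ge> n0"
    have "(\<lambda>m. norm (x m - x n)) \<longlonglongrightarrow> norm (l - x n)" by (intro tendsto_intros l)
    then have "norm (l - x n) \<le> a / (1 - q) * q ^ n"
      by (rule LIMSEQ_le_const2) (use bound'[OF n] in blast)
    then show "norm (x n - l) \<le> a / (1 - q) * q ^ n" by (simp add: norm_minus_commute)
  qed
qed

lemma exp_rate_bounds:
  fixes a :: "nat \<Rightarrow> real" and \<Lambda> \<delta> :: real
  assumes lim: "(\<lambda>n. ln (a n) / n) \<longlonglongrightarrow> \<Lambda>" and pos: "\<And>n. 0 < a n" and "0 < \<delta>"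
  shows "\<forall>\<^sub>F n in sequentially. exp (n * (\<Lambda> - \<delta>)) \<le> a n \<and> a n \<le> exp (n * (\<Lambda> + \<delta>))"
proof -
  have "\<forall>\<^sub>F n in sequentially. \<Lambda> - \<delta> < ln (a n) / n" "\<forall>\<^sub>F n in sequentially. ln (a n) / n < \<Lambda> + \<delta>"
    using order_tendstoD[OF lim] \<open>0 < \<delta>\<close> by auto
  then show ?thesis using eventually_gt_at_top[of 0]
proof eventually_elim
  case (elim n)
  then have "n * (\<Lambda> - \<delta>) \<le> ln (a n)" "ln (a n) \<le> n * (\<Lambda> + \<delta>)"
    by (simp_all add: field_simps)
  then have "exp (n * (\<Lambda> - \<delta>)) \<le> exp (ln (a n))" "exp (ln (a n)) \<le> exp (n * (\<Lambda> + \<delta>))"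
    by simp_all
  then show ?case using pos[of n] by simp
qed
qed

text \<open>The finitely many exceptional indices are absorbed by the sum of their ratios. The
  constant is a natural number so that \<open>recurrence\<close> can be applied to a countable
  family.\<close>

lemma eventually_le_imp_const_bound:
  fixes a b :: "nat \<Rightarrow> real"
  assumes ev: "\<forall>\<^sub>F n in sequentially. a n \<le> b n" and b: "\<And>n. 0 < b n"
  obtains j :: nat where "\<And>n. a n \<le> real (Suc j) * b n"
proof -
  obtain N where N: "\<And>n. n \<ge> N \<Longrightarrow> a n \<le> b n" using ev by (auto simp: eventually_sequentially)
  obtain j where j: "(\<Sum>n<N. \<bar>a n\<bar> / b n) \<le> real j" using real_arch_simple by blast
  show thesis
  proof (rule that[of j])
    fix n
    show "a n \<le> real (Suc j) * b n"
    proof (cases "n < N")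
      case True
      have "\<bar>a n\<bar> / b n \<le> (\<Sum>n<N. \<bar>a n\<bar> / b n)"
        by (rule member_le_sum) (use True b less_imp_le[OF b] in simp_all)
      then have "\<bar>a n\<bar> / b n \<le> real (Suc j)" using j by simp
      then show ?thesis using b[of n] by (simp add: divide_le_eq)
    next
      case False
      then have "a n \<le> b n" using N by simp
      also have "\<dots> \<le> real (Suc j) * b n" using b[of n] by (simp add: algebra_simps)
      finally show ?thesis .
    qed
  qed
qed

section \<open>Alignment and convergence of the most contracted directions\<close>

lemma sqn_ge_2:
  assumes "det P = 1" shows "2 \<le> sqn P"
proof (rule power2_le_imp_le[OF _ sqn_nonneg])
  have "0 \<le> (norm (dz P))\<^sup>2" by simp
  then show "2\<^sup>2 \<le> (sqn P)\<^sup>2" unfolding norm_dz_sq assms by simp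
qed

text \<open>For determinant 1, \<open>sqn P - norm (dz P)\<close> and
  \<open>sqn P + norm (dz P)\<close> have product 4. The first is twice the smaller squared singular
  value.\<close>

lemma sqn_minus_norm_dz:
  assumes "det P = 1" shows "sqn P - norm (dz P) \<le> 4 / sqn P"
proof -
  have "(sqn P - norm (dz P)) * (sqn P + norm (dz P)) = 4"
    using norm_dz_sq[of P] assms by (simp add: power2_eq_square algebra_simps)
  moreover have "(sqn P - norm (dz P)) * sqn P \<le> (sqn P - norm (dz P)) * (sqn P + norm (dz P))"
    using norm_dz_le[of P] by (intro mult_left_mono) auto
  ultimately show ?thesis using sqn_ge_2[OF assms] by (simp add: field_simps)
qed

text \<open>Rotations have \<open>sqn\<close> equal to 2 and \<open>dz\<close> equal to 0, so a
  distance from 2 is needed. From 3 on, the deficit is at most 4/3 and thus below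
  \<open>sqn P / 2\<close>.\<close>

lemma norm_dz_ge_half:
  assumes "det P = 1" "3 \<le> sqn P" shows "sqn P / 2 \<le> norm (dz P)"
proof -
  have "4 / sqn P \<le> 4 / 3" using assms(2) by (intro divide_left_mono) auto
  then show ?thesis using sqn_minus_norm_dz[OF assms(1)] assms(2) by linarith
qed

lemma exists_cis_4pi:
  assumes "norm w = 1" shows "\<exists>\<alpha>. w = cis (4*pi*\<alpha>)"
proof
  have "w \<noteq> 0" using assms by auto
  then show "w = cis (4*pi*(Arg w / (4*pi)))" using assms by (simp add: cis_Arg sgn_div_norm)
qed

lemma norm_diff_sq_unit:
  fixes z w :: "'a::real_inner"
  assumes "norm z = 1" "norm w = 1"
  shows "(norm (z - w))\<^sup>2 = 2 - 2 * (z \<bullet> w)"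
proof -
  have "z \<bullet> z = 1" "w \<bullet> w = 1" using assms by (simp_all add: dot_square_norm)
  moreover have "(norm (z - w))\<^sup>2 = z \<bullet> z - 2 * (z \<bullet> w) + w \<bullet> w"
    unfolding power2_norm_eq_inner inner_diff_left inner_diff_right by (simp add: inner_commute)
  ultimately show ?thesis by simp
qed

text \<open>Testing the one-step growth bound on the direction most contracted by \<open>P\<close>.\<close>

lemma sgn_dz_step:
  assumes P: "det P = 1" and Q: "det (B ** P) = 1" and C: "opnorm B \<le> C"
    and nz: "3 \<le> sqn P" "3 \<le> sqn (B ** P)"
  shows "(norm (sgn (dz (B ** P)) - sgn (dz P)))\<^sup>2 \<le> 16 * C\<^sup>2 / (sqn P * sqn (B ** P))"
proof -
  define z z' where "z = dz P" and "z' = dz (B ** P)"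
  have zpos: "0 < norm z" "0 < norm z'" "sqn (B ** P) / 2 \<le> norm z'"
    using norm_dz_ge_half[OF P nz(1)] norm_dz_ge_half[OF Q nz(2)] nz by (auto simp: z_def z'_def)
  have unit: "norm (sgn z) = 1" "norm (sgn z') = 1" using zpos by (auto simp: norm_sgn)
  obtain \<alpha> where \<alpha>: "- sgn z = cis (4*pi*\<alpha>)" using exists_cis_4pi[of "- sgn z"] unit by auto
  have C0: "0 \<le> C" using opnorm_nonneg[of B] C by linarith
  have zz: "z \<bullet> sgn z = norm z" "z' \<bullet> sgn z' = norm z'"
    using zpos by (auto simp: sgn_div_norm dot_square_norm power2_eq_square)
  have "norm ((B ** P) *v dir \<alpha>) \<le> C * norm (P *v dir \<alpha>)"
    using norm_mv_le[of B "P *v dir \<alpha>"] mult_right_mono[OF C, of "norm (P *v dir \<alpha>)"]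
    by (simp flip: matrix_vector_mul_assoc)
  then have "(norm ((B ** P) *v dir \<alpha>))\<^sup>2 \<le> C\<^sup>2 * (norm (P *v dir \<alpha>))\<^sup>2"
    by (metis norm_ge_zero power_mono power_mult_distrib)
  then have "sqn (B ** P) - z' \<bullet> sgn z \<le> C\<^sup>2 * (sqn P - norm z)"
    unfolding norm_mv_dir \<alpha>[symmetric] z_def[symmetric] z'_def[symmetric]
    by (simp add: zz)
  also have "\<dots> \<le> C\<^sup>2 * (4 / sqn P)"
    unfolding z_def by (intro mult_left_mono sqn_minus_norm_dz P) auto
  finally have "norm z' - z' \<bullet> sgn z \<le> 4 * C\<^sup>2 / sqn P"
    using norm_dz_le[of "B ** P"] by (simp add: z'_def mult.commute)
  moreover have "z' \<bullet> sgn z = norm z' * (sgn z' \<bullet> sgn z)"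
    using zpos by (simp add: sgn_div_norm)
  ultimately have "norm z' * (1 - sgn z' \<bullet> sgn z) \<le> 4 * C\<^sup>2 / sqn P"
    by (simp add: algebra_simps)
  moreover have "0 \<le> 1 - sgn z' \<bullet> sgn z"
    using norm_cauchy_schwarz[of "sgn z'" "sgn z"] unit by simp
  ultimately have "(sqn (B ** P) / 2) * (1 - sgn z' \<bullet> sgn z) \<le> 4 * C\<^sup>2 / sqn P"
    using mult_right_mono[OF zpos(3)] by (meson order_trans)
  then have "1 - sgn z' \<bullet> sgn z \<le> 8 * C\<^sup>2 / (sqn P * sqn (B ** P))"
    using nz by (simp add: field_simps)
  then show ?thesis using norm_diff_sq_unit[OF unit(2,1)] by (simp add: z_def z'_def)
qed

text \<open>The first term is the contribution of the smaller singular value. The second is the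
  error made by using the direction belonging to \<open>w\<close> instead of the most contracted
  one; it is quadratic in the misalignment.\<close>

lemma norm_mv_contracted_dir:
  assumes P: "det P = 1" and w: "norm w = 1" and \<alpha>: "cis (4*pi*\<alpha>) = - w" and nz: "3 \<le> sqn P"
  shows "(norm (P *v dir \<alpha>))\<^sup>2 \<le> 2 / sqn P + sqn P * (norm (sgn (dz P) - w))\<^sup>2 / 4"
proof -
  define z where "z = dz P"
  have zpos: "0 < norm z" using norm_dz_ge_half[OF P nz] nz by (auto simp: z_def)
  have u: "norm (sgn z) = 1" using zpos by (auto simp: norm_sgn)
  have zw: "z \<bullet> w = norm z * (sgn z \<bullet> w)" using zpos by (simp add: sgn_div_norm)
  have "(norm (P *v dir \<alpha>))\<^sup>2 = (sqn P - norm z) / 2 + norm z * (2 - 2 * (sgn z \<bullet> w)) / 4"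
    unfolding norm_mv_dir \<alpha> z_def[symmetric] by (simp add: zw field_simps)
  also have "\<dots> = (sqn P - norm z) / 2 + norm z * (norm (sgn z - w))\<^sup>2 / 4"
    by (simp add: norm_diff_sq_unit[OF u w])
  also have "\<dots> \<le> (4 / sqn P) / 2 + sqn P * (norm (sgn z - w))\<^sup>2 / 4"
    using sqn_minus_norm_dz[OF P] norm_dz_le[of P]
    by (intro add_mono divide_right_mono mult_right_mono) (auto simp: z_def)
  finally show ?thesis by (simp add: z_def)
qed

text \<open>Consecutive \<open>sgn (dz (P n))\<close> differ by a constant over \<open>sqn\<close>,
  about exp (- 2 n \<Lambda>), so they converge with that error. Squared and multiplied by
  \<open>sqn (P n)\<close>, about exp (2 n \<Lambda>), the misalignment term in
  \<open>norm_mv_contracted_dir\<close> is again about exp (- 2 n \<Lambda>).\<close>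

lemma stable_direction:
  fixes P B :: "nat \<Rightarrow> real^2^2" and \<Lambda> :: real
  assumes P: "\<And>n. P (Suc n) = B n ** P n" "\<And>n. det (P n) = 1" and C: "\<And>n. opnorm (B n) \<le> C"
    and lim: "(\<lambda>n. ln (opnorm (P n)) / n) \<longlonglongrightarrow> \<Lambda>" and \<Lambda>: "0 < \<Lambda>"
  obtains z where "(\<lambda>n. sgn (dz (P n))) \<longlonglongrightarrow> z" "norm z = 1"
    "\<And>\<alpha> e. cis (4*pi*\<alpha>) = - z \<Longrightarrow> 0 < e \<Longrightarrow>
      \<forall>\<^sub>F n in sequentially. norm (P n *v dir \<alpha>) \<le> exp (- (n * (\<Lambda> - e)))"
proof -
  define x where "x n = sgn (dz (P n))" for n
  have opos: "0 < opnorm (P n)" for n using opnorm_ge_1[OF P(2)[of n]] by linarith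
  have C1: "0 \<le> C" using opnorm_nonneg C order_trans by blast
  have T: "\<forall>\<^sub>F n in sequentially. exp (2 * (n * (\<Lambda> - \<delta>))) \<le> sqn (P n) \<and>
      sqn (P n) \<le> 2 * exp (2 * (n * (\<Lambda> + \<delta>)))" if "0 < \<delta>" for \<delta>
    using exp_rate_bounds[OF lim opos that]
  proof eventually_elim
    case (elim n)
    then have "(exp (n * (\<Lambda> - \<delta>)))\<^sup>2 \<le> (opnorm (P n))\<^sup>2" "(opnorm (P n))\<^sup>2 \<le> (exp (n * (\<Lambda> + \<delta>)))\<^sup>2"
      using opos[of n] by (auto intro!: power_mono)
    then show ?case using opnorm_sq_le_sqn[of "P n"] sqn_le_opnorm_sq[of "P n"] by (simp add: exp_double)
  qed
  \<comment> \<open>Limit and constant may depend on \<delta> here; uniqueness of limits later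
    identifies all the limits with one \<open>z\<close>.\<close>
  have rate: "\<exists>z K. x \<longlonglongrightarrow> z \<and> (\<forall>\<^sub>F n in sequentially. norm (x n - z) \<le> K * exp (- 2 * (n * (\<Lambda> - \<delta>))))"
    if \<delta>: "0 < \<delta>" "\<delta> < \<Lambda>" for \<delta>
  proof -
    define q where "q = exp (- 2 * (\<Lambda> - \<delta>))"
    have q: "0 < q" "q < 1" using \<delta> by (auto simp: q_def)
    have qn: "q ^ n = exp (- 2 * (n * (\<Lambda> - \<delta>)))" for n
      by (simp add: q_def algebra_simps flip: exp_of_nat_mult)
    have "filterlim (\<lambda>n. exp (2 * (real n * (\<Lambda> - \<delta>)))) at_top sequentially"
      using \<delta> by real_asymp
    then have "\<forall>\<^sub>F n in sequentially. 3 \<le> exp (2 * (real n * (\<Lambda> - \<delta>)))"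
      by (simp add: filterlim_at_top)
    with T[OF \<delta>(1)] have "\<forall>\<^sub>F n in sequentially. exp (2 * (n * (\<Lambda> - \<delta>))) \<le> sqn (P n) \<and> 3 \<le> sqn (P n)"
      by eventually_elim auto
    then obtain n0 where n0: "\<And>n. n \<ge> n0 \<Longrightarrow> exp (2 * (n * (\<Lambda> - \<delta>))) \<le> sqn (P n) \<and> 3 \<le> sqn (P n)"
      by (auto simp: eventually_sequentially)
    have "norm (x (Suc n) - x n) \<le> (4 * C) * q ^ n" if n: "n \<ge> n0" for n
    proof (rule power2_le_imp_le)
      have a: "exp (2 * (n * (\<Lambda> - \<delta>))) \<le> sqn (P n)" "3 \<le> sqn (P n)" "3 \<le> sqn (P (Suc n))"
        using n0 n by auto
      have "exp (2 * (n * (\<Lambda> - \<delta>))) \<le> exp (2 * (Suc n * (\<Lambda> - \<delta>)))"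
        using \<delta> by (simp add: mult_right_mono)
      also have "\<dots> \<le> sqn (P (Suc n))" using n0[of "Suc n"] n by simp
      finally have b: "exp (2 * (n * (\<Lambda> - \<delta>))) \<le> sqn (P (Suc n))" .
      have "(norm (x (Suc n) - x n))\<^sup>2 \<le> 16 * C\<^sup>2 / (sqn (P n) * sqn (P (Suc n)))"
        unfolding x_def P(1) by (rule sgn_dz_step) (use P(2)[of n] P(2)[of "Suc n"] P(1) C a in auto)
      also have "\<dots> \<le> 16 * C\<^sup>2 / (exp (2 * (n * (\<Lambda> - \<delta>))) * exp (2 * (n * (\<Lambda> - \<delta>))))"
        using a b by (intro divide_left_mono mult_mono mult_pos_pos) auto
      also have "\<dots> = ((4 * C) * q ^ n)\<^sup>2"
      proof -
        have "q ^ n = inverse (exp (2 * (n * (\<Lambda> - \<delta>))))" unfolding qn by (simp flip: exp_minus)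
        then show ?thesis by (simp add: power2_eq_square divide_inverse mult.assoc mult.left_commute)
      qed
      finally show "(norm (x (Suc n) - x n))\<^sup>2 \<le> ((4 * C) * q ^ n)\<^sup>2" .
    qed (use C1 q in simp)
    then obtain z where "x \<longlonglongrightarrow> z" "\<And>n. n \<ge> n0 \<Longrightarrow> norm (x n - z) \<le> 4 * C / (1 - q) * q ^ n"
      using geometric_steps_converge[OF _ q, of n0 x "4 * C"] by metis
    then show ?thesis unfolding qn by (meson eventually_sequentially)
  qed
  obtain z where z: "x \<longlonglongrightarrow> z" using rate[of "\<Lambda>/2"] \<Lambda> by auto
  \<comment> \<open>Since \<open>sgn 0 = 0\<close>, the limit is a unit vector only because
    \<open>dz (P n)\<close> is eventually nonzero.\<close>
  have "\<forall>\<^sub>F n in sequentially. 1 = norm (x n)"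
  proof -
    have "filterlim (\<lambda>n. exp (2 * (real n * (\<Lambda> - \<Lambda>/2)))) at_top sequentially"
      using \<Lambda> by real_asymp
    then have "\<forall>\<^sub>F n in sequentially. 3 \<le> exp (2 * (real n * (\<Lambda> - \<Lambda>/2)))"
      by (simp add: filterlim_at_top)
    moreover have "\<forall>\<^sub>F n in sequentially. exp (2 * (n * (\<Lambda> - \<Lambda>/2))) \<le> sqn (P n)"
      using T[of "\<Lambda>/2"] \<Lambda> by (auto elim: eventually_mono)
    ultimately show ?thesis
    proof eventually_elim
      case (elim n)
      then have "3 \<le> sqn (P n)" by linarith
      then have "dz (P n) \<noteq> 0" using norm_dz_ge_half[OF P(2), of n] by auto
      then show ?case by (simp add: x_def norm_sgn)
    qed
  qed
  then have nz: "norm z = 1"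
    using tendsto_norm[OF z] tendsto_cong[of "\<lambda>n. 1" "\<lambda>n. norm (x n)"] LIMSEQ_unique tendsto_const by metis
  show thesis
  proof (rule that[OF z[unfolded x_def] nz])
    fix \<alpha> e :: real assume \<alpha>: "cis (4*pi*\<alpha>) = - z" and e: "0 < e"
    \<comment> \<open>With D = exp (2 n \<delta>) the two error terms lose at most D^3, and a fourth
      factor D absorbs the constant 2 + K^2 / 2; hence 4 \<delta> \<le> e. The bound \<Lambda> / 2
      keeps \<delta> below \<Lambda>, as \<open>rate\<close> requires.\<close>
    define \<delta> where "\<delta> = min (e / 4) (\<Lambda> / 2)"
    have \<delta>: "0 < \<delta>" "\<delta> < \<Lambda>" "4 * \<delta> \<le> e" using e \<Lambda> by (auto simp: \<delta>_def)
    obtain z' K where "x \<longlonglongrightarrow> z'" and K: "\<forall>\<^sub>F n in sequentially. norm (x n - z') \<le> K * exp (- 2 * (n * (\<Lambda> - \<delta>)))"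
      using rate[OF \<delta>(1,2)] by blast
    then have K: "\<forall>\<^sub>F n in sequentially. norm (x n - z) \<le> K * exp (- 2 * (n * (\<Lambda> - \<delta>)))"
      using LIMSEQ_unique z by blast
    have "filterlim (\<lambda>n. exp (2 * (real n * (\<Lambda> - \<delta>)))) at_top sequentially"
      using \<delta> by real_asymp
    then have ev3: "\<forall>\<^sub>F n in sequentially. 3 \<le> exp (2 * (real n * (\<Lambda> - \<delta>)))"
      by (simp add: filterlim_at_top)
    have "filterlim (\<lambda>n. exp (2 * (real n * \<delta>))) at_top sequentially"
      using \<delta> by real_asymp
    then have evK: "\<forall>\<^sub>F n in sequentially. 2 + K\<^sup>2 / 2 \<le> exp (2 * (real n * \<delta>))"
      by (simp add: filterlim_at_top)
    show "\<forall>\<^sub>F n in sequentially. norm (P n *v dir \<alpha>) \<le> exp (- (n * (\<Lambda> - e)))"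
      using T[OF \<delta>(1)] K ev3 evK
    proof eventually_elim
      case (elim n)
      define X D where "X = exp (2 * (n * \<Lambda>))" and "D = exp (2 * (n * \<delta>))"
      have XD: "0 < X" "0 < D" "1 \<le> D" using \<delta> by (auto simp: X_def D_def)
      have e1: "exp (2 * (n * (\<Lambda> - \<delta>))) = X / D" and e2: "exp (2 * (n * (\<Lambda> + \<delta>))) = X * D"
        and e3: "exp (- 2 * (n * (\<Lambda> - \<delta>))) = D / X"
        by (simp_all add: X_def D_def algebra_simps exp_diff exp_add exp_minus divide_inverse)
      have s: "X / D \<le> sqn (P n)" "sqn (P n) \<le> 2 * (X * D)" "3 \<le> sqn (P n)"
        using elim(1,3) unfolding e1 e2 by auto
      have k: "norm (x n - z) \<le> K * (D / X)" using elim(2) unfolding e3 .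
      have "(norm (P n *v dir \<alpha>))\<^sup>2 \<le> 2 / sqn (P n) + sqn (P n) * (norm (x n - z))\<^sup>2 / 4"
        unfolding x_def by (rule norm_mv_contracted_dir[OF P(2) nz \<alpha> s(3)])
      also have "\<dots> \<le> 2 / (X / D) + (2 * (X * D)) * (K * (D / X))\<^sup>2 / 4"
        using s XD k by (intro add_mono divide_left_mono divide_right_mono mult_mono power_mono) auto
      also have "\<dots> = 2 * D / X + K\<^sup>2 / 2 * D ^ 3 / X"
        using XD by (simp add: power2_eq_square power3_eq_cube field_simps)
      also have "\<dots> \<le> 2 * D ^ 3 / X + K\<^sup>2 / 2 * D ^ 3 / X"
      proof -
        have "D ^ 1 \<le> D ^ 3" using XD by (intro power_increasing) auto
        then show ?thesis using XD by (simp add: divide_right_mono)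
      qed
      also have "\<dots> = (2 + K\<^sup>2 / 2) * (D ^ 3 / X)" by (simp add: distrib_right add_divide_distrib)
      also have "\<dots> \<le> D * (D ^ 3 / X)"
        using elim(4) XD by (intro mult_right_mono) (auto simp: D_def)
      also have "\<dots> = exp (2 * (n * (4 * \<delta>))) / X"
        by (simp add: D_def power3_eq_cube flip: exp_add)
      also have "\<dots> \<le> exp (2 * (n * e)) / X"
      proof -
        have "n * (4 * \<delta>) \<le> n * e" using \<delta> by (intro mult_left_mono) auto
        then have "exp (2 * (n * (4 * \<delta>))) \<le> exp (2 * (n * e))" unfolding exp_le_cancel_iff by (rule mult_left_mono) simp
        then show ?thesis using XD(1) by (rule divide_right_mono[OF _ less_imp_le])
      qed
      also have "\<dots> = (exp (- (n * (\<Lambda> - e))))\<^sup>2"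
        by (simp add: X_def exp_double[symmetric] algebra_simps flip: exp_diff)
      finally show ?case by (rule power2_le_imp_le) simp
    qed
  qed
qed

lemma tendsto_0_of_exp_rate:
  fixes f :: "nat \<Rightarrow> 'b::real_normed_vector" and \<Lambda> :: real
  assumes "0 < \<Lambda>" "\<forall>e>0. \<forall>\<^sub>F n in sequentially. norm (f n) \<le> exp (- (n * (\<Lambda> - e)))"
  shows "f \<longlonglongrightarrow> 0"
proof -
  define l where "l = \<Lambda> / 2"
  have "0 < l" using assms by (simp add: l_def)
  then have "(\<lambda>n. exp (- (real n * l))) \<longlonglongrightarrow> 0" by real_asymp
  moreover have "\<forall>\<^sub>F n in sequentially. norm (f n) \<le> exp (- (n * l))"
    using assms(2)[rule_format, of l] \<open>0 < l\<close> by (simp add: l_def)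
  ultimately show ?thesis by (rule Lim_null_comparison[rotated])
qed

text \<open>A rate q strictly between \<beta> and exp (- \<Lambda>) leaves the geometric factor
  (\<beta> / q)^n. Working with q instead of ln \<beta> includes the value \<beta> = 0.\<close>

lemma subcritical_tendsto_0:
  fixes a :: "nat \<Rightarrow> real" and \<Lambda> :: real
  assumes lim: "(\<lambda>n. ln (a n) / n) \<longlonglongrightarrow> \<Lambda>" and pos: "\<And>n. 0 < a n"
    and \<beta>: "0 \<le> \<beta>" "\<beta> < exp (- \<Lambda>)"
  shows "(\<lambda>n. \<beta> ^ n * a n) \<longlonglongrightarrow> 0"
proof -
  obtain q where q: "\<beta> < q" "q < exp (- \<Lambda>)" using dense \<beta>(2) by blast
  have q0: "0 < q" using \<beta> q by linarith
  have "exp (ln q) < exp (- \<Lambda>)" using q q0 by simp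
  then have d: "0 < - \<Lambda> - ln q" unfolding exp_less_cancel_iff by linarith
  have ev: "\<forall>\<^sub>F n in sequentially. norm (\<beta> ^ n * a n) \<le> (\<beta> / q) ^ n"
    using exp_rate_bounds[OF lim pos d]
  proof eventually_elim
    case (elim n)
    have "a n \<le> exp (n * (- ln q))" using elim by simp
    also have "\<dots> = inverse (q ^ n)" using q0 by (simp add: exp_minus exp_of_nat_mult)
    finally have "\<beta> ^ n * a n \<le> \<beta> ^ n * inverse (q ^ n)" using \<beta> by (intro mult_left_mono) auto
    moreover have "(\<beta> / q) ^ n = \<beta> ^ n * inverse (q ^ n)" by (simp add: divide_inverse power_mult_distrib power_inverse)
    ultimately show ?case using \<beta> pos[of n] by (simp add: abs_mult)
  qed
  have "(\<lambda>n. (\<beta> / q) ^ n) \<longlonglongrightarrow> 0" using \<beta> q q0 by (intro LIMSEQ_power_zero) auto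
  then show ?thesis by (rule Lim_null_comparison[OF ev])
qed

text \<open>The countably many rates \<open>r i\<close> decrease to exp c, and every larger q
  dominates one of them, so the countable intersection of full sets serves all q.\<close>

lemma (in ergodic_system) exp_rate_recurrence:
  fixes f :: "nat \<Rightarrow> 'a \<Rightarrow> real" and c :: real
  assumes f [measurable]: "\<And>n. f n \<in> borel_measurable M"
    and rate: "AE x in M. \<forall>e>0. \<forall>\<^sub>F n in sequentially. f n x \<le> exp (n * (c + e))"
  shows "AE x in M. \<forall>q>exp c. \<exists>D. infinite {k. \<forall>l. f l ((T ^^ k) x) \<le> D * q ^ l}"
proof -
  define r where "r i = exp (c + inverse (Suc i))" for i :: nat
  define V where "V i j = {x \<in> space M. \<forall>l. f l x \<le> real (Suc j) * r i ^ l}" for i j :: nat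
  have V: "V i j \<in> sets M" for i j unfolding V_def by measurable
  have cover: "AE x in M. \<exists>j. x \<in> V i j" for i
  proof -
    have "AE x in M. x \<in> space M" by simp
    with rate show ?thesis
    proof eventually_elim
      case (elim x)
      have "\<forall>\<^sub>F n in sequentially. f n x \<le> exp (n * (c + inverse (Suc i)))"
        using elim(1) by (metis inverse_positive_iff_positive of_nat_0_less_iff zero_less_Suc)
      then have "\<forall>\<^sub>F n in sequentially. f n x \<le> r i ^ n"
        unfolding r_def by (simp add: exp_of_nat_mult)
      moreover have "0 < r i ^ n" for n by (simp add: r_def)
      ultimately obtain j where "\<And>n. f n x \<le> real (Suc j) * r i ^ n"
        by (rule eventually_le_imp_const_bound) blast
      then show ?case using elim(2) by (auto simp: V_def)
    qed
  qed
  have "AE x in M. \<exists>j. infinite {k. (T ^^ k) x \<in> V i j}" for i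
  proof -
    obtain j where "AE x in M. infinite {k. (T ^^ k) x \<in> V i j}"
      using recurrence[OF V cover] by blast
    then show ?thesis by eventually_elim blast
  qed
  then have "AE x in M. \<forall>i. \<exists>j. infinite {k. (T ^^ k) x \<in> V i j}" by (simp add: AE_all_countable)
  then show ?thesis
  proof eventually_elim
    case (elim x)
    show ?case
    proof (intro allI impI)
      fix q assume q: "exp c < q"
      then have "0 < q" using exp_gt_zero less_trans by blast
      then have "exp c < exp (ln q)" using q by simp
      then have "0 < ln q - c" unfolding exp_less_cancel_iff by linarith
      then obtain i where i: "inverse (real (Suc i)) < ln q - c" using reals_Archimedean by blast
      then have "exp (c + inverse (Suc i)) \<le> exp (ln q)" unfolding exp_le_cancel_iff by linarith
      then have rq: "0 \<le> r i" "r i \<le> q" using \<open>0 < q\<close> by (simp_all add: r_def)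
      obtain j where j: "infinite {k. (T ^^ k) x \<in> V i j}" using elim by blast
      have "{k. (T ^^ k) x \<in> V i j} \<subseteq> {k. \<forall>l. f l ((T ^^ k) x) \<le> real (Suc j) * q ^ l}"
      proof (intro subsetI CollectI allI)
        fix k l assume "k \<in> {k. (T ^^ k) x \<in> V i j}"
        then have "f l ((T ^^ k) x) \<le> real (Suc j) * r i ^ l" by (simp add: V_def)
        also have "\<dots> \<le> real (Suc j) * q ^ l" using rq by (intro mult_left_mono power_mono) auto
        finally show "f l ((T ^^ k) x) \<le> real (Suc j) * q ^ l" .
      qed
      then show "\<exists>D. infinite {k. \<forall>l. f l ((T ^^ k) x) \<le> D * q ^ l}"
        using j infinite_super by blast
    qed
  qed
qed

section \<open>Cocycles over an invertible ergodic system\<close>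

text \<open>The argument is continuous off the closed half-line of nonnegative reals and equals 0 on
  it.\<close>

lemma borel_measurable_Arg2pi [measurable]: "Arg2pi \<in> borel_measurable borel"
proof -
  have "closed (\<real>\<^sub>\<ge>\<^sub>0 :: complex set)" by simp
  then have "- \<real>\<^sub>\<ge>\<^sub>0 \<in> sets (borel :: complex measure)" by auto
  moreover have "continuous_on (- \<real>\<^sub>\<ge>\<^sub>0) Arg2pi"
    by (intro continuous_at_imp_continuous_on ballI continuous_at_Arg2pi) auto
  ultimately have "(\<lambda>z. indicator (- \<real>\<^sub>\<ge>\<^sub>0) z *\<^sub>R Arg2pi z) \<in> borel_measurable borel"
    by (rule borel_measurable_continuous_on_indicator)
  moreover have "(\<lambda>z. indicator (- \<real>\<^sub>\<ge>\<^sub>0) z *\<^sub>R Arg2pi z) = Arg2pi"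
    by (auto simp: fun_eq_iff indicator_def Arg2pi_eq_0 complex_nonneg_Reals_iff complex_is_Real_iff)
  ultimately show ?thesis by simp
qed

lemma cocycle_add: "cocycle T A (m + n) x = cocycle T A n ((T ^^ m) x) ** cocycle T A m x"
proof (induction n)
  case (Suc n)
  have "(T ^^ (m + n)) x = (T ^^ n) ((T ^^ m) x)" by (simp add: add.commute[of m] funpow_add)
  then show ?case using Suc by (simp add: matrix_mul_assoc)
qed simp

text \<open>Determinant 1 preserves area, and two contracted vectors span an area tending to 0. So
  the contracted line is unique, which makes the invariant directions equivariant.\<close>

lemma contracted_parallel:
  fixes P :: "nat \<Rightarrow> real^2^2"
  assumes det: "\<And>n. det (P n) = 1" and "(\<lambda>n. P n *v v) \<longlonglongrightarrow> 0" "(\<lambda>n. P n *v w) \<longlonglongrightarrow> 0"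
  shows "cross2 v w = 0"
proof -
  have "(\<lambda>n. norm (P n *v v) * norm (P n *v w)) \<longlonglongrightarrow> 0 * 0"
    by (intro tendsto_mult tendsto_norm_zero assms)
  moreover have "\<bar>cross2 v w\<bar> \<le> norm (P n *v v) * norm (P n *v w)" for n
    using abs_cross2_le[of "P n *v v" "P n *v w"] by (simp add: cross2_mv det)
  ultimately have "\<bar>cross2 v w\<bar> \<le> 0 * 0" by (intro LIMSEQ_le_const) auto
  then show ?thesis by simp
qed

locale sl2_cocycle = ergodic_system +
  fixes A :: "'a \<Rightarrow> real^2^2" and C :: real
  assumes A_measurable [measurable]: "A \<in> borel_measurable M"
    and det_A: "\<And>x. x \<in> space M \<Longrightarrow> det (A x) = 1"
    and opnorm_A: "\<And>x. x \<in> space M \<Longrightarrow> opnorm (A x) \<le> C"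
begin

lemma det_cocycle: "x \<in> space M \<Longrightarrow> det (cocycle T A n x) = 1"
  by (induction n) (simp_all add: det_mul det_A T_space)

lemma measurable_cocycle [measurable]: "(\<lambda>x. cocycle T A n x) \<in> borel_measurable M"
proof (induction n)
  case (Suc n)
  have "(\<lambda>x. A ((T ^^ n) x)) \<in> borel_measurable M" by measurable
  then show ?case using Suc by (simp add: borel_measurable_mm)
qed simp

lemma opnorm_cocycle_ge_1: "x \<in> space M \<Longrightarrow> 1 \<le> opnorm (cocycle T A n x)"
  by (rule opnorm_ge_1) (rule det_cocycle)

lemma C_ge_1: "1 \<le> C"
proof -
  obtain x where "x \<in> space M" using not_empty by blast
  then show ?thesis using opnorm_ge_1[OF det_A] opnorm_A order_trans by blast
qed

lemma opnorm_cocycle_le: "x \<in> space M \<Longrightarrow> opnorm (cocycle T A n x) \<le> C ^ n"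
proof (induction n)
  case (Suc n)
  have "opnorm (cocycle T A (Suc n) x) \<le> opnorm (A ((T ^^ n) x)) * opnorm (cocycle T A n x)"
    by (simp add: opnorm_mult)
  also have "\<dots> \<le> C * C ^ n"
    using Suc C_ge_1 by (intro mult_mono opnorm_A T_space opnorm_nonneg) auto
  finally show ?case by simp
qed simp

sublocale kingman: bounded_subadditive M T "\<lambda>n x. ln (opnorm (cocycle T A n x))" "ln C"
proof
  show "(\<lambda>x. ln (opnorm (cocycle T A n x))) \<in> borel_measurable M" for n by measurable
  fix x n assume x: "x \<in> space M"
  have pos: "0 < opnorm (cocycle T A n y)" if "y \<in> space M" for n y
    using opnorm_cocycle_ge_1[OF that, of n] by linarith
  show "0 \<le> ln (opnorm (cocycle T A n x))" using opnorm_cocycle_ge_1[OF x] by simp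
  have "ln (opnorm (cocycle T A n x)) \<le> ln (C ^ n)"
    using opnorm_cocycle_le[OF x, of n] pos[OF x, of n] C_ge_1 by (subst ln_le_cancel_iff) auto
  then show "ln (opnorm (cocycle T A n x)) \<le> ln C * n"
    using C_ge_1 by (simp add: ln_realpow mult.commute)
  fix m
  have "ln (opnorm (cocycle T A (m + n) x)) \<le> ln (opnorm (cocycle T A n ((T ^^ m) x)) * opnorm (cocycle T A m x))"
    using opnorm_mult[of "cocycle T A n ((T ^^ m) x)" "cocycle T A m x"] pos[OF x, of "m + n"]
    by (subst ln_le_cancel_iff) (auto simp: cocycle_add intro: less_le_trans)
  then show "ln (opnorm (cocycle T A (m + n) x)) \<le> ln (opnorm (cocycle T A m x)) + ln (opnorm (cocycle T A n ((T ^^ m) x)))"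
    using pos[OF x, of m] pos[OF T_space[OF x], of n m] by (simp add: ln_mult)
qed

lemma lyapunov_limit:
  "0 \<le> lyapunov M T A"
  "AE x in M. (\<lambda>n. ln (opnorm (cocycle T A n x)) / n) \<longlonglongrightarrow> lyapunov M T A"
proof -
  obtain c where c: "0 \<le> c" "AE x in M. (\<lambda>n. ln (opnorm (cocycle T A n x)) / n) \<longlonglongrightarrow> c"
    "(\<lambda>n. (\<integral>x. ln (opnorm (cocycle T A n x)) \<partial>M) / n) \<longlonglongrightarrow> c"
    by (rule kingman.subadditive_ergodic)
  have "lyapunov M T A = c" unfolding lyapunov_def using c(3) by (intro limI) simp
  then show "0 \<le> lyapunov M T A"
    "AE x in M. (\<lambda>n. ln (opnorm (cocycle T A n x)) / n) \<longlonglongrightarrow> lyapunov M T A"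
    using c by auto
qed

text \<open>Division by 4 pi undoes the doubled angle in \<open>dz\<close> and places the value in
  [0, 1/2) at every point, even where the limit fails to exist. Range and measurability therefore
  hold without exceptional points.\<close>

definition stable_angle :: "'a \<Rightarrow> real" where
  "stable_angle x = Arg2pi (- lim (\<lambda>n. sgn (dz (cocycle T A n x)))) / (4 * pi)"

lemma stable_angle_measurable [measurable]: "stable_angle \<in> borel_measurable M"
  unfolding stable_angle_def sgn_div_norm by measurable

lemma stable_angle_range: "stable_angle x \<in> {0..<1/2}"
  using Arg2pi_ge_0 Arg2pi_lt_2pi by (simp add: stable_angle_def field_simps)

lemma stable_angle_contracted:
  assumes "0 < lyapunov M T A"
  shows "AE x in M. \<forall>e>0. \<forall>\<^sub>F n in sequentially.
    norm (cocycle T A n x *v dir (stable_angle x)) \<le> exp (- (n * (lyapunov M T A - e)))"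
proof -
  have "AE x in M. x \<in> space M" by simp
  with lyapunov_limit(2) show ?thesis
  proof eventually_elim
    case (elim x)
    obtain z where z: "(\<lambda>n. sgn (dz (cocycle T A n x))) \<longlonglongrightarrow> z" "norm z = 1"
      and s: "\<And>\<alpha> e. cis (4*pi*\<alpha>) = - z \<Longrightarrow> 0 < e \<Longrightarrow>
      \<forall>\<^sub>F n in sequentially. norm (cocycle T A n x *v dir \<alpha>) \<le> exp (- (n * (lyapunov M T A - e)))"
    proof (rule stable_direction[of "\<lambda>n. cocycle T A n x" "\<lambda>n. A ((T ^^ n) x)" C])
      show "opnorm (A ((T ^^ n) x)) \<le> C" for n using opnorm_A T_space elim(2) by blast
    qed (use elim det_cocycle assms in auto)
    have "cis (Arg2pi (- z)) = - z"
      using Arg2pi_eq[of "- z"] z(2) by (simp add: cis_conv_exp)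
    then have "cis (4 * pi * stable_angle x) = - z"
      unfolding stable_angle_def limI[OF z(1)] by simp
    then show ?case using s by blast
  qed
qed

end

locale sl2_system = sl2_cocycle M \<gamma> A C for M :: "'a measure" and \<gamma> A C +
  assumes bimeas: "bimeasurable_bij M \<gamma>"
begin

definition ginv :: "'a \<Rightarrow> 'a" where "ginv = inv_into (space M) \<gamma>"

text \<open>The inverse of the step that arrives at \<open>x\<close>; over \<open>ginv\<close> it
  generates the inverse cocycle, see \<open>back_cocycle\<close>.\<close>

definition Ainv :: "'a \<Rightarrow> real^2^2" where "Ainv x = adj2 (A (ginv x))"

lemma ginv_measurable [measurable]: "ginv \<in> measurable M M"
  using bimeas by (simp add: bimeasurable_bij_def ginv_def)

lemma ginv_gamma: "x \<in> space M \<Longrightarrow> ginv (\<gamma> x) = x"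
  and gamma_ginv: "x \<in> space M \<Longrightarrow> \<gamma> (ginv x) = x"
  using bimeas unfolding bimeasurable_bij_def ginv_def
  by (auto simp: bij_betw_inv_into_left bij_betw_inv_into_right)

lemma gamma_space: "x \<in> space M \<Longrightarrow> \<gamma> x \<in> space M"
  and ginv_space: "x \<in> space M \<Longrightarrow> ginv x \<in> space M"
  by (rule measurable_space[OF T_measurable], assumption) (rule measurable_space[OF ginv_measurable], assumption)

text \<open>Invariance and ergodicity pass to the inverse map, and \<open>adj2\<close> keeps
  determinant and norm. Every forward result thus has a backward copy, and the stable direction of
  this copy is the unstable direction of the original cocycle.\<close>

sublocale bk: sl2_cocycle M ginv Ainv C
proof
  have "distr M M ginv = distr (distr M M \<gamma>) M ginv" by (simp only: distr_T)
  also have "\<dots> = distr M M (ginv \<circ> \<gamma>)" by (rule distr_distr) measurable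
  also have "\<dots> = distr M M (\<lambda>x. x)" by (rule distr_cong) (auto simp: ginv_gamma)
  also have "\<dots> = M" by (rule distr_id)
  finally have "distr M M ginv = M" .
  moreover have "measure M B = 0 \<or> measure M B = 1"
    if B: "B \<in> sets M" "ginv -` B \<inter> space M = B" for B
  proof -
    have "\<gamma> -` B \<inter> space M = B"
    proof (intro set_eqI iffI)
      fix x assume x: "x \<in> \<gamma> -` B \<inter> space M"
      then have "\<gamma> x \<in> ginv -` B \<inter> space M" using B(2) by blast
      then show "x \<in> B" using x by (simp add: ginv_gamma)
    next
      fix x assume x: "x \<in> B"
      then have xs: "x \<in> space M" using sets.sets_into_space[OF B(1)] by blast
      have "\<gamma> x \<in> ginv -` B \<inter> space M" using x xs by (simp add: ginv_gamma gamma_space)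
      then show "x \<in> \<gamma> -` B \<inter> space M" using B(2) xs by blast
    qed
    then show ?thesis using inv_erg B(1) unfolding invariant_ergodic_def by blast
  qed
  ultimately show "invariant_ergodic M ginv" unfolding invariant_ergodic_def by simp
  show "Ainv \<in> borel_measurable M" unfolding Ainv_def by measurable
  show "det (Ainv x) = 1" if "x \<in> space M" for x using that by (simp add: Ainv_def det_A ginv_space)
  show "opnorm (Ainv x) \<le> C" if "x \<in> space M" for x
    using that by (simp add: Ainv_def opnorm_adj2 opnorm_A ginv_space)
qed

lemma ginv_pow_gamma_pow: "x \<in> space M \<Longrightarrow> (ginv ^^ n) ((\<gamma> ^^ n) x) = x"
proof (induction n)
  case (Suc n)
  have "(ginv ^^ Suc n) ((\<gamma> ^^ Suc n) x) = (ginv ^^ n) (ginv (\<gamma> ((\<gamma> ^^ n) x)))" by (simp add: funpow_swap1)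
  then show ?case using Suc T_space by (simp add: ginv_gamma)
qed simp

lemma gamma_pow_ginv_pow: "x \<in> space M \<Longrightarrow> (\<gamma> ^^ n) ((ginv ^^ n) x) = x"
proof (induction n)
  case (Suc n)
  have "(\<gamma> ^^ Suc n) ((ginv ^^ Suc n) x) = (\<gamma> ^^ n) (\<gamma> (ginv ((ginv ^^ n) x)))" by (simp add: funpow_swap1)
  then show ?case using Suc bk.T_space by (simp add: gamma_ginv)
qed simp

abbreviation Bc :: "nat \<Rightarrow> 'a \<Rightarrow> real^2^2" where "Bc \<equiv> cocycle ginv Ainv"
abbreviation Ac :: "nat \<Rightarrow> 'a \<Rightarrow> real^2^2" where "Ac \<equiv> cocycle \<gamma> A"

lemma back_cocycle: "x \<in> space M \<Longrightarrow> Bc n x = adj2 (Ac n ((ginv ^^ n) x))"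
proof (induction n)
  case 0
  show ?case by (simp add: vec2_eq_iff adj2_def mat_def)
next
  case (Suc n)
  define y where "y = (ginv ^^ n) x"
  have y: "y \<in> space M" using bk.T_space Suc.prems by (simp add: y_def)
  have "Ac (1 + n) (ginv y) = Ac n y ** A (ginv y)"
    unfolding cocycle_add by (simp add: gamma_ginv y)
  then show ?case using Suc by (simp add: Ainv_def adj2_mult y_def)
qed

lemma Bc_Ac: "x \<in> space M \<Longrightarrow> Bc n x *v (Ac n ((ginv ^^ n) x) *v w) = w"
  by (simp add: back_cocycle adj2_mv det_cocycle bk.T_space)

lemma lyapunov_back: "lyapunov M ginv Ainv = lyapunov M \<gamma> A"
proof -
  have "(\<integral>x. ln (opnorm (Bc n x)) \<partial>M) = (\<integral>x. ln (opnorm (Ac n x)) \<partial>M)" for n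
  proof -
    have "(\<integral>x. ln (opnorm (Bc n x)) \<partial>M) = (\<integral>x. ln (opnorm (Ac n ((ginv ^^ n) x))) \<partial>M)"
      by (rule Bochner_Integration.integral_cong) (auto simp: back_cocycle opnorm_adj2)
    also have "\<dots> = (\<integral>x. ln (opnorm (Ac n x)) \<partial>M)"
      by (rule bk.integral_T_pow) measurable
    finally show ?thesis .
  qed
  then show ?thesis by (simp add: lyapunov_def)
qed

text \<open>All points whose forward or backward orbit meets the exceptional null set are removed;
  they form a countable union of null preimages.\<close>

lemma invariant_full_set:
  assumes "AE x in M. Q x"
  obtains S where "S \<in> sets M" "\<gamma> ` S = S" "prob S = 1" "\<And>x. x \<in> S \<Longrightarrow> Q x"
proof -
  obtain N where N: "{x \<in> space M. \<not> Q x} \<subseteq> N" "emeasure M N = 0" and Ns [measurable]: "N \<in> sets M"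
    using AE_E[OF assms] by metis
  define S where "S = {x \<in> space M. \<forall>n. (\<gamma> ^^ n) x \<notin> N \<and> (ginv ^^ n) x \<notin> N}"
  have S [measurable]: "S \<in> sets M" unfolding S_def by measurable
  have SD: "x \<in> space M" "(\<gamma> ^^ n) x \<notin> N" "(ginv ^^ n) x \<notin> N" if "x \<in> S" for x n
    using that by (auto simp: S_def)
  have fwd: "\<gamma> x \<in> S" if x: "x \<in> S" for x
    unfolding S_def
  proof (intro CollectI conjI allI)
    show "\<gamma> x \<in> space M" using SD(1)[OF x] gamma_space by blast
    fix n
    show "(\<gamma> ^^ n) (\<gamma> x) \<notin> N" using SD(2)[OF x, of "Suc n"] by (simp add: funpow_swap1)
    show "(ginv ^^ n) (\<gamma> x) \<notin> N"
    proof (cases n)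
      case 0 then show ?thesis using SD(2)[OF x, of 1] by simp
    next
      case (Suc m)
      then have "(ginv ^^ n) (\<gamma> x) = (ginv ^^ m) (ginv (\<gamma> x))" by (simp add: funpow_swap1)
      then show ?thesis using SD(3)[OF x, of m] SD(1)[OF x] by (simp add: ginv_gamma)
    qed
  qed
  have bwd: "ginv x \<in> S" if x: "x \<in> S" for x
    unfolding S_def
  proof (intro CollectI conjI allI)
    show "ginv x \<in> space M" using SD(1)[OF x] ginv_space by blast
    fix n
    show "(ginv ^^ n) (ginv x) \<notin> N" using SD(3)[OF x, of "Suc n"] by (simp add: funpow_swap1)
    show "(\<gamma> ^^ n) (ginv x) \<notin> N"
    proof (cases n)
      case 0 then show ?thesis using SD(3)[OF x, of 1] by simp
    next
      case (Suc m)
      then have "(\<gamma> ^^ n) (ginv x) = (\<gamma> ^^ m) (\<gamma> (ginv x))" by (simp add: funpow_swap1)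
      then show ?thesis using SD(2)[OF x, of m] SD(1)[OF x] by (simp add: gamma_ginv)
    qed
  qed
  have "AE x in M. x \<notin> N" using N Ns by (intro AE_not_in) auto
  then have "AE x in M. (\<forall>n. (\<gamma> ^^ n) x \<notin> N) \<and> (\<forall>n. (ginv ^^ n) x \<notin> N)"
    using AE_T_pow[of "\<lambda>x. x \<notin> N"] bk.AE_T_pow[of "\<lambda>x. x \<notin> N"]
    by (simp add: AE_all_countable AE_conj_iff)
  then have "AE x in M. x \<in> S" by (rule AE_mp) (auto simp: S_def)
  then have "prob S = 1" by (simp add: prob_eq_1)
  moreover have "\<gamma> ` S = S"
  proof
    show "S \<subseteq> \<gamma> ` S"
    proof
      fix x assume "x \<in> S"
      then have "x = \<gamma> (ginv x)" "ginv x \<in> S" using SD(1) gamma_ginv bwd by auto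
      then show "x \<in> \<gamma> ` S" by blast
    qed
  qed (use fwd in auto)
  moreover have "Q x" if "x \<in> S" for x
    using SD(1)[OF that] SD(2)[OF that, of 0] N(1) by auto
  ultimately show thesis using that S by blast
qed

lemma gamma_pow_mem:
  assumes "\<gamma> ` S = S" "x \<in> S" shows "(\<gamma> ^^ n) x \<in> S"
  using assms by (induction n) auto

lemma ginv_pow_mem:
  assumes S: "\<gamma> ` S = S" "S \<subseteq> space M" "x \<in> S" shows "(ginv ^^ n) x \<in> S"
proof (induction n)
  case (Suc n)
  then obtain y where y: "y \<in> S" "(ginv ^^ n) x = \<gamma> y" using S(1) by blast
  then have "ginv ((ginv ^^ n) x) = y" using S(2) by (auto simp: ginv_gamma)
  then show ?case using y by simp
qed (use S in simp)

lemma stable_transport: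
  assumes x: "x \<in> space M" and v: "(\<lambda>n. Ac n x *v v) \<longlonglongrightarrow> 0"
  shows "(\<lambda>m. Ac m ((\<gamma> ^^ n) x) *v (Ac n x *v v)) \<longlonglongrightarrow> 0"
proof -
  have "(\<lambda>m. Ac (m + n) x *v v) \<longlonglongrightarrow> 0" using LIMSEQ_ignore_initial_segment[OF v] .
  then show ?thesis by (simp add: cocycle_add add.commute[of _ n] matrix_vector_mul_assoc)
qed

lemma Bc_gamma: "x \<in> space M \<Longrightarrow> Bc (Suc n) (\<gamma> x) *v (A x *v w) = Bc n x *v w"
  using cocycle_add[of ginv Ainv 1 n "\<gamma> x"]
  by (simp add: ginv_gamma Ainv_def adj2_mv det_A flip: matrix_vector_mul_assoc)

lemma unstable_transport:
  assumes x: "x \<in> space M" and v: "(\<lambda>n. Bc n x *v v) \<longlonglongrightarrow> 0"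
  shows "(\<lambda>m. Bc m (\<gamma> x) *v (A x *v v)) \<longlonglongrightarrow> 0"
  using v by (subst filterlim_sequentially_Suc[symmetric]) (simp only: Bc_gamma[OF x])

text \<open>If both contracted directions agreed, \<open>\<theta> \<mapsto> \<parallel>A\<^sub>n(\<theta>) v\<parallel>\<close> along them would tend to zero while its
  composition with \<open>\<gamma>\<^sup>-\<^sup>n\<close>, which has the same distribution, would tend to infinity.\<close>

lemma contracted_directions_differ:
  assumes s [measurable]: "s \<in> borel_measurable M" and u [measurable]: "u \<in> borel_measurable M"
    and ranges: "\<And>x. s x \<in> {0..<1/2}" "\<And>x. u x \<in> {0..<1/2}"
    and cs: "AE x in M. (\<lambda>n. Ac n x *v dir (s x)) \<longlonglongrightarrow> 0"
    and cu: "AE x in M. (\<lambda>n. Bc n x *v dir (u x)) \<longlonglongrightarrow> 0"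
  shows "AE x in M. u x \<noteq> s x"
proof -
  obtain S where S [measurable]: "S \<in> sets M" and Sinv: "\<gamma> ` S = S" and pS: "prob S = 1"
    and cS: "\<And>x. x \<in> S \<Longrightarrow> (\<lambda>n. Ac n x *v dir (s x)) \<longlonglongrightarrow> 0"
    "\<And>x. x \<in> S \<Longrightarrow> (\<lambda>n. Bc n x *v dir (u x)) \<longlonglongrightarrow> 0"
    using invariant_full_set[OF AE_conjI[OF cs cu]] by metis
  have Ssp: "S \<subseteq> space M" using S by (rule sets.sets_into_space)
  define I where "I = {x \<in> S. u x = s x}"
  have "I = {x \<in> space M. x \<in> S \<and> u x = s x}" using Ssp by (auto simp: I_def)
  also have "\<dots> \<in> sets M" by measurable
  finally have I [measurable]: "I \<in> sets M" .
  have "prob I = 0 \<or> prob I = 1"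
  \<comment> \<open>Each of the two contracted lines is carried to its counterpart over the next
    point, so coincidence persists under \<gamma>.\<close>
  proof (rule prob_01_of_subinvariant[OF I], rule subsetI)
    fix x assume "x \<in> I"
    then have x: "x \<in> S" "u x = s x" "x \<in> space M" using Ssp by (auto simp: I_def)
    have gx: "\<gamma> x \<in> S" "\<gamma> x \<in> space M" using x Sinv gamma_space by auto
    have "(\<lambda>m. Ac m (\<gamma> x) *v (A x *v dir (s x))) \<longlonglongrightarrow> 0"
      using stable_transport[OF x(3) cS(1)[OF x(1)], of 1] by simp
    then have 1: "cross2 (A x *v dir (s x)) (dir (s (\<gamma> x))) = 0"
      by (intro contracted_parallel[of "\<lambda>m. Ac m (\<gamma> x)"] cS gx) (auto simp: det_cocycle gx)
    have "(\<lambda>m. Bc m (\<gamma> x) *v (A x *v dir (u x))) \<longlonglongrightarrow> 0"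
      using unstable_transport[OF x(3) cS(2)[OF x(1)]] .
    then have 2: "cross2 (A x *v dir (u x)) (dir (u (\<gamma> x))) = 0"
      by (intro contracted_parallel[of "\<lambda>m. Bc m (\<gamma> x)"] cS gx) (auto simp: bk.det_cocycle gx)
    have "A x *v dir (s x) \<noteq> 0" by (intro mv_nonzero det_A x) simp
    moreover obtain a where a: "A x *v dir (s x) = a *\<^sub>R dir (s (\<gamma> x))" using cross2_eq_0D[OF 1] by auto
    ultimately have "a \<noteq> 0" by auto
    then have "cross2 (dir (s (\<gamma> x))) (dir (u (\<gamma> x))) = 0"
      using 2 a x(2) by (simp add: cross2_def flip: right_diff_distrib)
    then have "s (\<gamma> x) = u (\<gamma> x)" using dir_parallel_eq[OF ranges] by blast
    then show "x \<in> \<gamma> -` I \<inter> space M" using gx x by (simp add: I_def)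
  qed
  moreover have "prob I \<noteq> 1"
  proof
    assume "prob I = 1"
    then have AEI: "AE x in M. x \<in> I" by (simp add: prob_eq_1)
    define b where "b n x = norm (Ac n x *v dir (s x))" for n x
    define J where "J n = {x \<in> space M. b n x < 1}" for n
    have bm [measurable]: "b n \<in> borel_measurable M" for n unfolding b_def by measurable
    have J [measurable]: "J n \<in> sets M" for n unfolding J_def by measurable
    \<comment> \<open>Indicators of b n < 1 are dominated by 1, whereas the norms themselves grow.
      Their integrals tend to 1 here and to 0 after composition with \<open>ginv ^^ n\<close>,
      although invariance makes the two sequences equal.\<close>
    have "(\<lambda>n. \<integral>x. indicat_real (J n) x \<partial>M) \<longlonglongrightarrow> (\<integral>x. 1 \<partial>M)"
    proof (rule integral_dominated_convergence[where w="\<lambda>x. 1"])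
      show "AE x in M. (\<lambda>n. indicat_real (J n) x) \<longlonglongrightarrow> 1"
        using AEI
      proof eventually_elim
        case (elim x)
        then have x: "x \<in> S" "x \<in> space M" using Ssp by (auto simp: I_def)
        have "(\<lambda>n. b n x) \<longlonglongrightarrow> 0" unfolding b_def using tendsto_norm_zero[OF cS(1)[OF x(1)]] .
        then have "\<forall>\<^sub>F n in sequentially. b n x < 1" by (rule order_tendstoD) simp
        then have "\<forall>\<^sub>F n in sequentially. indicat_real (J n) x = 1"
          by eventually_elim (simp add: J_def x)
        then show ?case by (rule tendsto_eventually)
      qed
    qed auto
    moreover have "(\<lambda>n. \<integral>x. indicat_real (J n) ((ginv ^^ n) x) \<partial>M) \<longlonglongrightarrow> (\<integral>x. 0 \<partial>M)"
    proof (rule integral_dominated_convergence[where w="\<lambda>x. 1"])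
      show "AE x in M. (\<lambda>n. indicat_real (J n) ((ginv ^^ n) x)) \<longlonglongrightarrow> 0"
        using AEI
      proof eventually_elim
        case (elim x)
        then have x: "x \<in> S" "x \<in> space M" "u x = s x" using Ssp by (auto simp: I_def)
        \<comment> \<open>On the common invariant line both cocycles act as scalars, and these are
          mutually inverse.\<close>
        have inv: "b n ((ginv ^^ n) x) * norm (Bc n x *v dir (u x)) = 1" for n
        proof -
          define y where "y = (ginv ^^ n) x"
          have y: "y \<in> S" "y \<in> space M" "(\<gamma> ^^ n) y = x"
            using ginv_pow_mem[OF Sinv Ssp x(1)] Ssp gamma_pow_ginv_pow[OF x(2)] by (auto simp: y_def)
          have "(\<lambda>m. Ac m x *v (Ac n y *v dir (s y))) \<longlonglongrightarrow> 0"
            using stable_transport[OF y(2) cS(1)[OF y(1)], of n] y(3) by simp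
          then have "cross2 (Ac n y *v dir (s y)) (dir (s x)) = 0"
            by (intro contracted_parallel[of "\<lambda>m. Ac m x"] cS x) (auto simp: det_cocycle x)
          then obtain a where a: "Ac n y *v dir (s y) = a *\<^sub>R dir (s x)"
            using cross2_eq_0D[OF _ dir_nonzero] by blast
          have "a *\<^sub>R (Bc n x *v dir (s x)) = Bc n x *v (Ac n y *v dir (s y))"
            unfolding a by (simp add: matrix_vector_mult_scaleR)
          also have "\<dots> = dir (s y)" unfolding y_def by (rule Bc_Ac[OF x(2)])
          finally have "norm (a *\<^sub>R (Bc n x *v dir (s x))) = norm (dir (s y))" by (rule arg_cong)
          then have "\<bar>a\<bar> * norm (Bc n x *v dir (u x)) = 1" by (simp add: x)
          moreover have "b n y = \<bar>a\<bar>" by (simp add: b_def a)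
          ultimately show ?thesis by (simp add: y_def)
        qed
        have "(\<lambda>n. norm (Bc n x *v dir (u x))) \<longlonglongrightarrow> 0" using tendsto_norm_zero[OF cS(2)[OF x(1)]] .
        then have "\<forall>\<^sub>F n in sequentially. norm (Bc n x *v dir (u x)) < 1" by (rule order_tendstoD) simp
        then have "\<forall>\<^sub>F n in sequentially. indicat_real (J n) ((ginv ^^ n) x) = 0"
        proof eventually_elim
          case (elim n)
          have "\<not> b n ((ginv ^^ n) x) < 1"
          proof
            assume "b n ((ginv ^^ n) x) < 1"
            then have "b n ((ginv ^^ n) x) * norm (Bc n x *v dir (u x)) < 1 * 1"
              using elim by (intro mult_strict_mono') (auto simp: b_def)
            then show False using inv[of n] by simp
          qed
          then show ?case by (simp add: J_def)
        qed
        then show ?case by (rule tendsto_eventually)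
      qed
    qed auto
    moreover have "(\<integral>x. indicat_real (J n) ((ginv ^^ n) x) \<partial>M) = (\<integral>x. indicat_real (J n) x \<partial>M)" for n
      by (rule bk.integral_T_pow) simp
    ultimately have "(\<integral>x. 1 \<partial>M) = (\<integral>x. 0 \<partial>M :: real)" using LIMSEQ_unique by (simp only: ) blast
    then show False by (simp add: prob_space)
  qed
  ultimately have "AE x in M. x \<notin> I" by (simp add: prob_eq_0)
  moreover have "AE x in M. x \<in> S" using pS by (simp add: prob_eq_1)
  ultimately show ?thesis by eventually_elim (simp add: I_def)
qed

abbreviation lyap :: real ("\<Lambda>") where "\<Lambda> \<equiv> lyapunov M \<gamma> A"

text \<open>Quantification over rates q instead of \<beta> makes the property serve all parameters.
  The third clause yields past times with a bound in all directions at once, for \<beta> > exp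
  \<Lambda>; the last one yields future times with a bound along the unstable direction, for \<beta>
  > exp (- \<Lambda>).\<close>

definition good :: "'a \<Rightarrow> bool" where
  "good x \<longleftrightarrow>
    (\<lambda>n. ln (opnorm (Ac n x)) / n) \<longlonglongrightarrow> \<Lambda> \<and> (\<lambda>n. ln (opnorm (Bc n x)) / n) \<longlonglongrightarrow> \<Lambda> \<and>
    (\<forall>q>exp \<Lambda>. \<exists>D. infinite {k. \<forall>l. opnorm (Bc l ((ginv ^^ k) x)) \<le> D * q ^ l}) \<and>
    (0 < \<Lambda> \<longrightarrow>
      (\<forall>e>0. \<forall>\<^sub>F n in sequentially. norm (Ac n x *v dir (stable_angle x)) \<le> exp (- (n * (\<Lambda> - e)))) \<and>
      (\<forall>e>0. \<forall>\<^sub>F n in sequentially. norm (Bc n x *v dir (bk.stable_angle x)) \<le> exp (- (n * (\<Lambda> - e)))) \<and>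
      bk.stable_angle x \<noteq> stable_angle x \<and>
      (\<forall>q>exp (- \<Lambda>). \<exists>D. infinite {k. \<forall>l. norm (Bc l ((\<gamma> ^^ k) x) *v dir (bk.stable_angle ((\<gamma> ^^ k) x))) \<le> D * q ^ l}))"

lemma AE_good: "AE x in M. good x"
proof -
  have lim: "AE x in M. (\<lambda>n. ln (opnorm (Ac n x)) / n) \<longlonglongrightarrow> \<Lambda>"
    "AE x in M. (\<lambda>n. ln (opnorm (Bc n x)) / n) \<longlonglongrightarrow> \<Lambda>"
    using lyapunov_limit(2) bk.lyapunov_limit(2) by (simp_all add: lyapunov_back)
  have "AE x in M. x \<in> space M" by simp
  with lim(2) have "AE x in M. \<forall>e>0. \<forall>\<^sub>F n in sequentially. opnorm (Bc n x) \<le> exp (n * (\<Lambda> + e))"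
  proof eventually_elim
    case (elim x)
    have pos: "0 < opnorm (Bc n x)" for n using bk.opnorm_cocycle_ge_1[OF elim(2), of n] by linarith
    show ?case
    proof (intro allI impI)
      fix e :: real assume "0 < e"
      from exp_rate_bounds[OF elim(1) pos this]
      show "\<forall>\<^sub>F n in sequentially. opnorm (Bc n x) \<le> exp (n * (\<Lambda> + e))"
        by eventually_elim simp
    qed
  qed
  then have rec: "AE x in M. \<forall>q>exp \<Lambda>. \<exists>D. infinite {k. \<forall>l. opnorm (Bc l ((ginv ^^ k) x)) \<le> D * q ^ l}"
    by (intro bk.exp_rate_recurrence) measurable
  show ?thesis
  proof (cases "0 < \<Lambda>")
    case False
    show ?thesis unfolding good_def using lim rec by eventually_elim (use False in blast)
  next
    case True
    have s: "AE x in M. \<forall>e>0. \<forall>\<^sub>F n in sequentially. norm (Ac n x *v dir (stable_angle x)) \<le> exp (- (n * (\<Lambda> - e)))"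
      using stable_angle_contracted[OF True] .
    have u: "AE x in M. \<forall>e>0. \<forall>\<^sub>F n in sequentially. norm (Bc n x *v dir (bk.stable_angle x)) \<le> exp (- (n * (\<Lambda> - e)))"
      using bk.stable_angle_contracted True by (simp add: lyapunov_back)
    have "AE x in M. \<forall>e>0. \<forall>\<^sub>F n in sequentially. norm (Bc n x *v dir (bk.stable_angle x)) \<le> exp (n * (- \<Lambda> + e))"
      using u by eventually_elim (simp add: algebra_simps)
    then have rec_u: "AE x in M. \<forall>q>exp (- \<Lambda>). \<exists>D. infinite
      {k. \<forall>l. norm (Bc l ((\<gamma> ^^ k) x) *v dir (bk.stable_angle ((\<gamma> ^^ k) x))) \<le> D * q ^ l}"
      by (intro exp_rate_recurrence[where f="\<lambda>l x. norm (Bc l x *v dir (bk.stable_angle x))"]) measurable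
    have "AE x in M. (\<lambda>n. Ac n x *v dir (stable_angle x)) \<longlonglongrightarrow> 0"
      using s by eventually_elim (rule tendsto_0_of_exp_rate[OF True])
    moreover have "AE x in M. (\<lambda>n. Bc n x *v dir (bk.stable_angle x)) \<longlonglongrightarrow> 0"
      using u by eventually_elim (rule tendsto_0_of_exp_rate[OF True])
    ultimately have "AE x in M. bk.stable_angle x \<noteq> stable_angle x"
      by (intro contracted_directions_differ stable_angle_measurable bk.stable_angle_measurable
          stable_angle_range bk.stable_angle_range)
    then show ?thesis unfolding good_def using lim rec s u rec_u by eventually_elim blast
  qed
qed

end

section \<open>One-dimensional radial dynamics\<close>

text \<open>Here k stands for h (\<beta> x). \<open>k_ratio\<close> is what strict concavity gives
  on chords from 0, namely strict decrease of k x / x, while \<open>k_le\<close> and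
  \<open>k_slope\<close> say that this quotient tends to b at 0 from below.\<close>

locale radial_map =
  fixes k :: "real \<Rightarrow> real" and b :: real
  assumes k_0: "k 0 = 0"
    and k_strict_mono: "strict_mono_on {0..} k"
    and k_continuous: "continuous_on {0..} k"
    and k_ratio: "\<And>x y. 0 < x \<Longrightarrow> x < y \<Longrightarrow> x * k y < y * k x"
    and k_le: "\<And>x. 0 \<le> x \<Longrightarrow> k x \<le> b * x"
    and k_slope: "\<And>q. q < b \<Longrightarrow> \<exists>e>0. \<forall>x\<in>{0..e}. q * x \<le> k x"
begin

lemma k_mono: "0 \<le> x \<Longrightarrow> x \<le> y \<Longrightarrow> k x \<le> k y"
  using strict_mono_on_leD[OF k_strict_mono] by simp

lemma k_less: "0 \<le> x \<Longrightarrow> x < y \<Longrightarrow> k x < k y"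
  using strict_mono_onD[OF k_strict_mono] by simp

lemma k_pos: "0 < x \<Longrightarrow> 0 < k x"
  using k_less[of 0 x] by (simp add: k_0)

lemma k_nonneg: "0 \<le> x \<Longrightarrow> 0 \<le> k x"
  using k_mono[of 0 x] by (simp add: k_0)

lemma tendsto_k:
  assumes "(f \<longlongrightarrow> l) F" "0 \<le> l" "\<And>x. 0 \<le> f x"
  shows "((\<lambda>x. k (f x)) \<longlongrightarrow> k l) F"
  using continuous_on_tendsto_compose[OF k_continuous assms(1)] assms by simp

lemma log_contraction_strict:
  assumes "0 < x" "x < y" shows "ln (k y) - ln (k x) < ln y - ln x"
proof -
  have "ln (x * k y) < ln (y * k x)"
    using assms k_pos[of x] k_pos[of y] k_ratio[OF assms] by (subst ln_less_cancel_iff) auto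
  then show ?thesis using assms k_pos[of x] k_pos[of y] by (simp add: ln_mult)
qed

lemma log_contraction:
  assumes "0 < x" "x \<le> y"
  shows "0 \<le> ln (k y) - ln (k x)" "ln (k y) - ln (k x) \<le> ln y - ln x"
  using assms k_mono[of x y] k_pos[of x] k_pos[of y] log_contraction_strict[of x y]
  by (auto simp: le_less)

text \<open>The pairs in [c, 1] x [c, 1] at logarithmic distance at least d form a compact set, on
  which the gain in \<open>log_contraction_strict\<close> is continuous and positive.\<close>

lemma uniform_log_contraction:
  assumes c: "0 < c" and d: "0 < d"
  shows "\<exists>e>0. \<forall>x y. c \<le> x \<and> y \<le> 1 \<and> exp d * x \<le> y \<longrightarrow> ln (k y) - ln (k x) \<le> ln y - ln x - e"
proof -
  define S where "S = {p :: real \<times> real. p \<in> {c..1} \<times> {c..1} \<and> exp d * fst p \<le> snd p}"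
  define f where "f p = ln (snd p) - ln (fst p) - (ln (k (snd p)) - ln (k (fst p)))" for p
  have S: "p \<in> S \<Longrightarrow> c \<le> fst p \<and> c \<le> snd p \<and> fst p < snd p" for p
  proof -
    assume p: "p \<in> S"
    then have "c \<le> fst p" "c \<le> snd p" "exp d * fst p \<le> snd p" by (auto simp: S_def)
    moreover have "1 * fst p < exp d * fst p" using d c \<open>c \<le> fst p\<close> by (intro mult_strict_right_mono) auto
    ultimately show ?thesis by simp
  qed
  have "S = ({c..1} \<times> {c..1}) \<inter> {p. exp d * fst p \<le> snd p}" by (auto simp: S_def)
  moreover have "closed {p :: real \<times> real. exp d * fst p \<le> snd p}"
    by (intro closed_Collect_le continuous_intros)
  ultimately have comp: "compact S" by (simp add: compact_Times compact_Int_closed)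
  have kc: "continuous_on S (\<lambda>p. k (g p))" if "continuous_on S g" "\<And>p. p \<in> S \<Longrightarrow> 0 \<le> g p" for g
    by (rule continuous_on_compose2[OF k_continuous that(1)]) (use that in auto)
  have cont: "continuous_on S f"
    unfolding f_def
  proof (intro continuous_on_diff continuous_on_ln kc continuous_on_fst continuous_on_snd continuous_on_id ballI)
    fix p assume "p \<in> S"
    then have p: "c \<le> fst p" "c \<le> snd p" using S by auto
    show "fst p \<noteq> 0" "snd p \<noteq> 0" "0 \<le> fst p" "0 \<le> snd p" using p c by auto
    show "k (fst p) \<noteq> 0" "k (snd p) \<noteq> 0" using k_pos[of "fst p"] k_pos[of "snd p"] p c by auto
  qed
  obtain e where e: "0 < e" "\<And>p. p \<in> S \<Longrightarrow> e \<le> f p"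
  proof (cases "S = {}")
    case True then show ?thesis using that[of 1] by simp
  next
    case False
    obtain p where p: "p \<in> S" "\<And>p'. p' \<in> S \<Longrightarrow> f p \<le> f p'"
      using continuous_attains_inf[OF comp False cont] by blast
    have "0 < f p" using log_contraction_strict[of "fst p" "snd p"] S[OF p(1)] c by (simp add: f_def)
    then show ?thesis using that p by blast
  qed
  show ?thesis
  proof (intro exI[of _ e] conjI e(1) allI impI)
    fix x y assume xy: "c \<le> x \<and> y \<le> 1 \<and> exp d * x \<le> y"
    have "1 * x \<le> exp d * x" using d c xy by (intro mult_right_mono) auto
    then have "(x, y) \<in> S" using xy by (auto simp: S_def)
    then show "ln (k y) - ln (k x) \<le> ln y - ln x - e" using e(2)[of "(x, y)"] by (simp add: f_def)
  qed
qed

text \<open>Read backwards in time: \<open>x i\<close> and \<open>y i\<close> are the radii of two orbits over the same directions at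
  time \<open>-i\<close>. Their logarithmic distance grows by a fixed amount each time both are at least \<open>c\<close>,
  yet it is at most \<open>- ln c\<close> at such times.\<close>

lemma pullback_contraction:
  assumes c: "0 < c" and d: "0 < d"
  obtains N where "\<And>n x y a.
    (\<And>i. i < n \<Longrightarrow> 0 < a i \<and> x i = k (x (Suc i)) * a i \<and> y i = k (y (Suc i)) * a i) \<Longrightarrow>
    (\<And>i. i \<le> n \<Longrightarrow> 0 < x i \<and> x i \<le> y i \<and> y i \<le> 1) \<Longrightarrow>
    N \<le> card {i \<in> {1..n}. c \<le> x i} \<Longrightarrow> y 0 < exp d * x 0"
proof -
  obtain e where e: "0 < e" and contr: "\<And>x y. c \<le> x \<Longrightarrow> y \<le> 1 \<Longrightarrow> exp d * x \<le> y \<Longrightarrow>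
      ln (k y) - ln (k x) \<le> ln y - ln x - e"
    using uniform_log_contraction[OF c d] by blast
  \<comment> \<open>Each visit adds \<open>e\<close> to the logarithmic distance, so
    \<open>N0\<close> visits exceed the ceiling - ln c. The choice \<open>Suc N0\<close> below makes
    the set of visits nonempty even if \<open>N0 = 0\<close>, so that its last element can be
    evaluated.\<close>
  obtain N0 :: nat where N0: "- ln c < N0 * e" using reals_Archimedean3[OF e] by blast
  show thesis
  proof (rule that[of "Suc N0"], rule ccontr)
    fix n :: nat and x y a :: "nat \<Rightarrow> real"
    assume step: "\<And>i. i < n \<Longrightarrow> 0 < a i \<and> x i = k (x (Suc i)) * a i \<and> y i = k (y (Suc i)) * a i"
      and xy: "\<And>i. i \<le> n \<Longrightarrow> 0 < x i \<and> x i \<le> y i \<and> y i \<le> 1"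
      and card: "Suc N0 \<le> card {i \<in> {1..n}. c \<le> x i}" and "\<not> y 0 < exp d * x 0"
    define D where "D i = ln (y i) - ln (x i)" for i
    have expd: "exp d * x i \<le> y i \<longleftrightarrow> d \<le> D i" if "i \<le> n" for i
    proof -
      have "exp d * x i \<le> y i \<longleftrightarrow> ln (exp d * x i) \<le> ln (y i)"
        using xy[OF that] by (subst ln_le_cancel_iff) auto
      then show ?thesis using xy[OF that] by (simp add: ln_mult D_def algebra_simps)
    qed
    have Dstep: "D i = ln (k (y (Suc i))) - ln (k (x (Suc i)))" if "i < n" for i
    proof -
      have "0 < x (Suc i)" "0 < y (Suc i)" using xy[of "Suc i"] that by auto
      then show ?thesis
        using step[OF that] k_pos[of "x (Suc i)"] k_pos[of "y (Suc i)"] by (simp add: D_def ln_mult)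
    qed
    have grow: "d + e * card {j \<in> {1..i}. c \<le> x j} \<le> D i" if "i \<le> n" for i
      using that
    proof (induction i)
      case 0
      then show ?case using \<open>\<not> y 0 < exp d * x 0\<close> expd[of 0] by simp
    next
      case (Suc i)
      have set: "{j \<in> {1..Suc i}. c \<le> x j} =
          (if c \<le> x (Suc i) then insert (Suc i) {j \<in> {1..i}. c \<le> x j} else {j \<in> {1..i}. c \<le> x j})"
        by (auto simp: le_Suc_eq)
      have xs: "0 < x (Suc i)" "x (Suc i) \<le> y (Suc i)" "y (Suc i) \<le> 1" using xy[OF Suc.prems] by auto
      have le: "D i \<le> D (Suc i)" using log_contraction(2)[OF xs(1,2)] Dstep[of i] Suc.prems by (simp add: D_def)
      have IH: "d + e * card {j \<in> {1..i}. c \<le> x j} \<le> D i" using Suc by simp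
      show ?case
      proof (cases "c \<le> x (Suc i)")
        case True
        have "0 \<le> e * card {j \<in> {1..i}. c \<le> x j}" using e by simp
        then have "d \<le> D (Suc i)" using IH le by linarith
        then have "exp d * x (Suc i) \<le> y (Suc i)" using expd[OF Suc.prems] by simp
        then have "D i \<le> D (Suc i) - e" using contr[OF True xs(3)] Dstep[of i] Suc.prems by (simp add: D_def)
        moreover have "card {j \<in> {1..Suc i}. c \<le> x j} = Suc (card {j \<in> {1..i}. c \<le> x j})"
          unfolding set using True by (subst if_P) auto
        ultimately show ?thesis using IH by (simp add: algebra_simps)
      next
        case False
        then show ?thesis unfolding set using IH le by simp
      qed
    qed
    define G where "G = {i \<in> {1..n}. c \<le> x i}"
    have "finite G" by (simp add: G_def)
    moreover have "G \<noteq> {}"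
    proof
      assume "G = {}"
      then have "card G = 0" by simp
      then show False using card unfolding G_def[symmetric] by simp
    qed
    ultimately have m: "Max G \<in> G" "\<And>i. i \<in> G \<Longrightarrow> i \<le> Max G" by auto
    have "{j \<in> {1..Max G}. c \<le> x j} = G" using m by (fastforce simp: G_def)
    then have "d + e * card G \<le> D (Max G)" using grow[of "Max G"] m(1) by (simp add: G_def)
    moreover have "D (Max G) \<le> - ln c"
    proof -
      have "Max G \<le> n" "c \<le> x (Max G)" using m(1) by (auto simp: G_def)
      then have "ln c \<le> ln (x (Max G))" "ln (y (Max G)) \<le> 0" using c xy[of "Max G"] by auto
      then show ?thesis by (simp add: D_def)
    qed
    moreover have "N0 * e \<le> e * card G"
      using card e by (simp add: G_def mult.commute mult_left_mono)
    ultimately show False using N0 d by linarith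
  qed
qed

end

text \<open>Think of \<open>\<delta>\<close> as a signed logarithmic distance, \<open>c\<close> as
  its value after contraction and \<open>m\<close> as a vanishing drift. The modulus of
  \<open>\<delta> - m\<close> cannot grow above a small threshold. If it stayed above twice the
  threshold, it would decrease and converge, against infinitely many drops of a fixed size.\<close>

lemma damped_sequence_tendsto_0:
  fixes \<delta> c m :: "nat \<Rightarrow> real"
  assumes betw: "\<And>n. 0 \<le> \<delta> n \<Longrightarrow> 0 \<le> c n \<and> c n \<le> \<delta> n" "\<And>n. \<delta> n \<le> 0 \<Longrightarrow> \<delta> n \<le> c n \<and> c n \<le> 0"
    and rec: "\<And>n. \<delta> (Suc n) - m (Suc n) = c n - m n"
    and m: "m \<longlonglongrightarrow> 0"
    and contr: "\<And>e D. 0 < e \<Longrightarrow> \<exists>\<eta>>0. infinite {n. e \<le> \<bar>\<delta> n\<bar> \<and> \<bar>\<delta> n\<bar> \<le> D \<longrightarrow> \<bar>c n\<bar> \<le> \<bar>\<delta> n\<bar> - \<eta>}"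
  shows "\<delta> \<longlonglongrightarrow> 0"
proof (rule LIMSEQ_I)
  fix r :: real assume "0 < r"
  \<comment> \<open>At the end the corrected distance is at most 2 \<epsilon> and the drift below
    \<epsilon>, in total less than r.\<close>
  define \<epsilon> where "\<epsilon> = r / 4"
  have \<epsilon>: "0 < \<epsilon>" using \<open>0 < r\<close> by (simp add: \<epsilon>_def)
  define u where "u n = \<delta> n - m n" for n
  obtain N where N: "\<And>n. n \<ge> N \<Longrightarrow> \<bar>m n\<bar> < \<epsilon>"
    using LIMSEQ_D[OF m \<epsilon>] by auto
  have step: "\<bar>u (Suc n)\<bar> \<le> max \<bar>u n\<bar> \<epsilon>" if "n \<ge> N" for n
    using betw[of n] rec[of n] N[OF that] by (cases "0 \<le> \<delta> n") (auto simp: u_def abs_if max_def)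
  have mono: "\<bar>u (n + j)\<bar> \<le> max \<bar>u n\<bar> \<epsilon>" if "n \<ge> N" for n j
  proof (induction j)
    case (Suc j)
    then show ?case using step[of "n + j"] that by simp
  qed simp
  have "\<exists>n\<ge>N. \<bar>u n\<bar> \<le> 2 * \<epsilon>"
  proof (rule ccontr)
    assume "\<not> (\<exists>n\<ge>N. \<bar>u n\<bar> \<le> 2 * \<epsilon>)"
    then have big: "2 * \<epsilon> < \<bar>u n\<bar>" if "n \<ge> N" for n using that by force
    define D where "D = \<bar>u N\<bar> + 2 * \<epsilon>"
    have range: "\<epsilon> \<le> \<bar>\<delta> n\<bar> \<and> \<bar>\<delta> n\<bar> \<le> D" if "n \<ge> N" for n
      using big[OF that] N[OF that] mono[of N "n - N"] that \<epsilon> by (auto simp: u_def D_def)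
    obtain \<eta> where \<eta>: "0 < \<eta>" "infinite {n. \<epsilon> \<le> \<bar>\<delta> n\<bar> \<and> \<bar>\<delta> n\<bar> \<le> D \<longrightarrow> \<bar>c n\<bar> \<le> \<bar>\<delta> n\<bar> - \<eta>}"
      using contr[OF \<epsilon>] by blast
    have drop: "\<bar>u (Suc n)\<bar> \<le> \<bar>u n\<bar> - \<eta>" if "n \<ge> N" "\<bar>c n\<bar> \<le> \<bar>\<delta> n\<bar> - \<eta>" for n
      using betw[of n] rec[of n] N[OF that(1)] big[of n] big[of "Suc n"] that \<epsilon>
      by (cases "0 \<le> \<delta> n") (auto simp: u_def abs_if split: if_splits)
    have dec: "decseq (\<lambda>n. \<bar>u (n + N)\<bar>)"
      using step big \<epsilon> by (intro decseq_SucI) (smt (verit) add_Suc le_add2)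
    have "convergent (\<lambda>n. \<bar>u (n + N)\<bar>)"
      by (rule decseq_convergent[OF dec, of 0]) (auto simp: convergent_def)
    then obtain l where l: "(\<lambda>n. \<bar>u (n + N)\<bar>) \<longlonglongrightarrow> l" by (auto simp: convergent_def)
    then have "(\<lambda>n. \<bar>u n\<bar>) \<longlonglongrightarrow> l" by (rule LIMSEQ_offset)
    then have "(\<lambda>n. \<bar>u n\<bar> - \<bar>u (Suc n)\<bar>) \<longlonglongrightarrow> l - l" by (intro tendsto_diff LIMSEQ_Suc)
    then have "\<forall>\<^sub>F n in sequentially. \<bar>u n\<bar> - \<bar>u (Suc n)\<bar> < \<eta>" using \<eta>(1) by (auto dest: order_tendstoD)
    then obtain N' where N': "\<And>n. n \<ge> N' \<Longrightarrow> \<bar>u n\<bar> - \<bar>u (Suc n)\<bar> < \<eta>"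
      by (auto simp: eventually_sequentially)
    obtain n where n: "n \<ge> max N N'" "\<epsilon> \<le> \<bar>\<delta> n\<bar> \<and> \<bar>\<delta> n\<bar> \<le> D \<longrightarrow> \<bar>c n\<bar> \<le> \<bar>\<delta> n\<bar> - \<eta>"
      using \<eta>(2) unfolding infinite_nat_iff_unbounded_le by blast
    then have "\<bar>c n\<bar> \<le> \<bar>\<delta> n\<bar> - \<eta>" using range[of n] by simp
    then show False using drop[of n] N'[of n] n(1) by simp
  qed
  then obtain n where n: "n \<ge> N" "\<bar>u n\<bar> \<le> 2 * \<epsilon>" by blast
  have "norm (\<delta> i - 0) < r" if "i \<ge> n" for i
  proof -
    have "\<bar>u i\<bar> \<le> 2 * \<epsilon>" using mono[OF n(1), of "i - n"] n \<epsilon> that by simp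
    moreover have "\<bar>m i\<bar> < \<epsilon>" using N[of i] n that by simp
    ultimately show ?thesis using \<epsilon> by (simp add: u_def \<epsilon>_def abs_if split: if_splits)
  qed
  then show "\<exists>no. \<forall>n\<ge>no. norm (\<delta> n - 0) < r" by blast
qed

context radial_map
begin

text \<open>Orbits over different directions have different factors \<open>p\<close> and
  \<open>s\<close>. The relation \<open>ps\<close> makes them cohomologous via \<open>g\<close>, so
  their logarithmic discrepancy is an increment of ln (g n), which converges and becomes the drift
  of \<open>damped_sequence_tendsto_0\<close>.\<close>

lemma forward_synchronization:
  fixes \<rho> r p s g :: "nat \<Rightarrow> real"
  assumes pos: "\<And>n. 0 < \<rho> n" "\<And>n. 0 < r n" "\<And>n. 0 < p n" "\<And>n. 0 < s n" "\<And>n. 0 < g n" "0 < l"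
    and rec: "\<And>n. \<rho> (Suc n) = k (\<rho> n) * p n" "\<And>n. r (Suc n) = k (r n) * s n"
    and ps: "\<And>n. p n * g n = s n * g (Suc n)"
    and g: "g \<longlonglongrightarrow> l"
    and le1: "\<And>n. \<rho> (Suc n) \<le> 1" "\<And>n. r n \<le> 1"
    and c: "0 < c" "infinite {n. c \<le> r n}"
  shows "(\<lambda>n. \<rho> n / r n) \<longlonglongrightarrow> 1"
proof -
  define \<delta> where "\<delta> n = ln (\<rho> n) - ln (r n)" for n
  define \<kappa> where "\<kappa> n = ln (k (\<rho> n)) - ln (k (r n))" for n
  define m where "m n = ln (g n) - ln l" for n
  have kpos: "0 < k (\<rho> n)" "0 < k (r n)" for n using pos k_pos by auto
  have sgn: "0 \<le> \<delta> n \<longleftrightarrow> r n \<le> \<rho> n" "\<delta> n \<le> 0 \<longleftrightarrow> \<rho> n \<le> r n" for n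
    using pos(1,2)[of n] by (simp_all add: \<delta>_def)
  have "\<delta> \<longlonglongrightarrow> 0"
  proof (rule damped_sequence_tendsto_0[where c=\<kappa> and m=m])
    show "0 \<le> \<kappa> n \<and> \<kappa> n \<le> \<delta> n" if "0 \<le> \<delta> n" for n
    proof -
      have "r n \<le> \<rho> n" using that sgn by blast
      then show ?thesis using log_contraction[of "r n" "\<rho> n"] pos(2)[of n] by (simp add: \<kappa>_def \<delta>_def)
    qed
    show "\<delta> n \<le> \<kappa> n \<and> \<kappa> n \<le> 0" if "\<delta> n \<le> 0" for n
    proof -
      have "\<rho> n \<le> r n" using that sgn by blast
      then show ?thesis using log_contraction[of "\<rho> n" "r n"] pos(1)[of n] by (simp add: \<kappa>_def \<delta>_def)
    qed
    show "\<delta> (Suc n) - m (Suc n) = \<kappa> n - m n" for n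
    proof -
      have "ln (p n * g n) = ln (s n * g (Suc n))" using ps by simp
      then show ?thesis
        using pos(3,4,5)[of n] pos(5)[of "Suc n"] kpos[of n]
        by (simp add: \<delta>_def \<kappa>_def m_def rec ln_mult)
    qed
    have "m \<longlonglongrightarrow> ln l - ln l" unfolding m_def using pos(6) by (intro tendsto_intros g) auto
    then show "m \<longlonglongrightarrow> 0" by simp
    fix e D :: real assume e: "0 < e"
    \<comment> \<open>If \<rho> n is the smaller radius, it is within a factor exp D of r n \<ge> c,
      so the uniform contraction has to be available down to this level.\<close>
    define c' where "c' = c * exp (- \<bar>D\<bar>)"
    have c': "0 < c'" "c' \<le> c" using c(1) by (auto simp: c'_def mult_le_cancel_left1)
    obtain \<eta> where \<eta>: "0 < \<eta>" "\<And>x y. c' \<le> x \<Longrightarrow> y \<le> 1 \<Longrightarrow> exp e * x \<le> y \<Longrightarrow>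
        ln (k y) - ln (k x) \<le> ln y - ln x - \<eta>"
      using uniform_log_contraction[OF c'(1) e] by blast
    have "\<bar>\<kappa> n\<bar> \<le> \<bar>\<delta> n\<bar> - \<eta>" if n: "0 < n" "c \<le> r n" "e \<le> \<bar>\<delta> n\<bar>" "\<bar>\<delta> n\<bar> \<le> D" for n
    proof -
      have \<rho>1: "\<rho> n \<le> 1" using le1(1)[of "n - 1"] n(1) by simp
      have expe: "exp e * x \<le> y \<longleftrightarrow> e \<le> ln y - ln x" if "0 < x" "0 < y" for x y
      proof -
        have "exp e * x \<le> y \<longleftrightarrow> ln (exp e * x) \<le> ln y" using that by (subst ln_le_cancel_iff) auto
        then show ?thesis using that by (simp add: ln_mult algebra_simps)
      qed
      show ?thesis
      proof (cases "0 \<le> \<delta> n")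
        case True
        then have "exp e * r n \<le> \<rho> n" using n pos by (subst expe) (auto simp: \<delta>_def)
        then have "\<kappa> n \<le> \<delta> n - \<eta>" using \<eta>(2)[of "r n" "\<rho> n"] n c' \<rho>1 by (simp add: \<kappa>_def \<delta>_def)
        moreover have "0 \<le> \<kappa> n"
          using log_contraction(1)[of "r n" "\<rho> n"] True pos(2)[of n] by (simp add: sgn \<kappa>_def)
        ultimately show ?thesis using True by simp
      next
        case False
        then have "exp e * \<rho> n \<le> r n" using n pos by (subst expe) (auto simp: \<delta>_def)
        moreover have "c' \<le> \<rho> n"
        proof -
          have "ln c - \<bar>D\<bar> \<le> ln (\<rho> n)"
          proof -
            have "ln c \<le> ln (r n)" using n(2) c(1) pos(2)[of n] by simp
            then show ?thesis using n(4) False by (simp add: \<delta>_def)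
          qed
          then have "exp (ln c - \<bar>D\<bar>) \<le> \<rho> n" using pos(1)[of n] by (metis exp_le_cancel_iff exp_ln)
          then show ?thesis using c(1) by (simp add: c'_def exp_diff exp_minus divide_inverse)
        qed
        ultimately have "- \<kappa> n \<le> - \<delta> n - \<eta>" using \<eta>(2)[of "\<rho> n" "r n"] le1(2)[of n] by (simp add: \<kappa>_def \<delta>_def)
        moreover have "\<kappa> n \<le> 0"
          using log_contraction(1)[of "\<rho> n" "r n"] False pos(1)[of n] sgn[of n] by (simp add: \<kappa>_def)
        ultimately show ?thesis using False by simp
      qed
    qed
    \<comment> \<open>Time 0 is discarded because the initial radius \<rho> 0 may exceed 1.\<close>
    then have "{n. c \<le> r n} - {0} \<subseteq> {n. e \<le> \<bar>\<delta> n\<bar> \<and> \<bar>\<delta> n\<bar> \<le> D \<longrightarrow> \<bar>\<kappa> n\<bar> \<le> \<bar>\<delta> n\<bar> - \<eta>}"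
      by auto
    moreover have "infinite ({n. c \<le> r n} - {0})" using c(2) by simp
    ultimately show "\<exists>\<eta>>0. infinite {n. e \<le> \<bar>\<delta> n\<bar> \<and> \<bar>\<delta> n\<bar> \<le> D \<longrightarrow> \<bar>\<kappa> n\<bar> \<le> \<bar>\<delta> n\<bar> - \<eta>}"
      using \<eta>(1) infinite_super by blast
  qed
  then have "(\<lambda>n. exp (\<delta> n)) \<longlonglongrightarrow> exp 0" by (rule tendsto_exp)
  moreover have "exp (\<delta> n) = \<rho> n / r n" for n using pos(1,2)[of n] by (simp add: \<delta>_def exp_diff)
  ultimately show ?thesis by simp
qed

end

text \<open>Strict concavity on the chord from 0 gives the ratio condition. The quotients h y / y
  therefore decrease, and their limit h' 0 = 1 at 0 bounds them from above.\<close>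

lemma strictly_concave_radial_map:
  fixes h h' :: "real \<Rightarrow> real"
  assumes d: "\<forall>x\<ge>0. (h has_real_derivative h' x) (at x within {0..})" and d0: "h' 0 = 1" and h0: "h 0 = 0"
    and mono: "strict_mono_on {0..} h" and conc: "strictly_concave_on {0..} h" and "0 < \<beta>"
  shows "radial_map (\<lambda>x. h (\<beta> * x)) \<beta>"
proof -
  have ratio: "x * h y < y * h x" if "0 < x" "x < y" for x y
  proof -
    have "(1 - x/y) * h 0 + (x/y) * h y < h ((1 - x/y) * 0 + (x/y) * y)"
      by (rule conc[unfolded strictly_concave_on_def, THEN conjunct2, rule_format]) (use that in auto)
    then show ?thesis using that by (simp add: h0 field_simps)
  qed
  have lim: "((\<lambda>x. h x / x) \<longlongrightarrow> 1) (at 0 within {0..})"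
    using d[rule_format, of 0] by (simp add: has_field_derivative_iff h0 d0)
  have hle: "h x \<le> x" if "0 \<le> x" for x
  proof (cases "x = 0")
    case False
    then have x: "0 < x" using that by simp
    have "\<forall>\<^sub>F y in at 0 within {0..}. h x / x \<le> h y / y"
    proof -
      have "\<forall>\<^sub>F y in at 0 within {0..}. y < x" using x by (auto simp: eventually_at intro!: exI[of _ x])
      moreover have "\<forall>\<^sub>F y in at (0::real) within {0..}. 0 < y" by (auto simp: eventually_at intro!: exI[of _ 1])
      ultimately show ?thesis
      proof eventually_elim
        case (elim y)
        then show ?case using ratio[of y x] x by (simp add: field_simps less_imp_le)
      qed
    qed
    then have "h x / x \<le> 1"
      by (rule tendsto_lowerbound[OF lim]) (simp add: at_within_Ici_at_right)
    then show ?thesis using x by (simp add: divide_le_eq)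
  qed (simp add: h0)
  show ?thesis
  proof
    show "strict_mono_on {0..} (\<lambda>x. h (\<beta> * x))"
      using mono \<open>0 < \<beta>\<close> by (auto simp: strict_mono_on_def)
    have "continuous_on {0..} h"
      using d by (intro DERIV_continuous_on[where D=h']) auto
    then show "continuous_on {0..} (\<lambda>x. h (\<beta> * x))"
      by (rule continuous_on_compose2) (use \<open>0 < \<beta>\<close> in \<open>auto intro!: continuous_intros\<close>)
    show "x * h (\<beta> * y) < y * h (\<beta> * x)" if "0 < x" "x < y" for x y
    proof -
      have "(\<beta> * x) * h (\<beta> * y) < (\<beta> * y) * h (\<beta> * x)" using that \<open>0 < \<beta>\<close> by (intro ratio) auto
      then show ?thesis using \<open>0 < \<beta>\<close> by (simp add: mult.assoc)
    qed
    show "h (\<beta> * x) \<le> \<beta> * x" if "0 \<le> x" for x using hle that \<open>0 < \<beta>\<close> by simp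
    show "\<exists>e>0. \<forall>x\<in>{0..e}. q * x \<le> h (\<beta> * x)" if "q < \<beta>" for q
    proof -
      have "q / \<beta> < 1" using that \<open>0 < \<beta>\<close> by simp
      then have "\<forall>\<^sub>F y in at 0 within {0..}. q / \<beta> < h y / y" by (rule order_tendstoD[OF lim])
      then obtain r where r: "0 < r" "\<And>y. 0 < y \<Longrightarrow> y < r \<Longrightarrow> q / \<beta> < h y / y"
        by (auto simp: eventually_at dist_real_def)
      show ?thesis
      proof (intro exI[of _ "r / (2 * \<beta>)"] conjI ballI)
        fix x assume x: "x \<in> {0..r / (2 * \<beta>)}"
        show "q * x \<le> h (\<beta> * x)"
        proof (cases "x = 0")
          case False
          then have "0 < \<beta> * x" using x \<open>0 < \<beta>\<close> by auto
          moreover have "\<beta> * x < r" using x \<open>0 < \<beta>\<close> r(1) by (auto simp: field_simps)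
          ultimately have "q / \<beta> < h (\<beta> * x) / (\<beta> * x)" using r(2) by blast
          then show ?thesis using False x \<open>0 < \<beta>\<close> by (simp add: field_simps)
        qed (simp add: h0)
      qed (use r \<open>0 < \<beta>\<close> in simp)
    qed
  qed (simp add: h0)
qed

section \<open>The skew product in polar coordinates\<close>

context sl2_system
begin

lemma Bc_Suc: "x \<in> space M \<Longrightarrow> Bc (Suc n) x *v w = Bc n (ginv x) *v (Ainv x *v w)"
  using cocycle_add[of ginv Ainv 1 n x] by (simp flip: matrix_vector_mul_assoc)

lemma A_Ainv: "x \<in> space M \<Longrightarrow> A (ginv x) *v (Ainv x *v w) = w"
  by (simp add: Ainv_def mv_adj2 det_A ginv_space)

lemma Ainv_A: "x \<in> space M \<Longrightarrow> Ainv (\<gamma> x) *v (A x *v w) = w"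
  by (simp add: Ainv_def ginv_gamma adj2_mv det_A)

lemma Ainv_nonzero: "x \<in> space M \<Longrightarrow> w \<noteq> 0 \<Longrightarrow> Ainv x *v w \<noteq> 0"
  by (intro mv_nonzero bk.det_A)

lemma Bc_nonzero: "x \<in> space M \<Longrightarrow> w \<noteq> 0 \<Longrightarrow> Bc n x *v w \<noteq> 0"
  by (intro mv_nonzero bk.det_cocycle)

lemma Ac_nonzero: "x \<in> space M \<Longrightarrow> w \<noteq> 0 \<Longrightarrow> Ac n x *v w \<noteq> 0"
  by (intro mv_nonzero det_cocycle)

text \<open>The orbit starts n steps in the past and arrives over \<open>x\<close>, so that
  different n can be compared in one fibre.\<close>

definition pull :: "(real \<Rightarrow> real) \<Rightarrow> real \<Rightarrow> nat \<Rightarrow> 'a \<Rightarrow> real^2 \<Rightarrow> real^2" where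
  "pull h \<beta> n x v = fibre_iter \<gamma> A h \<beta> n ((ginv ^^ n) x) v"

lemma pull_0 [simp]: "pull h \<beta> 0 x v = v"
  by (simp add: pull_def)

lemma pull_Suc:
  assumes "x \<in> space M"
  shows "pull h \<beta> (Suc n) x v = fibre_map A h \<beta> (ginv x) (pull h \<beta> n (ginv x) v)"
  using gamma_pow_ginv_pow[of "ginv x" n] assms by (simp add: pull_def funpow_swap1 ginv_space)

lemma skew_iter: "(skew \<gamma> A h \<beta> ^^ n) (x, v) = ((\<gamma> ^^ n) x, fibre_iter \<gamma> A h \<beta> n x v)"
  by (induction n) (simp_all add: skew_def)

lemma fibre_attractor:
  assumes x: "x \<in> space M"
  shows "fibre (attractor M \<gamma> A h \<beta>) x = (\<Inter>n. pull h \<beta> n x ` cball 0 1)"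
proof -
  have "(x, v) \<in> (skew \<gamma> A h \<beta> ^^ n) ` (space M \<times> cball 0 1) \<longleftrightarrow> v \<in> pull h \<beta> n x ` cball 0 1" for n v
  proof
    assume "(x, v) \<in> (skew \<gamma> A h \<beta> ^^ n) ` (space M \<times> cball 0 1)"
    then obtain y u where yu: "y \<in> space M" "u \<in> cball 0 1" "(x, v) = (skew \<gamma> A h \<beta> ^^ n) (y, u)" by auto
    then have "(ginv ^^ n) x = y" "v = fibre_iter \<gamma> A h \<beta> n y u"
      using ginv_pow_gamma_pow by (auto simp: skew_iter)
    then show "v \<in> pull h \<beta> n x ` cball 0 1" using yu(2) by (auto simp: pull_def)
  next
    assume "v \<in> pull h \<beta> n x ` cball 0 1"
    then obtain u where u: "u \<in> cball 0 1" "v = fibre_iter \<gamma> A h \<beta> n ((ginv ^^ n) x) u"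
      by (auto simp: pull_def)
    have "(x, v) = (skew \<gamma> A h \<beta> ^^ n) ((ginv ^^ n) x, u)"
      by (simp add: skew_iter u(2) gamma_pow_ginv_pow[OF x])
    then show "(x, v) \<in> (skew \<gamma> A h \<beta> ^^ n) ` (space M \<times> cball 0 1)"
      using bk.T_space[OF x] u(1) by blast
  qed
  then show ?thesis by (auto simp: fibre_def attractor_def)
qed

text \<open>The iterate is a multiple c of the linear image with 0 \<le> c \<le> \<beta>^n, since h
  t \<le> t at every step.\<close>

lemma fibre_iter_bound:
  assumes h: "\<And>t. 0 \<le> t \<Longrightarrow> 0 \<le> h t \<and> h t \<le> t" and "0 \<le> \<beta>"
  shows "norm (fibre_iter \<gamma> A h \<beta> n x v) \<le> \<beta> ^ n * opnorm (Ac n x) * norm v"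
proof -
  have "\<exists>c. 0 \<le> c \<and> c \<le> \<beta> ^ n \<and> fibre_iter \<gamma> A h \<beta> n x v = c *\<^sub>R (Ac n x *v v)"
  proof (induction n)
    case 0 show ?case by (intro exI[of _ 1]) simp
  next
    case (Suc n)
    then obtain c where c: "0 \<le> c" "c \<le> \<beta> ^ n" "fibre_iter \<gamma> A h \<beta> n x v = c *\<^sub>R (Ac n x *v v)" by blast
    define w where "w = fibre_iter \<gamma> A h \<beta> n x v"
    have "\<exists>c'. 0 \<le> c' \<and> c' \<le> \<beta> \<and> fibre_map A h \<beta> ((\<gamma> ^^ n) x) w = c' *\<^sub>R (A ((\<gamma> ^^ n) x) *v w)"
    proof (cases "w = 0")
      case True
      then show ?thesis using \<open>0 \<le> \<beta>\<close> by (intro exI[of _ 0]) (simp add: fibre_map_def)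
    next
      case False
      have "h (\<beta> * norm w) / norm w \<le> \<beta>"
        using h[of "\<beta> * norm w"] False \<open>0 \<le> \<beta>\<close> by (simp add: divide_le_eq)
      moreover have "0 \<le> h (\<beta> * norm w) / norm w" using h[of "\<beta> * norm w"] \<open>0 \<le> \<beta>\<close> by simp
      ultimately show ?thesis using False
        by (intro exI[of _ "h (\<beta> * norm w) / norm w"])
          (simp add: fibre_map_def matrix_vector_mult_scaleR divide_inverse)
    qed
    then obtain c' where c': "0 \<le> c'" "c' \<le> \<beta>" "fibre_map A h \<beta> ((\<gamma> ^^ n) x) w = c' *\<^sub>R (A ((\<gamma> ^^ n) x) *v w)"
      by blast
    have "fibre_iter \<gamma> A h \<beta> (Suc n) x v = (c' * c) *\<^sub>R (Ac (Suc n) x *v v)"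
      using c' c(3) by (simp add: w_def matrix_vector_mult_scaleR flip: matrix_vector_mul_assoc)
    moreover have "c' * c \<le> \<beta> ^ Suc n" using c c' \<open>0 \<le> \<beta>\<close> by (auto intro!: mult_mono)
    ultimately show ?case using c c' by (intro exI[of _ "c' * c"]) simp
  qed
  then obtain c where c: "0 \<le> c" "c \<le> \<beta> ^ n" "fibre_iter \<gamma> A h \<beta> n x v = c *\<^sub>R (Ac n x *v v)" by blast
  have "norm (fibre_iter \<gamma> A h \<beta> n x v) = c * norm (Ac n x *v v)" using c by simp
  also have "\<dots> \<le> \<beta> ^ n * (opnorm (Ac n x) * norm v)"
    using c \<open>0 \<le> \<beta>\<close> by (intro mult_mono norm_mv_le) auto
  finally show ?thesis by (simp add: mult.assoc)
qed

text \<open>Placed outside \<open>skew_system\<close>, which assumes \<beta> > 0, so that \<beta> =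
  0 is covered.\<close>

lemma subcritical:
  assumes x: "x \<in> space M" "good x" and h: "\<And>t. 0 \<le> t \<Longrightarrow> 0 \<le> h t \<and> h t \<le> t"
    and \<beta>: "0 \<le> \<beta>" "\<beta> < exp (- \<Lambda>)"
  shows "fibre (attractor M \<gamma> A h \<beta>) x = {0}" "(\<lambda>n. fibre_iter \<gamma> A h \<beta> n x v) \<longlonglongrightarrow> 0"
proof -
  have pos: "0 < opnorm (Ac n x)" "0 < opnorm (Bc n x)" for n
    using opnorm_cocycle_ge_1[OF x(1), of n] bk.opnorm_cocycle_ge_1[OF x(1), of n] by linarith+
  have lim: "(\<lambda>n. ln (opnorm (Ac n x)) / n) \<longlonglongrightarrow> \<Lambda>" "(\<lambda>n. ln (opnorm (Bc n x)) / n) \<longlonglongrightarrow> \<Lambda>"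
    using x(2) by (auto simp: good_def)
  have "(\<lambda>n. \<beta> ^ n * opnorm (Ac n x) * norm v) \<longlonglongrightarrow> 0"
    using subcritical_tendsto_0[OF lim(1) pos(1) \<beta>] by (rule tendsto_mult_left_zero)
  then show "(\<lambda>n. fibre_iter \<gamma> A h \<beta> n x v) \<longlonglongrightarrow> 0"
    by (rule Lim_null_comparison[rotated]) (intro always_eventually allI fibre_iter_bound h \<beta>(1))
  have pull0: "pull h \<beta> n x 0 = 0" for n
    using fibre_iter_bound[OF h \<beta>(1), of n "(ginv ^^ n) x" 0] by (simp add: pull_def)
  have bound: "norm u \<le> \<beta> ^ n * opnorm (Bc n x)" if "u \<in> pull h \<beta> n x ` cball 0 1" for u n
  proof -
    obtain w where "w \<in> cball 0 1" and w: "u = pull h \<beta> n x w" using \<open>u \<in> _\<close> by blast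
    then have w1: "norm w \<le> 1" by simp
    have "norm u \<le> \<beta> ^ n * opnorm (Ac n ((ginv ^^ n) x)) * norm w"
      unfolding w pull_def by (rule fibre_iter_bound[OF h \<beta>(1)])
    also have "\<dots> \<le> \<beta> ^ n * opnorm (Ac n ((ginv ^^ n) x))"
      using w1 \<beta>(1) opnorm_nonneg by (intro mult_right_le_one_le mult_nonneg_nonneg) auto
    finally show ?thesis by (simp add: back_cocycle[OF x(1)] opnorm_adj2)
  qed
  show "fibre (attractor M \<gamma> A h \<beta>) x = {0}"
    unfolding fibre_attractor[OF x(1)]
  proof (intro equalityI subsetI)
    fix u assume "u \<in> (\<Inter>n. pull h \<beta> n x ` cball 0 1)"
    then have "norm u \<le> \<beta> ^ n * opnorm (Bc n x)" for n using bound by blast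
    then have "norm u \<le> 0"
      using subcritical_tendsto_0[OF lim(2) pos(2) \<beta>] by (intro LIMSEQ_le_const) auto
    then show "u \<in> {0}" by simp
  next
    fix u :: "real^2" assume "u \<in> {0}"
    then show "u \<in> (\<Inter>n. pull h \<beta> n x ` cball 0 1)" using pull0 by (auto intro!: image_eqI[of _ _ 0])
  qed
qed

end

locale skew_system = sl2_system M \<gamma> A C + radial_map "\<lambda>t. h (\<beta> * t)" \<beta>
  for M :: "'a measure" and \<gamma> A C h \<beta> +
  assumes \<beta>_pos: "0 < \<beta>" and h_C: "\<And>t. 0 \<le> t \<Longrightarrow> h t * C \<le> 1"
begin

abbreviation k :: "real \<Rightarrow> real" where "k t \<equiv> h (\<beta> * t)"
abbreviation fit :: "nat \<Rightarrow> 'a \<Rightarrow> real^2 \<Rightarrow> real^2" where "fit \<equiv> fibre_iter \<gamma> A h \<beta>"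
abbreviation attr :: "'a \<Rightarrow> (real^2) set" where "attr \<equiv> fibre (attractor M \<gamma> A h \<beta>)"

section \<open>Radii along rays and their decreasing limit\<close>

lemma fibre_map_ray:
  assumes "w \<noteq> 0" "A x *v w \<noteq> 0" "0 \<le> r"
  shows "fibre_map A h \<beta> x (r *\<^sub>R sgn w) = (k r * (norm (A x *v w) / norm w)) *\<^sub>R sgn (A x *v w)"
proof (cases "r = 0")
  case True
  then show ?thesis using k_0 by (simp add: fibre_map_def)
next
  case False
  then have "norm (r *\<^sub>R sgn w) = r" using assms by (simp add: norm_sgn)
  moreover have "(r *\<^sub>R sgn w) /\<^sub>R r = sgn w" "r *\<^sub>R sgn w \<noteq> 0" using False assms by (auto simp: sgn_zero_iff)
  ultimately have "fibre_map A h \<beta> x (r *\<^sub>R sgn w) = k r *\<^sub>R (A x *v sgn w)" by (simp add: fibre_map_def)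
  also have "A x *v sgn w = (norm (A x *v w) / norm w) *\<^sub>R sgn (A x *v w)"
    using assms by (simp add: sgn_div_norm matrix_vector_mult_scaleR divide_inverse)
  finally show ?thesis by simp
qed

lemma fibre_map_0 [simp]: "fibre_map A h \<beta> x 0 = 0"
  by (simp add: fibre_map_def)

lemma fit_0 [simp]: "fit n x 0 = 0"
  by (induction n) auto

text \<open>The radius at \<open>x\<close> in direction \<open>w\<close> of the orbit started n
  steps earlier at radius r over \<open>Bc n x *v w\<close>, see \<open>pull_ray\<close>. The ray of
  arrival stays fixed while n varies, and only the line of \<open>w\<close> matters
  (\<open>rad_scale\<close>).\<close>

primrec rad :: "nat \<Rightarrow> 'a \<Rightarrow> real^2 \<Rightarrow> real \<Rightarrow> real" where
  "rad 0 x w r = r"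
| "rad (Suc n) x w r = k (rad n (ginv x) (Ainv x *v w) r) * (norm w / norm (Ainv x *v w))"

lemma rad_nonneg: "0 \<le> r \<Longrightarrow> 0 \<le> rad n x w r"
proof (induction n arbitrary: x w)
  case (Suc n)
  show ?case
    unfolding rad.simps by (intro mult_nonneg_nonneg k_nonneg divide_nonneg_nonneg norm_ge_zero Suc)
qed simp

lemma rad_at_0: "rad n x w 0 = 0"
  by (induction n arbitrary: x w) (use k_0 in auto)

lemma rad_mono: "0 \<le> r \<Longrightarrow> r \<le> s \<Longrightarrow> rad n x w r \<le> rad n x w s"
proof (induction n arbitrary: x w)
  case (Suc n)
  show ?case
    unfolding rad.simps
    by (intro mult_right_mono k_mono rad_nonneg divide_nonneg_nonneg norm_ge_zero Suc)
qed simp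

lemma rad_scale: "c \<noteq> 0 \<Longrightarrow> rad n x (c *\<^sub>R w) r = rad n x w r"
  by (induction n arbitrary: x w) (simp_all add: matrix_vector_mult_scaleR)

lemma norm_ratio_le: "x \<in> space M \<Longrightarrow> w \<noteq> 0 \<Longrightarrow> norm w / norm (Ainv x *v w) \<le> C"
  using norm_mv_le[of "A (ginv x)" "Ainv x *v w"] opnorm_A[OF ginv_space, of x] Ainv_nonzero[of x w]
  by (simp add: A_Ainv divide_le_eq) (meson mult_right_mono norm_ge_zero order_trans)

lemma rad_Suc_le_1:
  assumes "x \<in> space M" "w \<noteq> 0" "0 \<le> r" shows "rad (Suc n) x w r \<le> 1"
proof -
  define t where "t = rad n (ginv x) (Ainv x *v w) r"
  have t: "0 \<le> t" using rad_nonneg assms by (simp add: t_def)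
  have "rad (Suc n) x w r \<le> k t * C"
    unfolding rad.simps t_def[symmetric] by (intro mult_left_mono norm_ratio_le assms k_nonneg t)
  also have "\<dots> \<le> 1" using h_C[of "\<beta> * t"] \<beta>_pos t by simp
  finally show ?thesis .
qed

lemma rad_le_1: "x \<in> space M \<Longrightarrow> w \<noteq> 0 \<Longrightarrow> 0 \<le> r \<Longrightarrow> r \<le> 1 \<Longrightarrow> rad n x w r \<le> 1"
  using rad_Suc_le_1 by (cases n) auto

lemma rad_antimono_step: "x \<in> space M \<Longrightarrow> w \<noteq> 0 \<Longrightarrow> rad (Suc n) x w 1 \<le> rad n x w 1"
proof (induction n arbitrary: x w)
  case 0
  then show ?case using rad_Suc_le_1[of x w 1 0] by simp
next
  case (Suc n)
  have "rad (Suc n) (ginv x) (Ainv x *v w) 1 \<le> rad n (ginv x) (Ainv x *v w) 1"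
    by (intro Suc.IH ginv_space Ainv_nonzero Suc.prems)
  then have "k (rad (Suc n) (ginv x) (Ainv x *v w) 1) \<le> k (rad n (ginv x) (Ainv x *v w) 1)"
    by (intro k_mono rad_nonneg) auto
  then show ?case unfolding rad.simps(2)[of "Suc n" x] rad.simps(2)[of n x] by (intro mult_right_mono) auto
qed

lemma rad_decseq: "x \<in> space M \<Longrightarrow> w \<noteq> 0 \<Longrightarrow> decseq (\<lambda>n. rad n x w 1)"
  by (intro decseq_SucI rad_antimono_step)

lemma continuous_on_rad_r: "continuous_on {0..} (\<lambda>r. rad n x w r)"
proof (induction n arbitrary: x w)
  case (Suc n)
  have "continuous_on {0..} (\<lambda>r. k (rad n (ginv x) (Ainv x *v w) r))"
    by (rule continuous_on_compose2[OF k_continuous Suc]) (auto intro: rad_nonneg)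
  then show ?case unfolding rad.simps by (intro continuous_on_mult continuous_on_const)
qed (simp add: continuous_on_id)

lemma continuous_on_rad_w: "x \<in> space M \<Longrightarrow> 0 \<le> r \<Longrightarrow> continuous_on (-{0}) (\<lambda>w. rad n x w r)"
proof (induction n arbitrary: x)
  case (Suc n)
  have "continuous_on (-{0}) (\<lambda>w. rad n (ginv x) (Ainv x *v w) r)"
    by (rule continuous_on_compose2[OF Suc.IH[OF ginv_space[OF Suc.prems(1)] Suc.prems(2)] continuous_on_mv])
      (intro image_subsetI, simp add: Ainv_nonzero[OF Suc.prems(1)])
  then have "continuous_on (-{0}) (\<lambda>w. k (rad n (ginv x) (Ainv x *v w) r))"
    by (rule continuous_on_compose2[OF k_continuous]) (intro image_subsetI, simp add: rad_nonneg Suc.prems(2))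
  moreover have "continuous_on (-{0}) (\<lambda>w. norm w / norm (Ainv x *v w))"
    using Ainv_nonzero[OF Suc.prems(1)]
    by (intro continuous_on_divide continuous_on_norm continuous_on_mv continuous_on_id) auto
  ultimately show ?case unfolding rad.simps by (rule continuous_on_mult)
qed (simp add: continuous_on_const)

lemma borel_measurable_rad:
  assumes "w \<in> borel_measurable M" "0 \<le> r"
  shows "(\<lambda>x. rad n x (w x) r) \<in> borel_measurable M"
  using assms(1)
proof (induction n arbitrary: w)
  case (Suc n)
  note [measurable] = Suc.prems
  \<comment> \<open>The induction hypothesis concerns direction and radius at the same base point;
    \<open>w'\<close> is chosen so that its value at \<open>ginv x\<close> is
    \<open>Ainv x *v w x\<close>.\<close>
  define w' where "w' x = adj2 (A x) *v w (\<gamma> x)" for x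
  have w' [measurable]: "w' \<in> borel_measurable M" unfolding w'_def by measurable
  \<comment> \<open>Continuity of \<open>k\<close> is known on nonnegative reals only; truncation
    makes it measurable on the whole line and changes nothing at radii.\<close>
  have "continuous_on UNIV (\<lambda>t. k (max 0 t))"
    by (rule continuous_on_compose2[OF k_continuous]) (auto intro!: continuous_intros)
  then have [measurable]: "(\<lambda>t. k (max 0 t)) \<in> borel_measurable borel"
    by (rule borel_measurable_continuous_onI)
  have [measurable]: "(\<lambda>x. rad n x (w' x) r) \<in> borel_measurable M" by (rule Suc.IH) measurable
  have "(\<lambda>x. k (max 0 (rad n (ginv x) (w' (ginv x)) r))) \<in> borel_measurable M"
    by measurable
  moreover have "Ainv \<in> borel_measurable M" by (rule bk.A_measurable)
  ultimately have "(\<lambda>x. k (max 0 (rad n (ginv x) (w' (ginv x)) r)) * (norm (w x) / norm (Ainv x *v w x))) \<in> borel_measurable M"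
    by measurable
  note meas = this
  have eq: "rad (Suc n) x (w x) r =
      k (max 0 (rad n (ginv x) (w' (ginv x)) r)) * (norm (w x) / norm (Ainv x *v w x))" if "x \<in> space M" for x
    using rad_nonneg[OF assms(2)] by (simp add: w'_def Ainv_def gamma_ginv that)
  show ?case by (subst measurable_cong[OF eq]) (assumption, rule meas)
qed simp

lemma pull_ray:
  assumes "x \<in> space M" "w \<noteq> 0" "0 \<le> r"
  shows "pull h \<beta> n x (r *\<^sub>R sgn (Bc n x *v w)) = rad n x w r *\<^sub>R sgn w"
  using assms
proof (induction n arbitrary: x w)
  case (Suc n)
  have nz: "Ainv x *v w \<noteq> 0" using Ainv_nonzero Suc.prems by blast
  have "pull h \<beta> (Suc n) x (r *\<^sub>R sgn (Bc (Suc n) x *v w)) =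
      fibre_map A h \<beta> (ginv x) (rad n (ginv x) (Ainv x *v w) r *\<^sub>R sgn (Ainv x *v w))"
    using Suc.prems by (simp only: pull_Suc Bc_Suc Suc.IH[OF ginv_space nz])
  also have "\<dots> = rad (Suc n) x w r *\<^sub>R sgn w"
    using Suc.prems nz by (subst fibre_map_ray) (auto simp: A_Ainv rad_nonneg)
  finally show ?case .
qed simp

text \<open>Each ray over \<open>x\<close> is the image of a single ray n steps earlier, and along
  it the radius increases continuously from 0, so the intermediate value theorem fills the whole
  segment.\<close>

lemma ray_in_pull_iff:
  assumes x: "x \<in> space M" and w: "w \<noteq> 0" and t: "0 \<le> t"
  shows "t *\<^sub>R sgn w \<in> pull h \<beta> n x ` cball 0 1 \<longleftrightarrow> t \<le> rad n x w 1"
proof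
  assume "t \<le> rad n x w 1"
  moreover have "continuous_on {0..1} (\<lambda>r. rad n x w r)"
    by (rule continuous_on_subset[OF continuous_on_rad_r]) auto
  ultimately obtain r where r: "0 \<le> r" "r \<le> 1" "rad n x w r = t"
    using IVT'[of "\<lambda>r. rad n x w r" 0 t 1] t by (auto simp: rad_at_0)
  have "t *\<^sub>R sgn w = pull h \<beta> n x (r *\<^sub>R sgn (Bc n x *v w))" using pull_ray[OF x w r(1)] r(3) by simp
  moreover have "r *\<^sub>R sgn (Bc n x *v w) \<in> cball 0 1" using r by (simp add: norm_sgn)
  ultimately show "t *\<^sub>R sgn w \<in> pull h \<beta> n x ` cball 0 1" by blast
next
  assume "t *\<^sub>R sgn w \<in> pull h \<beta> n x ` cball 0 1"
  then obtain v where v: "norm v \<le> 1" "t *\<^sub>R sgn w = pull h \<beta> n x v" by auto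
  show "t \<le> rad n x w 1"
  proof (cases "t = 0 \<or> v = 0")
    case True
    then have "t = 0" using v(2) w by (auto simp: pull_def sgn_zero_iff)
    then show ?thesis using rad_nonneg by simp
  next
    case False
    define w' where "w' = Ac n ((ginv ^^ n) x) *v v"
    have Bw': "Bc n x *v w' = v" using Bc_Ac[OF x] by (simp add: w'_def)
    have w'0: "w' \<noteq> 0" using Bw' False by auto
    have "pull h \<beta> n x v = rad n x w' (norm v) *\<^sub>R sgn w'"
      using pull_ray[OF x w'0, of "norm v" n] False by (simp add: Bw' sgn_div_norm)
    then have eq: "t *\<^sub>R sgn w = rad n x w' (norm v) *\<^sub>R sgn w'" using v(2) by simp
    then have "norm (t *\<^sub>R sgn w) = norm (rad n x w' (norm v) *\<^sub>R sgn w')" by simp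
    then have teq: "t = rad n x w' (norm v)" using t w w'0 rad_nonneg[of "norm v"] by (simp add: norm_sgn)
    then have "sgn w = sgn w'" using eq False by auto
    then have "w' = norm w' *\<^sub>R sgn w" using w'0 by (simp add: sgn_div_norm)
    then have "w' = (norm w' / norm w) *\<^sub>R w" by (simp add: sgn_div_norm divide_inverse)
    then have "rad n x w' (norm v) = rad n x w (norm v)"
      using rad_scale[of "norm w' / norm w" n x w "norm v"] w w'0 by simp
    then show ?thesis using teq rad_mono[of "norm v" 1 n x w] v(1) by simp
  qed
qed

text \<open>The function r_\<beta> extended to nonzero vectors with homogeneity of degree 0. As an
  infimum of continuous functions of \<open>w\<close> it is a priori only upper
  semicontinuous.\<close>

definition R :: "'a \<Rightarrow> real^2 \<Rightarrow> real" where
  "R x w = (INF n. rad n x w 1)"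

lemma bdd_below_rad: "bdd_below (range (\<lambda>n. rad n x w 1))"
  by (rule bdd_belowI[of _ 0]) (auto intro: rad_nonneg)

lemma R_le_rad: "R x w \<le> rad n x w 1"
  unfolding R_def by (intro cINF_lower bdd_below_rad) simp

lemma le_R: "(\<And>n. t \<le> rad n x w 1) \<Longrightarrow> t \<le> R x w"
  unfolding R_def by (intro cINF_greatest) auto

lemma R_nonneg: "0 \<le> R x w"
  by (intro le_R rad_nonneg) simp

lemma R_le_1: "R x w \<le> 1"
  using R_le_rad[of x w 0] by simp

lemma R_scale: "c \<noteq> 0 \<Longrightarrow> R x (c *\<^sub>R w) = R x w"
  by (simp add: R_def rad_scale)

lemma rad_tendsto_R: "x \<in> space M \<Longrightarrow> w \<noteq> 0 \<Longrightarrow> (\<lambda>n. rad n x w 1) \<longlonglongrightarrow> R x w"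
  unfolding R_def by (intro LIMSEQ_decseq_INF bdd_below_rad rad_decseq)

lemma R_invariant:
  assumes "x \<in> space M" "w \<noteq> 0"
  shows "R x w = k (R (ginv x) (Ainv x *v w)) * (norm w / norm (Ainv x *v w))"
proof -
  have "(\<lambda>n. rad (Suc n) x w 1) \<longlonglongrightarrow> k (R (ginv x) (Ainv x *v w)) * (norm w / norm (Ainv x *v w))"
    unfolding rad.simps
    by (intro tendsto_mult tendsto_const tendsto_k rad_tendsto_R R_nonneg rad_nonneg ginv_space Ainv_nonzero assms) simp
  moreover have "(\<lambda>n. rad (Suc n) x w 1) \<longlonglongrightarrow> R x w" by (intro LIMSEQ_Suc rad_tendsto_R assms)
  ultimately show ?thesis using LIMSEQ_unique by blast
qed

lemma R_forward:
  assumes "x \<in> space M" "w \<noteq> 0"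
  shows "R (\<gamma> x) (A x *v w) = k (R x w) * (norm (A x *v w) / norm w)"
  using R_invariant[OF gamma_space, of x "A x *v w"] assms
  by (simp add: ginv_gamma Ainv_A mv_nonzero det_A)

lemma attr_iff:
  assumes x: "x \<in> space M" shows "v \<in> attr x \<longleftrightarrow> v = 0 \<or> norm v \<le> R x v"
proof (cases "v = 0")
  case True
  have "0 \<in> pull h \<beta> n x ` cball 0 1" for n by (intro image_eqI[of _ _ 0]) (auto simp: pull_def)
  then show ?thesis using True by (auto simp: fibre_attractor[OF x])
next
  case False
  have "v = norm v *\<^sub>R sgn v" using False by (simp add: sgn_div_norm)
  then have "v \<in> pull h \<beta> n x ` cball 0 1 \<longleftrightarrow> norm v \<le> rad n x v 1" for n
    using ray_in_pull_iff[OF x False, of "norm v" n] by simp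
  then have "v \<in> attr x \<longleftrightarrow> (\<forall>n. norm v \<le> rad n x v 1)" by (simp add: fibre_attractor[OF x])
  also have "\<dots> \<longleftrightarrow> norm v \<le> R x v" using le_R R_le_rad order_trans by blast
  finally show ?thesis using False by simp
qed

lemma radius_eq_R:
  assumes x: "x \<in> space M" shows "radius M \<gamma> A h \<beta> x \<alpha> = R x (dir \<alpha>)"
  unfolding radius_def
proof (rule Greatest_equality)
  have "r *\<^sub>R dir \<alpha> \<in> attr x \<longleftrightarrow> r \<le> R x (dir \<alpha>)" if "0 \<le> r" for r
    using that R_scale[of r x "dir \<alpha>"] R_nonneg[of x "dir \<alpha>"] by (cases "r = 0") (auto simp: attr_iff[OF x])
  then show "0 \<le> R x (dir \<alpha>) \<and> R x (dir \<alpha>) *\<^sub>R dir \<alpha> \<in> attr x" "\<And>y. 0 \<le> y \<and> y *\<^sub>R dir \<alpha> \<in> attr x \<Longrightarrow> y \<le> R x (dir \<alpha>)"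
    using R_nonneg by auto
qed

text \<open>As long as the radius stays below \<open>e\<close> it grows at least like \<open>q\<^sup>n\<close> times the linear cocycle.\<close>

lemma rad_lower_bound:
  assumes "x \<in> space M" "w \<noteq> 0" "0 < r" "0 < e" "0 < q" "0 \<le> m"
    and slope: "\<forall>t\<in>{0..e}. q * t \<le> k t"
    and rate: "\<And>l. m * norm (Bc l x *v w) \<le> q ^ l * norm w"
  shows "min e r * m \<le> rad n x w r"
  using assms(1,2,6) rate
proof (induction n arbitrary: x w m)
  case 0
  have "m \<le> 1" using "0.prems"(2) "0.prems"(4)[of 0] by simp
  then have "min e r * m \<le> r * 1" using \<open>0 < r\<close> \<open>0 < e\<close> "0.prems" by (intro mult_mono) auto
  then show ?case by simp
next
  case (Suc n)
  define w' where "w' = Ainv x *v w"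
  have w': "w' \<noteq> 0" using Ainv_nonzero Suc.prems by (simp add: w'_def)
  \<comment> \<open>The constant one step earlier: it turns the rate hypothesis at \<open>x\<close>
    with exponent \<open>Suc l\<close> into the one at \<open>ginv x\<close> with exponent
    l.\<close>
  define m' where "m' = m * norm w' / (q * norm w)"
  define t where "t = rad n (ginv x) w' r"
  have t0: "0 \<le> t" using rad_nonneg \<open>0 < r\<close> by (simp add: t_def)
  have pos: "0 < norm w" "0 < norm w'" using w' Suc.prems by auto
  have "min e r * m' \<le> t"
    unfolding t_def
  proof (rule Suc.IH[OF ginv_space w'])
    show "0 \<le> m'" using Suc.prems \<open>0 < q\<close> by (simp add: m'_def)
    fix l
    have "m * norm (Bc l (ginv x) *v w') \<le> q ^ Suc l * norm w"
      using Suc.prems(4)[of "Suc l"] Suc.prems(1) by (simp add: Bc_Suc w'_def del: cocycle.simps)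
    then have "m * norm (Bc l (ginv x) *v w') * norm w' \<le> (q ^ Suc l * norm w) * norm w'"
      by (intro mult_right_mono) auto
    then show "m' * norm (Bc l (ginv x) *v w') \<le> q ^ l * norm w'"
      using pos \<open>0 < q\<close> by (simp add: m'_def field_simps)
  qed (use Suc.prems in auto)
  have "min e r * m * norm w' \<le> k t * norm w"
  proof (cases "t \<le> e")
    case True
    have "min e r * m * norm w' = q * (min e r * m') * norm w"
      using pos \<open>0 < q\<close> by (simp add: m'_def)
    also have "\<dots> \<le> q * t * norm w"
      using \<open>min e r * m' \<le> t\<close> \<open>0 < q\<close> by (intro mult_right_mono mult_left_mono) auto
    also have "\<dots> \<le> k t * norm w" using slope True t0 by (intro mult_right_mono) auto
    finally show ?thesis .
  next
    case False
    have "m * norm w' \<le> q * norm w" using Suc.prems(4)[of 1] by (simp add: w'_def)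
    then have "min e r * (m * norm w') \<le> e * (q * norm w)"
      using \<open>0 < r\<close> \<open>0 < e\<close> Suc.prems(3) by (intro mult_mono[of "min e r" e "m * norm w'"]) auto
    also have "\<dots> = (q * e) * norm w" by simp
    also have "\<dots> \<le> k e * norm w" using slope \<open>0 < e\<close> by (intro mult_right_mono) auto
    also have "\<dots> \<le> k t * norm w" using False \<open>0 < e\<close> by (intro mult_right_mono k_mono) auto
    finally show ?thesis by (simp add: mult.assoc)
  qed
  then show ?case using pos by (simp add: w'_def[symmetric] t_def[symmetric] field_simps)
qed

text \<open>Once k t is replaced by \<beta> t, the quotients of norms telescope against
  \<open>Bc n x *v w\<close>.\<close>

lemma rad_upper_bound:
  assumes "x \<in> space M" "w \<noteq> 0" "0 \<le> r"
  shows "rad n x w r * norm (Bc n x *v w) \<le> \<beta> ^ n * r * norm w"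
  using assms
proof (induction n arbitrary: x w)
  case (Suc n)
  define w' where "w' = Ainv x *v w"
  have w': "w' \<noteq> 0" using Ainv_nonzero Suc.prems by (simp add: w'_def)
  define t where "t = rad n (ginv x) w' r"
  have t0: "0 \<le> t" using rad_nonneg Suc.prems by (simp add: t_def)
  have "rad (Suc n) x w r * norm (Bc (Suc n) x *v w) = k t * (norm w / norm w') * norm (Bc n (ginv x) *v w')"
    using Suc.prems by (simp add: Bc_Suc w'_def t_def del: cocycle.simps)
  also have "\<dots> \<le> (\<beta> * t) * (norm w / norm w') * norm (Bc n (ginv x) *v w')"
    by (intro mult_right_mono k_le t0) auto
  also have "\<dots> = \<beta> * (norm w / norm w') * (t * norm (Bc n (ginv x) *v w'))" by (simp add: mult_ac)
  also have "\<dots> \<le> \<beta> * (norm w / norm w') * (\<beta> ^ n * r * norm w')"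
    unfolding t_def using \<beta>_pos by (intro mult_left_mono Suc.IH ginv_space w' Suc.prems) auto
  also have "\<dots> = \<beta> ^ Suc n * r * norm w" using w' by simp
  finally show ?case .
qed simp

end

section \<open>The supercritical regime\<close>

lemma infinite_card_Icc:
  assumes "infinite (G :: nat set)" obtains n where "N \<le> card {i \<in> {1..n}. i \<in> G}"
proof -
  have "infinite (G - {0})" using assms by simp
  then obtain B where B: "finite B" "card B = N" "B \<subseteq> G - {0}"
    using infinite_arbitrarily_large by blast
  have "B \<subseteq> {i \<in> {1..Max (insert 0 B)}. i \<in> G}"
    using B by (auto simp: Suc_le_eq)
  then have "card B \<le> card {i \<in> {1..Max (insert 0 B)}. i \<in> G}" by (intro card_mono) auto
  then show thesis using that B(2) by blast
qed

lemma infdist_closure: "infdist x (closure S) = infdist x S"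
proof (cases "S = {}")
  case False
  have "infdist x S \<le> dist x a" if "a \<in> closure S" for a
    using infdist_triangle[of x S a] in_closure_iff_infdist_zero[OF False, of a] that by simp
  then have "infdist x S \<le> infdist x (closure S)"
    using False by (subst (2) infdist_notempty) (auto intro!: cINF_greatest)
  moreover have "infdist x (closure S) \<le> infdist x S" by (rule infdist_mono[OF closure_subset False])
  ultimately show ?thesis by simp
qed simp

context skew_system
begin

lemma Bc_step: "Ainv ((ginv ^^ i) x) *v (Bc i x *v w) = Bc (Suc i) x *v w"
  by (simp add: matrix_vector_mul_assoc)

lemma rad_ge_of_opnorm:
  assumes x: "x \<in> space M" and w: "w \<noteq> 0" and "0 < r" "0 < e" "0 < q"
    and slope: "\<forall>t\<in>{0..e}. q * t \<le> k t"
    and D: "\<And>l. norm (Bc l x *v w) \<le> D * q ^ l * norm w"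
  shows "0 < D" "min e r / D \<le> rad n x w r"
proof -
  have "norm w \<le> D * norm w" using D[of 0] by simp
  then have "1 * norm w \<le> D * norm w" by simp
  then show D0: "0 < D" using w by (simp only: mult_le_cancel_right) auto
  have "min e r * (1 / D) \<le> rad n x w r"
  proof (rule rad_lower_bound[OF x w \<open>0 < r\<close> \<open>0 < e\<close> \<open>0 < q\<close> _ slope])
    show "1 / D * norm (Bc l x *v w) \<le> q ^ l * norm w" for l
      using D[of l] D0 by (simp add: field_simps)
  qed (use D0 in simp)
  then show "min e r / D \<le> rad n x w r" by simp
qed

text \<open>A rate q between exp \<Lambda> and \<beta> is fixed. A bound of
  \<open>opnorm (Bc l y)\<close> by a multiple of q^l controls all directions at once; at
  \<open>x\<close> itself the multiple is pointwise, at the recurring past times it is a common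
  constant.\<close>

lemma supercritical_lower_bounds:
  assumes x: "x \<in> space M" "good x" and \<beta>: "exp \<Lambda> < \<beta>" and r: "0 < r"
  shows "\<exists>m>0. \<forall>n w. w \<noteq> 0 \<longrightarrow> m \<le> rad n x w r"
    and "\<exists>c>0. infinite {i. \<forall>n w. w \<noteq> 0 \<longrightarrow> c \<le> rad n ((ginv ^^ i) x) w r}"
proof -
  obtain q where q: "exp \<Lambda> < q" "q < \<beta>" using dense \<beta> by blast
  have q0: "0 < q" using q(1) exp_gt_zero[of \<Lambda>] by linarith
  obtain e where e: "0 < e" "\<forall>t\<in>{0..e}. q * t \<le> k t" using k_slope[OF q(2)] by blast
  have main: "min e r / D \<le> rad n y w r \<and> 0 < D" if y: "y \<in> space M" "w \<noteq> 0" and D: "\<And>l. opnorm (Bc l y) \<le> D * q ^ l" for D y n w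
  proof -
    have "norm (Bc l y *v w) \<le> D * q ^ l * norm w" for l
      using norm_mv_le[of "Bc l y" w] mult_right_mono[OF D[of l], of "norm w"] by simp
    then show ?thesis using rad_ge_of_opnorm[OF y r e(1) q0 e(2)] by blast
  qed
  have "exp \<Lambda> < exp (ln q)" using q q0 by simp
  then have d: "0 < ln q - \<Lambda>" unfolding exp_less_cancel_iff by simp
  have pos: "0 < opnorm (Bc n x)" for n using bk.opnorm_cocycle_ge_1[OF x(1), of n] by linarith
  have "(\<lambda>n. ln (opnorm (Bc n x)) / n) \<longlonglongrightarrow> \<Lambda>" using x(2) by (simp add: good_def)
  from exp_rate_bounds[OF this pos d]
  have ev: "\<forall>\<^sub>F n in sequentially. opnorm (Bc n x) \<le> q ^ n"
    by eventually_elim (use q0 in \<open>simp add: exp_of_nat_mult\<close>)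
  have "0 < q ^ n" for n using q0 by simp
  from eventually_le_imp_const_bound[OF ev this]
  obtain j where j: "\<And>n. opnorm (Bc n x) \<le> real (Suc j) * q ^ n" by blast
  show "\<exists>m>0. \<forall>n w. w \<noteq> 0 \<longrightarrow> m \<le> rad n x w r"
    using main[OF x(1) _ j] e r by (intro exI[of _ "min e r / real (Suc j)"]) auto
  obtain D where D: "infinite {i. \<forall>l. opnorm (Bc l ((ginv ^^ i) x)) \<le> D * q ^ l}"
    using x(2) q(1) unfolding good_def by blast
  then obtain i0 where i0: "\<And>l. opnorm (Bc l ((ginv ^^ i0) x)) \<le> D * q ^ l"
    using infinite_imp_nonempty by blast
  have D0: "0 < D" using main[OF bk.T_space[OF x(1)] dir_nonzero i0] by blast
  have "{i. \<forall>l. opnorm (Bc l ((ginv ^^ i) x)) \<le> D * q ^ l} \<subseteq>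
      {i. \<forall>n w. w \<noteq> 0 \<longrightarrow> min e r / D \<le> rad n ((ginv ^^ i) x) w r}"
    using main[OF bk.T_space[OF x(1)]] by blast
  then have "infinite {i. \<forall>n w. w \<noteq> 0 \<longrightarrow> min e r / D \<le> rad n ((ginv ^^ i) x) w r}"
    using D infinite_super by blast
  moreover have "0 < min e r / D" using D0 e r by simp
  ultimately show "\<exists>c>0. infinite {i. \<forall>n w. w \<noteq> 0 \<longrightarrow> c \<le> rad n ((ginv ^^ i) x) w r}" by blast
qed

lemma R_orbit:
  assumes "x \<in> space M" "w \<noteq> 0"
  shows "R ((ginv ^^ i) x) (Bc i x *v w) =
    k (R ((ginv ^^ Suc i) x) (Bc (Suc i) x *v w)) * (norm (Bc i x *v w) / norm (Bc (Suc i) x *v w))"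
  using R_invariant[OF bk.T_space[OF assms(1)] Bc_nonzero[OF assms], of i i] unfolding Bc_step by (simp only: funpow.simps o_apply)

lemma R_orbit_pos:
  assumes "x \<in> space M" "w \<noteq> 0" "0 < R x w"
  shows "0 < R ((ginv ^^ i) x) (Bc i x *v w)"
proof (induction i)
  case (Suc i)
  then have "R ((ginv ^^ Suc i) x) (Bc (Suc i) x *v w) \<noteq> 0"
    using R_orbit[OF assms(1,2), of i] k_0 by (metis less_irrefl mult_zero_left)
  then show ?case using R_nonneg by (metis order_le_less)
qed (use assms in simp)

text \<open>The orbit started at radius 1 and the orbit of \<open>R\<close> pass over the same
  directions, so \<open>pullback_contraction\<close> applies. The visit times belong to the base
  point alone, hence one n serves all \<open>w\<close>.\<close>

lemma rad_uniformly_close_to_R: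
  assumes x: "x \<in> space M" "good x" and \<beta>: "exp \<Lambda> < \<beta>" and d: "0 < d"
  obtains n where "\<And>w. w \<noteq> 0 \<Longrightarrow> rad n x w 1 < exp d * R x w"
proof -
  obtain c where c: "0 < c" "infinite {i. \<forall>n w. w \<noteq> 0 \<longrightarrow> c \<le> rad n ((ginv ^^ i) x) w 1}"
    using supercritical_lower_bounds(2)[OF x \<beta>, of 1] by auto
  obtain m where m: "0 < m" "\<And>n w. w \<noteq> 0 \<Longrightarrow> m \<le> rad n x w 1"
    using supercritical_lower_bounds(1)[OF x \<beta>, of 1] by auto
  define G where "G = {i. \<forall>w. w \<noteq> 0 \<longrightarrow> c \<le> R ((ginv ^^ i) x) w}"
  have "{i. \<forall>n w. w \<noteq> 0 \<longrightarrow> c \<le> rad n ((ginv ^^ i) x) w 1} \<subseteq> G"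
    unfolding G_def by (auto intro: le_R)
  then have G: "infinite G" using c(2) infinite_super by blast
  obtain N where N: "\<And>n u y a.
    (\<And>i. i < n \<Longrightarrow> 0 < a i \<and> u i = k (u (Suc i)) * a i \<and> y i = k (y (Suc i)) * a i) \<Longrightarrow>
    (\<And>i. i \<le> n \<Longrightarrow> 0 < u i \<and> u i \<le> y i \<and> y i \<le> 1) \<Longrightarrow>
    N \<le> card {i \<in> {1..n}. c \<le> u i} \<Longrightarrow> y 0 < exp d * u 0"
    using pullback_contraction[OF c(1) d] by blast
  obtain n where n: "N \<le> card {i \<in> {1..n}. i \<in> G}" using infinite_card_Icc[OF G] by blast
  show thesis
  proof (rule that[of n])
    fix w :: "real^2" assume w: "w \<noteq> 0"
    define u where "u i = R ((ginv ^^ i) x) (Bc i x *v w)" for i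
    \<comment> \<open>Index i counts steps into the past: there the orbit started at time -n has
      made n - i steps.\<close>
    define y where "y i = rad (n - i) ((ginv ^^ i) x) (Bc i x *v w) 1" for i
    define a where "a i = norm (Bc i x *v w) / norm (Bc (Suc i) x *v w)" for i
    have nz: "Bc i x *v w \<noteq> 0" for i by (intro Bc_nonzero x w)
    have "y 0 < exp d * u 0"
    proof (rule N[of n a])
      fix i assume i: "i < n"
      have "n - i = Suc (n - Suc i)" using i by simp
      then have "y i = k (y (Suc i)) * a i"
        unfolding y_def a_def by (simp only: rad.simps Bc_step funpow.simps o_apply)
      moreover have "0 < a i" using nz[of i] nz[of "Suc i"] unfolding a_def by (simp del: cocycle.simps)
      ultimately show "0 < a i \<and> u i = k (u (Suc i)) * a i \<and> y i = k (y (Suc i)) * a i"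
        using R_orbit[OF x(1) w, of i] by (simp add: u_def a_def del: cocycle.simps)
    next
      fix i assume "i \<le> n"
      have "0 < R x w" using m(1) le_R[of m x w] m(2)[OF w] by fastforce
      then show "0 < u i \<and> u i \<le> y i \<and> y i \<le> 1"
        using R_orbit_pos[OF x(1) w] R_le_rad rad_le_1[OF bk.T_space[OF x(1)] nz, of 1]
        by (simp add: u_def y_def)
    next
      have "{i \<in> {1..n}. i \<in> G} \<subseteq> {i \<in> {1..n}. c \<le> u i}" using nz by (auto simp: G_def u_def)
      then have "card {i \<in> {1..n}. i \<in> G} \<le> card {i \<in> {1..n}. c \<le> u i}" by (intro card_mono) auto
      then show "N \<le> card {i \<in> {1..n}. c \<le> u i}" using n by simp
    qed
    then show "rad n x w 1 < exp d * R x w" by (simp add: y_def u_def)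
  qed
qed

text \<open>Multiplicative closeness becomes additive because \<open>R\<close> is at most 1, and it
  extends to all later n by monotonicity. The convergence of the continuous functions
  \<open>rad n x w 1\<close> is therefore uniform in \<open>w\<close>.\<close>

lemma R_continuous:
  assumes x: "x \<in> space M" "good x" and \<beta>: "exp \<Lambda> < \<beta>"
  shows "continuous_on (-{0}) (R x)"
proof (rule uniform_limit_theorem)
  show "\<forall>\<^sub>F n in sequentially. continuous_on (-{0}) (\<lambda>w. rad n x w 1)"
    by (intro always_eventually allI continuous_on_rad_w x) simp
  show "uniform_limit (-{0}) (\<lambda>n w. rad n x w 1) (R x) sequentially"
  proof (rule uniform_limitI)
    fix e :: real assume e: "0 < e"
    define d where "d = ln (1 + e)"
    have d: "0 < d" "exp d = 1 + e" using e by (auto simp: d_def)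
    obtain n0 where n0: "\<And>w. w \<noteq> 0 \<Longrightarrow> rad n0 x w 1 < exp d * R x w"
      using rad_uniformly_close_to_R[OF x \<beta> d(1)] by blast
    show "\<forall>\<^sub>F n in sequentially. \<forall>w\<in>-{0}. dist (rad n x w 1) (R x w) < e"
    proof (rule eventually_sequentiallyI[of n0], rule ballI)
      fix n w assume n: "n0 \<le> n" and "w \<in> - {0::real^2}"
      then have w: "w \<noteq> 0" by simp
      have "rad n x w 1 \<le> rad n0 x w 1" using rad_decseq[OF x(1) w] n by (simp add: decseq_def)
      also have "\<dots> < R x w + e * R x w" using n0[OF w] d by (simp add: algebra_simps)
      also have "e * R x w \<le> e" using R_le_1[of x w] e by (simp add: mult_left_le)
      finally show "dist (rad n x w 1) (R x w) < e"
        using R_le_rad[of x w n] by (simp add: dist_real_def)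
    qed
  qed
qed simp

text \<open>Continuity of \<open>R\<close> makes the sign of \<open>R x v - norm v\<close> decide
  between interior and exterior away from 0; the origin is interior thanks to the positive lower
  bound \<open>m\<close> of \<open>R\<close>.\<close>

lemma frontier_attr:
  assumes x: "x \<in> space M" "good x" and \<beta>: "exp \<Lambda> < \<beta>"
  shows "frontier (attr x) = {v. v \<noteq> 0 \<and> norm v = R x v}"
proof -
  obtain m where m: "0 < m" "\<And>n w. w \<noteq> 0 \<Longrightarrow> m \<le> rad n x w 1"
    using supercritical_lower_bounds(1)[OF x \<beta>, of 1] by auto
  have mR: "m \<le> R x w" if "w \<noteq> 0" for w using m(2) that by (intro le_R)
  have cont: "continuous_on (-{0}) (\<lambda>v. R x v - norm v)"
    by (intro continuous_on_diff R_continuous[OF x \<beta>] continuous_intros)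
  have open_pos: "open {v \<in> -{0}. R x v - norm v \<in> {0<..}}"
    by (rule continuous_open_preimage[OF cont, unfolded vimage_def Int_def mem_Collect_eq]) auto
  have open_neg: "open {v \<in> -{0}. R x v - norm v \<in> {..<0}}"
    by (rule continuous_open_preimage[OF cont, unfolded vimage_def Int_def mem_Collect_eq]) auto
  have "- attr x = {v \<in> -{0}. R x v - norm v \<in> {..<0}}"
    by (auto simp: attr_iff[OF x(1)] not_le)
  then have closed: "closed (attr x)" using open_neg by (simp add: closed_def)
  have "interior (attr x) = ball 0 m \<union> {v \<in> -{0}. R x v - norm v \<in> {0<..}}"
  proof (rule interior_unique)
    show "ball 0 m \<union> {v \<in> -{0}. R x v - norm v \<in> {0<..}} \<subseteq> attr x"
      using mR by (fastforce simp: attr_iff[OF x(1)])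
    show "open (ball 0 m \<union> {v \<in> -{0}. R x v - norm v \<in> {0<..}})" using open_pos by blast
    fix U assume U: "U \<subseteq> attr x" "open U"
    show "U \<subseteq> ball 0 m \<union> {v \<in> -{0}. R x v - norm v \<in> {0<..}}"
    proof
      fix v assume v: "v \<in> U"
      show "v \<in> ball 0 m \<union> {v \<in> -{0}. R x v - norm v \<in> {0<..}}"
      proof (cases "v = 0")
        case False
        obtain e where e: "0 < e" "ball v e \<subseteq> U" using U(2) v openE by blast
        \<comment> \<open>Pushing the point outward inside an open subset of the attractor fibre
          leaves \<open>R\<close> unchanged, so its norm was strictly smaller than
          \<open>R\<close>.\<close>
        define s where "s = 1 + e / (2 * norm v)"
        have s: "1 < s" using e False by (simp add: s_def)
        have "dist v (s *\<^sub>R v) = norm ((s - 1) *\<^sub>R v)"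
          by (simp add: dist_norm norm_minus_commute algebra_simps)
        also have "\<dots> = e / 2" using e False by (simp add: s_def)
        finally have "s *\<^sub>R v \<in> U" using e by (intro subsetD[OF e(2)]) simp
        then have "norm (s *\<^sub>R v) \<le> R x (s *\<^sub>R v)"
          using U(1) False s by (auto simp: attr_iff[OF x(1)] dest!: subsetD)
        then have "s * norm v \<le> R x v" using s by (simp add: R_scale)
        moreover have "1 * norm v < s * norm v" using s False by (intro mult_strict_right_mono) auto
        ultimately have "norm v < R x v" by linarith
        then show ?thesis using False by simp
      qed (use m in simp)
    qed
  qed
  then have "frontier (attr x) = attr x - (ball 0 m \<union> {v \<in> -{0}. R x v - norm v \<in> {0<..}})"
    using closed by (simp add: frontier_def)
  also have "\<dots> = {v. v \<noteq> 0 \<and> norm v = R x v}"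
    using m(1) mR by (fastforce simp: attr_iff[OF x(1)])
  finally show ?thesis .
qed

lemma sphere_param:
  "{v. v \<noteq> 0 \<and> norm v = R x v} = {R x (dir \<alpha>) *\<^sub>R dir \<alpha> | \<alpha>. \<alpha> \<in> {0..<1}}"
  if pos: "\<And>\<alpha>. 0 < R x (dir \<alpha>)"
proof (intro equalityI subsetI)
  fix v assume "v \<in> {v. v \<noteq> 0 \<and> norm v = R x v}"
  then have v: "v \<noteq> 0" "norm v = R x v" by auto
  have "norm (sgn v) = 1" using v by (simp add: norm_sgn)
  then obtain \<alpha> where \<alpha>: "\<alpha> \<in> {0..<1}" "sgn v = dir \<alpha>" using exists_dir by blast
  have vd: "v = norm v *\<^sub>R dir \<alpha>" using v(1) by (simp add: \<alpha>(2)[symmetric] sgn_div_norm)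
  then have "R x v = R x (norm v *\<^sub>R dir \<alpha>)" by (rule arg_cong)
  also have "\<dots> = R x (dir \<alpha>)" using v(1) by (intro R_scale) simp
  finally have "v = R x (dir \<alpha>) *\<^sub>R dir \<alpha>" using vd unfolding v(2) by metis
  then show "v \<in> {R x (dir \<alpha>) *\<^sub>R dir \<alpha> | \<alpha>. \<alpha> \<in> {0..<1}}" using \<alpha>(1) by blast
next
  fix v assume "v \<in> {R x (dir \<alpha>) *\<^sub>R dir \<alpha> | \<alpha>. \<alpha> \<in> {0..<1}}"
  then obtain \<alpha> where "v = R x (dir \<alpha>) *\<^sub>R dir \<alpha>" by blast
  then show "v \<in> {v. v \<noteq> 0 \<and> norm v = R x v}" using pos[of \<alpha>] by (simp add: R_scale)
qed

lemma radius_continuous: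
  assumes x: "x \<in> space M" "good x" and \<beta>: "exp \<Lambda> < \<beta>"
  shows "continuous_on UNIV (\<lambda>\<alpha>. R x (dir \<alpha>))"
proof (rule continuous_on_compose2[OF R_continuous[OF x \<beta>]])
  have eq: "dir = (\<lambda>\<alpha>. cos (2*pi*\<alpha>) *\<^sub>R axis 1 1 + sin (2*pi*\<alpha>) *\<^sub>R axis 2 1)"
    by (simp add: fun_eq_iff vec2_eq_iff axis_def)
  show "continuous_on UNIV dir" unfolding eq by (intro continuous_intros)
qed auto

section \<open>Continuity and measurability of fibre maps, and the absorbing set\<close>

lemma fibre_map_bound: "norm (fibre_map A h \<beta> x v) \<le> \<beta> * opnorm (A x) * norm v"
proof (cases "v = 0")
  case False
  have "norm (fibre_map A h \<beta> x v) = k (norm v) * norm (A x *v (v /\<^sub>R norm v))"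
    using False k_nonneg[of "norm v"] by (simp add: fibre_map_def)
  also have "\<dots> \<le> (\<beta> * norm v) * (opnorm (A x) * norm (v /\<^sub>R norm v))"
    by (intro mult_mono k_le norm_mv_le) (use \<beta>_pos in auto)
  finally show ?thesis using False by (simp add: mult_ac)
qed simp

lemma continuous_fibre_map: "continuous_on UNIV (fibre_map A h \<beta> x)"
proof -
  have "isCont (fibre_map A h \<beta> x) v" for v
  proof (cases "v = 0")
    case True
    have "((\<lambda>u. norm (u::real^2)) \<longlongrightarrow> 0) (at 0)"
      by (rule tendsto_norm_zero) (rule tendsto_ident_at)
    then have "((\<lambda>u::real^2. \<beta> * opnorm (A x) * norm u) \<longlongrightarrow> 0) (at 0)"
      by (rule tendsto_mult_right_zero)
    then have "((\<lambda>u. fibre_map A h \<beta> x u) \<longlongrightarrow> 0) (at 0)"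
      by (rule Lim_null_comparison[rotated]) (rule always_eventually, rule allI, rule fibre_map_bound)
    then show ?thesis using True by (simp add: isCont_def)
  next
    case False
    have kn: "continuous_on (-{0}) (\<lambda>u::real^2. k (norm u))"
      by (rule continuous_on_compose2[OF k_continuous continuous_on_norm_id]) auto
    have "continuous_on (-{0}) (\<lambda>u. k (norm u) *\<^sub>R (A x *v (u /\<^sub>R norm u)))"
      by (intro continuous_on_scaleR kn continuous_on_compose2[OF continuous_on_mv[of UNIV "A x"]]
          continuous_on_inverse continuous_on_norm_id continuous_on_id) auto
    then have "continuous_on (-{0}) (fibre_map A h \<beta> x)"
      by (rule continuous_on_eq) (simp add: fibre_map_def)
    moreover have "open (-{0::real^2})" by (rule open_Compl) simp
    ultimately show ?thesis using False continuous_on_eq_continuous_at by blast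
  qed
  then show ?thesis by (simp add: continuous_at_imp_continuous_on)
qed

lemma pull_norm:
  assumes x: "x \<in> space M" and v: "v \<noteq> 0"
  obtains w where "w \<noteq> 0" "pull h \<beta> n x v = rad n x w (norm v) *\<^sub>R sgn w" "Bc n x *v w = v"
proof (rule that[of "Ac n ((ginv ^^ n) x) *v v"])
  show 1: "Bc n x *v (Ac n ((ginv ^^ n) x) *v v) = v" using Bc_Ac[OF x] .
  show 2: "Ac n ((ginv ^^ n) x) *v v \<noteq> 0" by (intro Ac_nonzero bk.T_space x v)
  show "pull h \<beta> n x v = rad n x (Ac n ((ginv ^^ n) x) *v v) (norm v) *\<^sub>R sgn (Ac n ((ginv ^^ n) x) *v v)"
    using pull_ray[OF x 2, of "norm v" n] v by (simp add: 1 sgn_div_norm)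
qed

lemma pull_cball: "x \<in> space M \<Longrightarrow> norm v \<le> 1 \<Longrightarrow> norm (pull h \<beta> n x v) \<le> 1"
proof (cases "v = 0")
  case False
  assume x: "x \<in> space M" and v: "norm v \<le> 1"
  obtain w where w: "w \<noteq> 0" "pull h \<beta> n x v = rad n x w (norm v) *\<^sub>R sgn w"
    using pull_norm[OF x False] by metis
  then show ?thesis using rad_le_1[OF x w(1) _ v] rad_nonneg[of "norm v"] by (simp add: norm_sgn)
qed (simp add: pull_def)

lemma continuous_pull: "x \<in> space M \<Longrightarrow> continuous_on UNIV (pull h \<beta> n x)"
proof (induction n arbitrary: x)
  case (Suc n)
  have "continuous_on UNIV (\<lambda>v. fibre_map A h \<beta> (ginv x) (pull h \<beta> n (ginv x) v))"
    by (rule continuous_on_compose2[OF continuous_fibre_map Suc.IH[OF ginv_space[OF Suc.prems]]]) simp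
  then show ?case using Suc.prems by (simp add: pull_Suc)
qed (simp add: continuous_on_id)

lemma measurable_fibre_map:
  assumes [measurable]: "T \<in> measurable M M" "g \<in> borel_measurable M"
  shows "(\<lambda>x. fibre_map A h \<beta> (T x) (g x)) \<in> borel_measurable M"
proof -
  have "continuous_on UNIV (\<lambda>t. k (max 0 t))"
    by (rule continuous_on_compose2[OF k_continuous]) (auto intro!: continuous_intros)
  then have [measurable]: "(\<lambda>t. k (max 0 t)) \<in> borel_measurable borel"
    by (rule borel_measurable_continuous_onI)
  have "(\<lambda>x. if g x = 0 then 0 else k (max 0 (norm (g x))) *\<^sub>R (A (T x) *v (g x /\<^sub>R norm (g x)))) \<in> borel_measurable M"
    by measurable
  moreover have "max 0 (norm (g x)) = norm (g x)" for x by simp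
  ultimately show ?thesis unfolding fibre_map_def by (simp only:)
qed

lemma measurable_pull: "(\<lambda>x. pull h \<beta> n x v) \<in> borel_measurable M"
proof -
  have "(\<lambda>x. fit n x v) \<in> borel_measurable M"
    by (induction n) (simp_all add: measurable_fibre_map)
  then have "(\<lambda>x. fit n ((ginv ^^ n) x) v) \<in> borel_measurable M" by measurable
  then show ?thesis by (simp add: pull_def)
qed

definition annulus :: "real \<Rightarrow> (real^2) set" where "annulus r = cball 0 1 - ball 0 r"

text \<open>Forward invariance forces all images of the annulus to be included; how close they come
  to the origin is controlled by \<open>absorb_norm_ge\<close>. The closure makes the fibres
  compact.\<close>

definition absorb :: "real \<Rightarrow> 'a \<Rightarrow> (real^2) set" where
  "absorb r x = closure (\<Union>n. pull h \<beta> n x ` annulus r)"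

definition Kset :: "real \<Rightarrow> ('a \<times> (real^2)) set" where
  "Kset r = Sigma (space M) (absorb r)"

lemma fibre_Kset: "fibre (Kset r) x = (if x \<in> space M then absorb r x else {})"
  by (auto simp: fibre_def Kset_def)

lemma absorb_subset_cball:
  assumes x: "x \<in> space M" shows "absorb r x \<subseteq> cball 0 1"
  unfolding absorb_def by (rule closure_minimal) (auto simp: annulus_def pull_cball[OF x])

lemma random_compact_Kset:
  assumes r: "r \<le> 1" shows "random_compact_set M (Kset r)"
  unfolding random_compact_set_def
proof (intro conjI allI)
  show "Kset r \<subseteq> space M \<times> UNIV" by (auto simp: Kset_def)
  show "AE x in M. compact (fibre (Kset r) x)"
  proof (rule AE_I2)
    fix x assume x: "x \<in> space M"
    have "bounded (absorb r x)" using absorb_subset_cball[OF x] bounded_cball bounded_subset by blast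
    then show "compact (fibre (Kset r) x)"
      using x by (simp add: fibre_Kset absorb_def compact_eq_bounded_closed)
  qed
  fix y :: "real^2"
  \<comment> \<open>A countable dense part of the annulus turns the distance into a countable
    infimum of measurable functions; continuity of \<open>pull\<close> leaves the closure
    unchanged.\<close>
  obtain D :: "(real^2) set" where D: "countable D" "D \<subseteq> annulus r" "annulus r \<subseteq> closure D"
    using separable by metis
  have "dir 0 \<in> annulus r" using r by (simp add: annulus_def)
  then have "D \<noteq> {}" using D(3) by auto
  have eq: "infdist y (fibre (Kset r) x) = (INF p\<in>UNIV \<times> D. dist y (pull h \<beta> (fst p) x (snd p)))"
    if x: "x \<in> space M" for x
  proof -
    define S0 where "S0 = (\<Union>n. pull h \<beta> n x ` D)"
    have "(\<Union>n. pull h \<beta> n x ` annulus r) \<subseteq> closure S0"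
    proof (rule UN_least)
      fix n
      have "pull h \<beta> n x ` closure D \<subseteq> closure (pull h \<beta> n x ` D)"
        by (rule image_closure_subset[OF continuous_on_subset[OF continuous_pull[OF x] subset_UNIV] closed_closure closure_subset])
      also have "\<dots> \<subseteq> closure S0" unfolding S0_def by (intro closure_mono) auto
      finally show "pull h \<beta> n x ` annulus r \<subseteq> closure S0" using D(3) by blast
    qed
    then have "absorb r x = closure S0"
      unfolding absorb_def
    proof (intro equalityI)
      show "closure S0 \<subseteq> closure (\<Union>n. pull h \<beta> n x ` annulus r)"
        using D(2) unfolding S0_def by (intro closure_mono) blast
    qed (rule closure_minimal[OF _ closed_closure])
    then have "infdist y (fibre (Kset r) x) = infdist y S0"
      using x by (simp add: fibre_Kset infdist_closure)
    moreover have S0: "S0 = (\<lambda>p. pull h \<beta> (fst p) x (snd p)) ` (UNIV \<times> D)" by (force simp: S0_def image_iff)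
    moreover have "S0 \<noteq> {}" using \<open>D \<noteq> {}\<close> by (auto simp: S0_def)
    ultimately show ?thesis by (simp add: infdist_notempty image_image)
  qed
  have "(\<lambda>x. INF p\<in>UNIV \<times> D. dist y (pull h \<beta> (fst p) x (snd p))) \<in> borel_measurable M"
  proof (rule borel_measurable_cINF)
    show "countable ((UNIV :: nat set) \<times> D)" using D(1) by simp
    show "(\<lambda>x. dist y (pull h \<beta> (fst p) x (snd p))) \<in> borel_measurable M" for p
      using measurable_pull by measurable
    show "bdd_below ((\<lambda>p. dist y (pull h \<beta> (fst p) x (snd p))) ` (UNIV \<times> D))" for x
      by (rule bdd_belowI[of _ 0]) auto
  qed
  then show "(\<lambda>x. infdist y (fibre (Kset r) x)) \<in> borel_measurable M"
    by (subst measurable_cong[OF eq]) auto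
qed

lemma forward_invariant_Kset: "forward_invariant M \<gamma> A h \<beta> (Kset r)"
  unfolding forward_invariant_def
proof (rule AE_I2)
  fix x assume x: "x \<in> space M"
  have "fibre_map A h \<beta> x ` absorb r x \<subseteq> closure (fibre_map A h \<beta> x ` (\<Union>n. pull h \<beta> n x ` annulus r))"
    unfolding absorb_def
    by (rule image_closure_subset[OF continuous_on_subset[OF continuous_fibre_map subset_UNIV] closed_closure closure_subset])
  also have "\<dots> \<subseteq> absorb r (\<gamma> x)"
    unfolding absorb_def
  proof (rule closure_mono, rule image_subsetI)
    fix v assume "v \<in> (\<Union>n. pull h \<beta> n x ` annulus r)"
    then obtain n u where "u \<in> annulus r" "v = pull h \<beta> n x u" by blast
    then have "fibre_map A h \<beta> x v = pull h \<beta> (Suc n) (\<gamma> x) u" "u \<in> annulus r"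
      using pull_Suc[OF gamma_space[OF x]] by (simp_all add: ginv_gamma[OF x])
    then show "fibre_map A h \<beta> x v \<in> (\<Union>n. pull h \<beta> n (\<gamma> x) ` annulus r)" by blast
  qed
  finally show "fibre_map A h \<beta> x ` fibre (Kset r) x \<subseteq> fibre (Kset r) (\<gamma> x)"
    using x gamma_space[OF x] by (simp add: fibre_Kset)
qed

lemma absorb_norm_ge:
  assumes x: "x \<in> space M" and r: "0 < r" and c: "\<And>n w. w \<noteq> 0 \<Longrightarrow> c \<le> rad n x w r" and v: "v \<in> absorb r x"
  shows "c \<le> norm v"
proof -
  have "absorb r x \<subseteq> {v. c \<le> norm v}"
    unfolding absorb_def
  proof (rule closure_minimal)
    show "closed {v::real^2. c \<le> norm v}" by (intro closed_Collect_le continuous_intros)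
    show "(\<Union>n. pull h \<beta> n x ` annulus r) \<subseteq> {v. c \<le> norm v}"
    proof clarify
      fix n u assume u: "u \<in> annulus r"
      then have u0: "u \<noteq> 0" "r \<le> norm u" using r by (auto simp: annulus_def)
      obtain w where w: "w \<noteq> 0" "pull h \<beta> n x u = rad n x w (norm u) *\<^sub>R sgn w"
        using pull_norm[OF x u0(1)] by metis
      have "c \<le> rad n x w r" using c w(1) .
      also have "\<dots> \<le> rad n x w (norm u)" using r u0 by (intro rad_mono) auto
      finally show "c \<le> norm (pull h \<beta> n x u)" using w rad_nonneg[of "norm u"] by (simp add: norm_sgn)
    qed
  qed
  then show ?thesis using v by blast
qed

lemma rad_strict_mono: "x \<in> space M \<Longrightarrow> w \<noteq> 0 \<Longrightarrow> 0 \<le> r \<Longrightarrow> r < s \<Longrightarrow> rad n x w r < rad n x w s"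
proof (induction n arbitrary: x w)
  case (Suc n)
  have "rad n (ginv x) (Ainv x *v w) r < rad n (ginv x) (Ainv x *v w) s"
    by (intro Suc.IH ginv_space Ainv_nonzero Suc.prems)
  then have "k (rad n (ginv x) (Ainv x *v w) r) < k (rad n (ginv x) (Ainv x *v w) s)"
    by (intro k_less rad_nonneg Suc.prems)
  then show ?case
    unfolding rad.simps using Suc.prems Ainv_nonzero[OF Suc.prems(1,2)]
    by (intro mult_strict_right_mono) auto
qed simp

lemma rad_inj:
  "x \<in> space M \<Longrightarrow> w \<noteq> 0 \<Longrightarrow> 0 \<le> r \<Longrightarrow> 0 \<le> s \<Longrightarrow> rad n x w r = rad n x w s \<Longrightarrow> r = s"
  using rad_strict_mono[of x w r s n] rad_strict_mono[of x w s r n] by (cases r s rule: linorder_cases) simp_all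

text \<open>The recursion of \<open>rad\<close> splits off the step of arrival. This version splits
  off the first step, which relates orbits started at consecutive past times.\<close>

lemma rad_Suc_end:
  "x \<in> space M \<Longrightarrow> rad (Suc n) x w r = rad n x w (k r * (norm (Bc n x *v w) / norm (Bc (Suc n) x *v w)))"
proof (induction n arbitrary: x w)
  case (Suc n)
  have "rad (Suc (Suc n)) x w r = k (rad (Suc n) (ginv x) (Ainv x *v w) r) * (norm w / norm (Ainv x *v w))"
    by (rule rad.simps)
  also have "rad (Suc n) (ginv x) (Ainv x *v w) r =
      rad n (ginv x) (Ainv x *v w) (k r * (norm (Bc (Suc n) x *v w) / norm (Bc (Suc (Suc n)) x *v w)))"
    by (simp only: Suc.IH[OF ginv_space[OF Suc.prems]] Bc_Suc[OF Suc.prems])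
  finally show ?case unfolding rad.simps(2)[of n] .
qed simp

lemma rad_R: "x \<in> space M \<Longrightarrow> w \<noteq> 0 \<Longrightarrow> rad n x w (R ((ginv ^^ n) x) (Bc n x *v w)) = R x w"
proof (induction n)
  case (Suc n)
  then show ?case
    unfolding rad_Suc_end[OF Suc.prems(1)] R_orbit[OF Suc.prems, of n, symmetric] by simp
qed simp

text \<open>\<open>R\<close> is the limit of radii started on the unit circle, which lies in the
  annulus because r \<le> 1.\<close>

lemma R_in_absorb:
  assumes x: "x \<in> space M" and w: "w \<noteq> 0" and r: "r \<le> 1"
  shows "R x w *\<^sub>R sgn w \<in> absorb r x"
proof -
  have lim: "(\<lambda>n. rad n x w 1 *\<^sub>R sgn w) \<longlonglongrightarrow> R x w *\<^sub>R sgn w"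
    by (intro tendsto_intros rad_tendsto_R x w)
  have mem: "rad n x w 1 *\<^sub>R sgn w \<in> (\<Union>n. pull h \<beta> n x ` annulus r)" for n
  proof -
    have "sgn (Bc n x *v w) \<in> annulus r" using Bc_nonzero[OF x w] r by (simp add: annulus_def norm_sgn)
    then have "pull h \<beta> n x (1 *\<^sub>R sgn (Bc n x *v w)) \<in> (\<Union>n. pull h \<beta> n x ` annulus r)" by auto
    then show ?thesis by (simp only: pull_ray[OF x w zero_le_one])
  qed
  show ?thesis
    unfolding absorb_def closure_sequential
    by (intro exI[of _ "\<lambda>n. rad n x w 1 *\<^sub>R sgn w"] conjI allI lim mem)
qed

text \<open>A boundary point comes from boundary points over all past fibres, and these lie in the
  absorbing sets. Conversely, a point of the intersection has a past orbit inside the absorbing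
  sets, whose radii are at least c at infinitely many times, so \<open>pullback_contraction\<close>
  forces equality with \<open>R\<close>.\<close>

lemma frontier_eq_pullback:
  assumes x: "x \<in> space M" "good x" and \<beta>: "exp \<Lambda> < \<beta>" and r: "0 < r" "r \<le> 1"
  shows "frontier (attr x) = (\<Inter>n. pull h \<beta> n x ` absorb r ((ginv ^^ n) x))"
  unfolding frontier_attr[OF x \<beta>]
proof (intro equalityI subsetI INT_I)
  fix v n assume "v \<in> {v. v \<noteq> 0 \<and> norm v = R x v}"
  then have v: "v \<noteq> 0" "norm v = R x v" by auto
  define u where "u = R ((ginv ^^ n) x) (Bc n x *v v) *\<^sub>R sgn (Bc n x *v v)"
  have "pull h \<beta> n x u = R x v *\<^sub>R sgn v"
    unfolding u_def by (simp add: pull_ray[OF x(1) v(1)] R_nonneg rad_R[OF x(1) v(1)])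
  then have "pull h \<beta> n x u = v" using v by (metis norm_eq_zero scaleR_right_imp_eq sgn_div_norm v(2) divideR_right)
  moreover have "u \<in> absorb r ((ginv ^^ n) x)"
    unfolding u_def by (intro R_in_absorb bk.T_space x Bc_nonzero v r)
  ultimately show "v \<in> pull h \<beta> n x ` absorb r ((ginv ^^ n) x)" by blast
next
  fix v assume v: "v \<in> (\<Inter>n. pull h \<beta> n x ` absorb r ((ginv ^^ n) x))"
  obtain m where m: "0 < m" "\<And>n w. w \<noteq> 0 \<Longrightarrow> m \<le> rad n x w r"
    using supercritical_lower_bounds(1)[OF x \<beta> r(1)] by auto
  obtain c where c: "0 < c" "infinite {i. \<forall>n w. w \<noteq> 0 \<longrightarrow> c \<le> rad n ((ginv ^^ i) x) w r}"
    using supercritical_lower_bounds(2)[OF x \<beta> r(1)] by auto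
  define G where "G = {i. \<forall>n w. w \<noteq> 0 \<longrightarrow> c \<le> rad n ((ginv ^^ i) x) w r}"
  have "v \<in> pull h \<beta> 0 x ` absorb r ((ginv ^^ 0) x)" using v by blast
  then have "v \<in> absorb r x" by simp
  then have "m \<le> norm v" by (rule absorb_norm_ge[OF x(1) r(1) m(2), rotated])
  then have v0: "v \<noteq> 0" using m(1) by auto
  have "v \<in> attr x"
  proof -
    have "v \<in> pull h \<beta> n x ` cball 0 1" for n
      using v absorb_subset_cball[OF bk.T_space[OF x(1)], of r n] by blast
    then show ?thesis by (simp add: fibre_attractor[OF x(1)])
  qed
  then have vR: "norm v \<le> R x v" using v0 by (simp add: attr_iff[OF x(1)])
  have "\<exists>u. u \<in> absorb r ((ginv ^^ i) x) \<and> rad i x v (norm u) = norm v" for i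
  proof -
    obtain u where u: "u \<in> absorb r ((ginv ^^ i) x)" "v = pull h \<beta> i x u" using v by blast
    then have u0: "u \<noteq> 0" using v0 by (auto simp: pull_def)
    obtain w where w: "w \<noteq> 0" "v = rad i x w (norm u) *\<^sub>R sgn w"
      using pull_norm[OF x(1) u0, of i] u(2) by metis
    have nn: "0 \<le> rad i x w (norm u)" by (rule rad_nonneg) simp
    have nv: "norm v = rad i x w (norm u)" using w nn by (simp add: norm_sgn)
    have "v = (norm v / norm w) *\<^sub>R w" using w(2) by (simp add: nv[symmetric] sgn_div_norm divide_inverse)
    then have "rad i x v (norm u) = rad i x w (norm u)"
      using rad_scale[of "norm v / norm w" i x w "norm u"] v0 w(1) by simp
    then show ?thesis using u(1) nv by auto
  qed
  then obtain u where u: "\<And>i. u i \<in> absorb r ((ginv ^^ i) x)" "\<And>i. rad i x v (norm (u i)) = norm v" by metis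
  define a where "a i = norm (Bc i x *v v) / norm (Bc (Suc i) x *v v)" for i
  define y where "y i = R ((ginv ^^ i) x) (Bc i x *v v)" for i
  have nz: "Bc i x *v v \<noteq> 0" for i by (intro Bc_nonzero x v0)
  have apos: "0 < a i" for i using nz[of i] nz[of "Suc i"] unfolding a_def by (simp del: cocycle.simps)
  \<comment> \<open>The preimages \<open>u i\<close> were chosen independently for each i;
    injectivity of \<open>rad\<close> in the radius shows that their norms nevertheless form one
    orbit.\<close>
  have urec: "norm (u i) = k (norm (u (Suc i))) * a i" for i
  proof (rule rad_inj[OF x(1) v0])
    show "0 \<le> k (norm (u (Suc i))) * a i" using apos[of i] by (simp add: k_nonneg)
    have "rad (Suc i) x v (norm (u (Suc i))) = norm v" by (rule u(2))
    then show "rad i x v (norm (u i)) = rad i x v (k (norm (u (Suc i))) * a i)"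
      using u(2)[of i] unfolding rad_Suc_end[OF x(1)] a_def by simp
  qed simp
  have upos: "0 < norm (u i)" for i
  proof -
    have "u i \<noteq> 0" using u(2)[of i] v0 by (auto simp: rad_at_0)
    then show ?thesis by simp
  qed
  have uy: "norm (u i) \<le> y i" for i
  proof (rule ccontr)
    assume "\<not> norm (u i) \<le> y i"
    then have "rad i x v (y i) < rad i x v (norm (u i))"
      by (intro rad_strict_mono x v0) (auto simp: y_def R_nonneg)
    then show False using vR u(2)[of i] rad_R[OF x(1) v0, of i] by (simp add: y_def)
  qed
  have lt: "R x v < exp d * norm v" if d: "0 < d" for d
  proof -
    obtain N where N: "\<And>n u y a.
      (\<And>i. i < n \<Longrightarrow> 0 < a i \<and> u i = k (u (Suc i)) * a i \<and> y i = k (y (Suc i)) * a i) \<Longrightarrow>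
      (\<And>i. i \<le> n \<Longrightarrow> 0 < u i \<and> u i \<le> y i \<and> y i \<le> 1) \<Longrightarrow>
      N \<le> card {i \<in> {1..n}. c \<le> u i} \<Longrightarrow> y 0 < exp d * u 0"
      using pullback_contraction[OF c(1) d] by blast
    obtain n where n: "N \<le> card {i \<in> {1..n}. i \<in> G}"
      using infinite_card_Icc c(2) unfolding G_def by blast
    have "y 0 < exp d * norm (u 0)"
    proof (rule N[of n a])
      show "0 < a i \<and> norm (u i) = k (norm (u (Suc i))) * a i \<and> y i = k (y (Suc i)) * a i" for i
        using apos[of i] urec[of i] R_orbit[OF x(1) v0, of i] unfolding y_def a_def by blast
      show "0 < norm (u i) \<and> norm (u i) \<le> y i \<and> y i \<le> 1" for i
        using upos uy R_le_1 by (simp add: y_def)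
      have "{i \<in> {1..n}. i \<in> G} \<subseteq> {i \<in> {1..n}. c \<le> norm (u i)}"
        using absorb_norm_ge[OF bk.T_space[OF x(1)] r(1) _ u(1)] by (auto simp: G_def)
      then have "card {i \<in> {1..n}. i \<in> G} \<le> card {i \<in> {1..n}. c \<le> norm (u i)}" by (intro card_mono) auto
      then show "N \<le> card {i \<in> {1..n}. c \<le> norm (u i)}" using n by simp
    qed
    moreover have "norm (u 0) = norm v" using u(2)[of 0] by simp
    ultimately show ?thesis by (simp add: y_def)
  qed
  have "((\<lambda>d. exp d * norm v) \<longlongrightarrow> exp 0 * norm v) (at_right 0)" by (intro tendsto_intros)
  moreover have "\<forall>\<^sub>F d in at_right 0. R x v \<le> exp d * norm v"
    using eventually_at_right_less[of 0] by eventually_elim (use lt less_imp_le in blast)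
  ultimately have "R x v \<le> exp 0 * norm v" by (rule tendsto_lowerbound) simp
  then show "v \<in> {v. v \<noteq> 0 \<and> norm v = R x v}" using v0 vR by simp
qed

end

section \<open>The unstable direction\<close>

lemma symmetric_segment:
  fixes e :: "'v::real_vector"
  assumes "0 < b"
  shows "{r *\<^sub>R e | r. \<bar>r\<bar> \<le> b} = closed_segment (- (b *\<^sub>R e)) (b *\<^sub>R e)"
proof (intro equalityI subsetI)
  fix v assume "v \<in> {r *\<^sub>R e | r. \<bar>r\<bar> \<le> b}"
  then obtain r where r: "v = r *\<^sub>R e" "\<bar>r\<bar> \<le> b" by blast
  define u where "u = (r / b + 1) / 2"
  have "0 \<le> u" "u \<le> 1" using r(2) assms by (auto simp: u_def field_simps abs_le_iff)
  moreover have "(1 - u) * (- b) + u * b = r" using assms by (simp add: u_def field_simps)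
  then have "v = (1 - u) *\<^sub>R (- (b *\<^sub>R e)) + u *\<^sub>R (b *\<^sub>R e)"
    unfolding r(1) by (simp flip: scaleR_left.add scaleR_minus_left)
  ultimately show "v \<in> closed_segment (- (b *\<^sub>R e)) (b *\<^sub>R e)" unfolding in_segment by blast
next
  fix v assume "v \<in> closed_segment (- (b *\<^sub>R e)) (b *\<^sub>R e)"
  then obtain u where u: "0 \<le> u" "u \<le> 1" "v = (1 - u) *\<^sub>R (- (b *\<^sub>R e)) + u *\<^sub>R (b *\<^sub>R e)"
    unfolding in_segment by blast
  have "v = ((2 * u - 1) * b) *\<^sub>R e" unfolding u(3) by (simp add: algebra_simps flip: scaleR_left.add)
  moreover have "\<bar>(2 * u - 1) * b\<bar> \<le> 1 * b"
    using u assms unfolding abs_mult by (intro mult_mono) auto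
  ultimately show "v \<in> {r *\<^sub>R e | r. \<bar>r\<bar> \<le> b}" by auto
qed

context skew_system
begin

abbreviation eu :: "'a \<Rightarrow> real^2" where "eu x \<equiv> dir (bk.stable_angle x)"
abbreviation es :: "'a \<Rightarrow> real^2" where "es x \<equiv> dir (stable_angle x)"

lemma good_decay:
  assumes "good x" "0 < \<Lambda>"
  shows "\<forall>e>0. \<forall>\<^sub>F n in sequentially. norm (Ac n x *v es x) \<le> exp (- (n * (\<Lambda> - e)))"
    and "\<forall>e>0. \<forall>\<^sub>F n in sequentially. norm (Bc n x *v eu x) \<le> exp (- (n * (\<Lambda> - e)))"
  using assms by (simp_all add: good_def)

lemma good_tendsto_0:
  assumes "good x" "0 < \<Lambda>"
  shows "(\<lambda>n. Ac n x *v es x) \<longlonglongrightarrow> 0" "(\<lambda>n. Bc n x *v eu x) \<longlonglongrightarrow> 0"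
  by (rule tendsto_0_of_exp_rate[OF assms(2) good_decay(1)[OF assms]],
      rule tendsto_0_of_exp_rate[OF assms(2) good_decay(2)[OF assms]])

lemma R_ge_of_decay:
  assumes x: "x \<in> space M" and w: "w \<noteq> 0" and q: "0 < q" and e: "0 < e" "\<forall>t\<in>{0..e}. q * t \<le> k t"
    and D: "\<And>l. norm (Bc l x *v w) \<le> D * q ^ l * norm w"
  shows "0 < D" "min e 1 / D \<le> R x w"
  using rad_ge_of_opnorm[OF x w zero_less_one e(1) q e(2) D] by (auto intro: le_R)

text \<open>The unstable direction is contracted by \<open>Bc\<close> at rate exp (- \<Lambda>), so
  any q between this and \<beta> gives a positive lower bound. The recurrence clause of
  \<open>good\<close> gives a common one at infinitely many future times.\<close>

lemma unstable_radius:
  assumes x: "x \<in> space M" "good x" and \<Lambda>: "0 < \<Lambda>" and \<beta>: "exp (- \<Lambda>) < \<beta>"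
  shows "0 < R x (eu x)" "\<exists>c>0. infinite {i. c \<le> R ((\<gamma> ^^ i) x) (eu ((\<gamma> ^^ i) x))}"
proof -
  obtain q where q: "exp (- \<Lambda>) < q" "q < \<beta>" using dense \<beta> by blast
  have q0: "0 < q" using q(1) exp_gt_zero[of "- \<Lambda>"] by linarith
  obtain e where e: "0 < e" "\<forall>t\<in>{0..e}. q * t \<le> k t" using k_slope[OF q(2)] by blast
  note lower = R_ge_of_decay[OF _ dir_nonzero q0 e]
  have "exp (- \<Lambda>) < exp (ln q)" using q q0 by simp
  then have d: "0 < ln q + \<Lambda>" unfolding exp_less_cancel_iff by simp
  have ev: "\<forall>\<^sub>F n in sequentially. norm (Bc n x *v eu x) \<le> q ^ n"
    using good_decay(2)[OF x(2) \<Lambda>, rule_format, OF d]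
    by eventually_elim (use q0 in \<open>simp add: exp_of_nat_mult\<close>)
  have "0 < q ^ n" for n using q0 by simp
  from eventually_le_imp_const_bound[OF ev this]
  obtain j where j: "\<And>n. norm (Bc n x *v eu x) \<le> real (Suc j) * q ^ n" by blast
  have "min e 1 / real (Suc j) \<le> R x (eu x)" using j by (intro lower x) simp
  moreover have "0 < min e 1 / real (Suc j)" using e by simp
  ultimately show "0 < R x (eu x)" by linarith
  obtain D where D: "infinite {i. \<forall>l. norm (Bc l ((\<gamma> ^^ i) x) *v eu ((\<gamma> ^^ i) x)) \<le> D * q ^ l}"
    using x(2) \<Lambda> q(1) unfolding good_def by blast
  define G where "G = {i. \<forall>l. norm (Bc l ((\<gamma> ^^ i) x) *v eu ((\<gamma> ^^ i) x)) \<le> D * q ^ l}"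
  have G: "0 < D \<and> min e 1 / D \<le> R ((\<gamma> ^^ i) x) (eu ((\<gamma> ^^ i) x))" if "i \<in> G" for i
  proof -
    have "norm (Bc l ((\<gamma> ^^ i) x) *v eu ((\<gamma> ^^ i) x)) \<le> D * q ^ l * norm (eu ((\<gamma> ^^ i) x))" for l
      using that by (simp add: G_def)
    then show ?thesis using lower[OF T_space[OF x(1)]] by blast
  qed
  obtain i0 where "i0 \<in> G" using D unfolding G_def using infinite_imp_nonempty by blast
  then have "0 < min e 1 / D" using G e by simp
  moreover have "infinite {i. min e 1 / D \<le> R ((\<gamma> ^^ i) x) (eu ((\<gamma> ^^ i) x))}"
  proof (rule infinite_super)
    show "G \<subseteq> {i. min e 1 / D \<le> R ((\<gamma> ^^ i) x) (eu ((\<gamma> ^^ i) x))}" using G by blast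
    show "infinite G" using D unfolding G_def .
  qed
  ultimately show "\<exists>c>0. infinite {i. c \<le> R ((\<gamma> ^^ i) x) (eu ((\<gamma> ^^ i) x))}"
    by (intro exI[of _ "min e 1 / D"] conjI)
qed

text \<open>Area invariance bounds \<open>norm (Bc n x *v w)\<close> below by a constant over
  \<open>norm (Bc n x *v eu x)\<close>, which grows faster than \<beta>^n. With
  \<open>rad_upper_bound\<close> this leaves no room for a positive radius.\<close>

lemma R_eq_0_off_unstable:
  assumes x: "x \<in> space M" "good x" and \<Lambda>: "0 < \<Lambda>" and \<beta>: "\<beta> < exp \<Lambda>"
    and w: "w \<noteq> 0" "cross2 w (eu x) \<noteq> 0"
  shows "R x w = 0"
proof -
  define K where "K = \<bar>cross2 w (eu x)\<bar>"
  have K: "0 < K" using w by (simp add: K_def)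
  have bound: "R x w * K \<le> \<beta> ^ n * norm w * norm (Bc n x *v eu x)" for n
  proof -
    have "K = \<bar>cross2 (Bc n x *v w) (Bc n x *v eu x)\<bar>" by (simp add: K_def cross2_mv bk.det_cocycle[OF x(1)])
    also have "\<dots> \<le> norm (Bc n x *v w) * norm (Bc n x *v eu x)" by (rule abs_cross2_le)
    finally have "R x w * K \<le> rad n x w 1 * (norm (Bc n x *v w) * norm (Bc n x *v eu x))"
      using R_nonneg R_le_rad K by (intro mult_mono) (auto intro: rad_nonneg)
    also have "\<dots> = (rad n x w 1 * norm (Bc n x *v w)) * norm (Bc n x *v eu x)" by simp
    also have "\<dots> \<le> (\<beta> ^ n * 1 * norm w) * norm (Bc n x *v eu x)"
      by (intro mult_right_mono rad_upper_bound x w) auto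
    finally show ?thesis by simp
  qed
  have "exp (ln \<beta>) < exp \<Lambda>" using \<beta> \<beta>_pos by simp
  then have lt: "ln \<beta> < \<Lambda>" unfolding exp_less_cancel_iff .
  \<comment> \<open>Half of the gap is spent on the decay estimate, the other half remains as
    exponential decay.\<close>
  define d where "d = (\<Lambda> - ln \<beta>) / 2"
  have d: "0 < d" using lt by (simp add: d_def)
  have ev: "\<forall>\<^sub>F n in sequentially. R x w * K \<le> norm w * exp (- (real n * d))"
    using good_decay(2)[OF x(2) \<Lambda>, rule_format, OF d]
  proof eventually_elim
    case (elim n)
    have "\<beta> ^ n = exp (n * ln \<beta>)" using \<beta>_pos by (simp add: exp_of_nat_mult)
    have "R x w * K \<le> \<beta> ^ n * norm w * norm (Bc n x *v eu x)" by (rule bound)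
    also have "\<dots> \<le> \<beta> ^ n * norm w * exp (- (n * (\<Lambda> - d)))"
      using elim \<beta>_pos by (intro mult_left_mono) auto
    also have "\<dots> = norm w * exp (n * ln \<beta> + - (n * (\<Lambda> - d)))"
      unfolding exp_add \<open>\<beta> ^ n = _\<close> by simp
    also have "n * ln \<beta> + - (n * (\<Lambda> - d)) = - (real n * d)"
      by (simp add: d_def field_simps)
    finally show ?case .
  qed
  have "(\<lambda>n. exp (- (real n * d))) \<longlonglongrightarrow> 0" using d by real_asymp
  then have "(\<lambda>n. norm w * exp (- (real n * d))) \<longlonglongrightarrow> 0" by (rule tendsto_mult_right_zero)
  then have "R x w * K \<le> 0" by (rule tendsto_lowerbound[OF _ ev]) simp
  then show ?thesis using K R_nonneg[of x w] by (simp add: mult_le_0_iff)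
qed

lemma radius_pos_iff:
  assumes x: "x \<in> space M" "good x" and \<Lambda>: "0 < \<Lambda>" and \<beta>: "exp (- \<Lambda>) < \<beta>" "\<beta> < exp \<Lambda>"
    and \<alpha>: "\<alpha> \<in> {0..<1/2}"
  shows "0 < R x (dir \<alpha>) \<longleftrightarrow> \<alpha> = bk.stable_angle x"
proof
  assume "0 < R x (dir \<alpha>)"
  then have "cross2 (dir \<alpha>) (eu x) = 0"
    using R_eq_0_off_unstable[OF x \<Lambda> \<beta>(2) dir_nonzero, of \<alpha>] by (metis less_irrefl)
  then show "\<alpha> = bk.stable_angle x" by (rule dir_parallel_eq[OF \<alpha> bk.stable_angle_range])
qed (use unstable_radius(1)[OF x \<Lambda> \<beta>(1)] in simp)

lemma attr_segment:
  assumes x: "x \<in> space M" "good x" and \<Lambda>: "0 < \<Lambda>" and \<beta>: "\<beta> < exp \<Lambda>"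
  shows "attr x = {r *\<^sub>R eu x | r. \<bar>r\<bar> \<le> R x (eu x)}"
proof (intro equalityI subsetI)
  fix v assume v: "v \<in> attr x"
  show "v \<in> {r *\<^sub>R eu x | r. \<bar>r\<bar> \<le> R x (eu x)}"
  proof (cases "v = 0")
    case True
    then show ?thesis using R_nonneg by (auto intro!: exI[of _ 0])
  next
    case False
    then have "norm v \<le> R x v" using v by (simp add: attr_iff[OF x(1)])
    then have "cross2 v (eu x) = 0" using R_eq_0_off_unstable[OF x \<Lambda> \<beta> False] False by force
    then obtain t where t: "v = t *\<^sub>R eu x" using cross2_eq_0D[OF _ dir_nonzero] by blast
    then have "t \<noteq> 0" using False by auto
    then have "\<bar>t\<bar> \<le> R x (eu x)" using \<open>norm v \<le> R x v\<close> by (simp add: t R_scale)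
    then show ?thesis using t by blast
  qed
next
  fix v assume "v \<in> {r *\<^sub>R eu x | r. \<bar>r\<bar> \<le> R x (eu x)}"
  then obtain r where r: "v = r *\<^sub>R eu x" "\<bar>r\<bar> \<le> R x (eu x)" by blast
  then show "v \<in> attr x" by (cases "r = 0") (simp_all add: attr_iff[OF x(1)] R_scale)
qed

text \<open>The image of the unstable line and the unstable line over the image point are both
  contracted by the inverse cocycle, and such a line is unique.\<close>

lemma unstable_invariant:
  assumes good: "\<And>i. good ((\<gamma> ^^ i) x)" and x: "x \<in> space M" and \<Lambda>: "0 < \<Lambda>"
  shows "\<exists>t. t \<noteq> 0 \<and> Ac n x *v eu x = t *\<^sub>R eu ((\<gamma> ^^ n) x)"
proof (induction n)
  case 0 show ?case by (intro exI[of _ 1]) simp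
next
  case (Suc n)
  define y where "y = (\<gamma> ^^ n) x"
  have y: "y \<in> space M" "\<gamma> y = (\<gamma> ^^ Suc n) x" using T_space[OF x] by (simp_all add: y_def)
  have "(\<lambda>m. Bc m (\<gamma> y) *v (A y *v eu y)) \<longlonglongrightarrow> 0"
    using unstable_transport[OF y(1) good_tendsto_0(2)[OF good[of n] \<Lambda>, folded y_def]] .
  moreover have "(\<lambda>m. Bc m (\<gamma> y) *v eu (\<gamma> y)) \<longlonglongrightarrow> 0"
    using good_tendsto_0(2)[OF good[of "Suc n"] \<Lambda>] y(2) by simp
  ultimately have "cross2 (A y *v eu y) (eu (\<gamma> y)) = 0"
    using contracted_parallel[of "\<lambda>m. Bc m (\<gamma> y)"] bk.det_cocycle[OF gamma_space[OF y(1)]] by blast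
  then obtain s where s: "A y *v eu y = s *\<^sub>R eu (\<gamma> y)" using cross2_eq_0D[OF _ dir_nonzero] by blast
  have "A y *v eu y \<noteq> 0" by (intro mv_nonzero det_A y) simp
  then have s0: "s \<noteq> 0" using s by auto
  obtain t where t: "t \<noteq> 0" "Ac n x *v eu x = t *\<^sub>R eu y" using Suc by (auto simp: y_def)
  have "Ac (Suc n) x *v eu x = A y *v (Ac n x *v eu x)"
    by (simp add: y_def matrix_vector_mul_assoc)
  also have "\<dots> = (t * s) *\<^sub>R eu (\<gamma> y)" by (simp add: t(2) matrix_vector_mult_scaleR s)
  finally show ?case using t(1) s0 y(2) by (intro exI[of _ "t * s"]) simp
qed

section \<open>Forward orbits in polar coordinates\<close>

lemma fit_ray:
  assumes x: "x \<in> space M" and v: "v \<noteq> 0"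
  shows "fit n x v = norm (fit n x v) *\<^sub>R sgn (Ac n x *v v)"
    and "norm (fit (Suc n) x v) = k (norm (fit n x v)) * (norm (Ac (Suc n) x *v v) / norm (Ac n x *v v))"
    and "0 < norm (fit n x v)"
proof -
  have Suc: "Ac (Suc n) x *v v = A ((\<gamma> ^^ n) x) *v (Ac n x *v v)" for n
    by (simp add: matrix_vector_mul_assoc)
  have nz: "Ac n x *v v \<noteq> 0" for n by (intro Ac_nonzero x v)
  have step: "fit (Suc n) x v = (k (norm (fit n x v)) * (norm (Ac (Suc n) x *v v) / norm (Ac n x *v v))) *\<^sub>R sgn (Ac (Suc n) x *v v)"
    if "fit n x v = norm (fit n x v) *\<^sub>R sgn (Ac n x *v v)" for n
  proof -
    have e: "fit (Suc n) x v = fibre_map A h \<beta> ((\<gamma> ^^ n) x) (norm (fit n x v) *\<^sub>R sgn (Ac n x *v v))"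
      using that by simp
    have "A ((\<gamma> ^^ n) x) *v (Ac n x *v v) \<noteq> 0" using nz[of "Suc n"] unfolding Suc .
    then show ?thesis unfolding Suc e by (rule fibre_map_ray[OF nz _ norm_ge_zero])
  qed
  have nn: "0 \<le> k (norm (fit n x v)) * (norm (Ac (Suc n) x *v v) / norm (Ac n x *v v))" for n
    by (intro mult_nonneg_nonneg k_nonneg divide_nonneg_nonneg norm_ge_zero)
  have norm_step: "norm (fit (Suc n) x v) = k (norm (fit n x v)) * (norm (Ac (Suc n) x *v v) / norm (Ac n x *v v))"
    if "fit n x v = norm (fit n x v) *\<^sub>R sgn (Ac n x *v v)" for n
  proof -
    have "norm (sgn (Ac (Suc n) x *v v)) = 1" unfolding norm_sgn using nz[of "Suc n"] by (simp only: if_False)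
    then show ?thesis unfolding step[OF that] norm_scaleR abs_of_nonneg[OF nn] by (simp only: mult_1_right)
  qed
  have ray: "fit n x v = norm (fit n x v) *\<^sub>R sgn (Ac n x *v v)" for n
  proof (induction n)
    case 0
    show ?case using v by (simp add: sgn_div_norm)
  next
    case (Suc n)
    show ?case using step[OF Suc] unfolding norm_step[OF Suc] .
  qed
  show "fit n x v = norm (fit n x v) *\<^sub>R sgn (Ac n x *v v)" by (rule ray)
  show "norm (fit (Suc n) x v) = k (norm (fit n x v)) * (norm (Ac (Suc n) x *v v) / norm (Ac n x *v v))"
    by (rule norm_step[OF ray])
  show "0 < norm (fit n x v)"
  proof (induction n)
    case (Suc n)
    then have "0 < k (norm (fit n x v))" by (rule k_pos)
    then show ?case unfolding norm_step[OF ray] using nz[of n] nz[of "Suc n"] by (simp del: cocycle.simps)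
  qed (use v in simp)
qed

lemma fit_Suc_le_1: "x \<in> space M \<Longrightarrow> norm (fit (Suc n) x v) \<le> 1"
proof -
  assume x: "x \<in> space M"
  define u where "u = fit n x v"
  have "norm (fibre_map A h \<beta> ((\<gamma> ^^ n) x) u) \<le> 1"
  proof (cases "u = 0")
    case False
    have "norm (fibre_map A h \<beta> ((\<gamma> ^^ n) x) u) = k (norm u) * norm (A ((\<gamma> ^^ n) x) *v (u /\<^sub>R norm u))"
      using False k_nonneg[of "norm u"] by (simp add: fibre_map_def)
    also have "\<dots> \<le> k (norm u) * C"
    proof (intro mult_left_mono k_nonneg norm_ge_zero)
      show "norm (A ((\<gamma> ^^ n) x) *v (u /\<^sub>R norm u)) \<le> C"
        using norm_mv_le[of "A ((\<gamma> ^^ n) x)" "u /\<^sub>R norm u"] opnorm_A[OF T_space[OF x, of n]] False by simp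
    qed
    also have "\<dots> \<le> 1" using h_C[of "\<beta> * norm u"] \<beta>_pos by simp
    finally show ?thesis .
  qed simp
  then show ?thesis by (simp add: u_def)
qed

text \<open>Off the stable line the vector has a nonzero component \<open>a\<close> along
  \<open>eu x\<close>, which dominates: directions align with the unstable line and the growth
  quotient \<open>g\<close> tends to the modulus of \<open>a\<close>. Then
  \<open>forward_synchronization\<close> matches the radii.\<close>

lemma forward_attraction:
  assumes good: "\<And>i. good ((\<gamma> ^^ i) x)" and x: "x \<in> space M" and \<Lambda>: "0 < \<Lambda>" and \<beta>: "exp (- \<Lambda>) < \<beta>"
    and v: "v \<notin> range (\<lambda>t. t *\<^sub>R es x)"
  shows "(\<lambda>n. infdist (fit n x v) {R ((\<gamma> ^^ n) x) (eu ((\<gamma> ^^ n) x)) *\<^sub>R eu ((\<gamma> ^^ n) x),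
    - (R ((\<gamma> ^^ n) x) (eu ((\<gamma> ^^ n) x)) *\<^sub>R eu ((\<gamma> ^^ n) x))}) \<longlonglongrightarrow> 0"
proof -
  have gx: "good x" using good[of 0] by simp
  have v0: "v \<noteq> 0" using v by (metis rangeI scaleR_zero_left)
  have ne: "cross2 (eu x) (es x) \<noteq> 0"
    using dir_parallel_eq[OF bk.stable_angle_range stable_angle_range] gx \<Lambda> unfolding good_def by blast
  obtain a b where ab: "v = a *\<^sub>R eu x + b *\<^sub>R es x" using cross2_basis[OF ne] by blast
  have a0: "a \<noteq> 0" using v ab by auto
  define E where "E n = norm (Ac n x *v eu x)" for n
  define U where "U n = sgn (Ac n x *v v)" for n
  define V where "V n = sgn (Ac n x *v eu x)" for n
  define z where "z n = (b / E n) *\<^sub>R (Ac n x *v es x)" for n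
  define g where "g n = norm (Ac n x *v v) / E n" for n
  define r where "r n = R ((\<gamma> ^^ n) x) (eu ((\<gamma> ^^ n) x))" for n
  define \<rho> where "\<rho> n = norm (fit n x v)" for n
  have nz: "Ac n x *v v \<noteq> 0" "Ac n x *v eu x \<noteq> 0" for n by (intro Ac_nonzero x v0 dir_nonzero)+
  have E0: "0 < E n" for n using nz by (simp add: E_def)
  have decomp: "(1 / E n) *\<^sub>R (Ac n x *v v) = a *\<^sub>R V n + z n" for n
    by (simp add: ab V_def z_def E_def sgn_div_norm matrix_vector_right_distrib matrix_vector_mult_scaleR
        scaleR_add_right divide_inverse mult.commute)
  \<comment> \<open>Area preservation bounds 1 / E n by a multiple of the contracted length, so the
    stable correction decays like the square of that length.\<close>
  have zlim: "z \<longlonglongrightarrow> 0"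
  proof (rule Lim_null_comparison)
    define c where "c = \<bar>cross2 (eu x) (es x)\<bar>"
    have c: "0 < c" using ne by (simp add: c_def)
    show "\<forall>\<^sub>F n in sequentially. norm (z n) \<le> \<bar>b\<bar> / c * (norm (Ac n x *v es x))\<^sup>2"
    proof (intro always_eventually allI)
      fix n
      have "c = \<bar>cross2 (Ac n x *v eu x) (Ac n x *v es x)\<bar>"
        by (simp add: c_def cross2_mv det_cocycle[OF x])
      also have "\<dots> \<le> E n * norm (Ac n x *v es x)" unfolding E_def by (rule abs_cross2_le)
      finally have "1 / E n \<le> norm (Ac n x *v es x) / c" using E0[of n] c by (simp add: field_simps)
      then have "\<bar>b\<bar> * norm (Ac n x *v es x) * (1 / E n) \<le> \<bar>b\<bar> * norm (Ac n x *v es x) * (norm (Ac n x *v es x) / c)"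
        by (intro mult_left_mono) auto
      then show "norm (z n) \<le> \<bar>b\<bar> / c * (norm (Ac n x *v es x))\<^sup>2"
        using E0[of n] by (simp add: z_def power2_eq_square)
    qed
    have "(\<lambda>n. (norm (Ac n x *v es x))\<^sup>2) \<longlonglongrightarrow> 0\<^sup>2"
      by (intro tendsto_power tendsto_norm_zero good_tendsto_0(1) gx \<Lambda>)
    then have "(\<lambda>n. (norm (Ac n x *v es x))\<^sup>2) \<longlonglongrightarrow> 0" by simp
    then show "(\<lambda>n. \<bar>b\<bar> / c * (norm (Ac n x *v es x))\<^sup>2) \<longlonglongrightarrow> 0"
      by (rule tendsto_mult_right_zero)
  qed
  have g_eq: "g n = norm (a *\<^sub>R V n + z n)" for n
    unfolding decomp[symmetric] using E0[of n] by (simp add: g_def)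
  have V1: "norm (V n) = 1" for n using nz by (simp add: V_def norm_sgn)
  have glim: "g \<longlonglongrightarrow> \<bar>a\<bar>"
  proof (rule Lim_transform2[where f="\<lambda>n. \<bar>a\<bar>"])
    show "(\<lambda>n. \<bar>a\<bar> - g n) \<longlonglongrightarrow> 0"
    proof (rule Lim_null_comparison[OF _ tendsto_norm_zero[OF zlim]], intro always_eventually allI)
      fix n
      have "\<bar>norm (a *\<^sub>R V n) - norm (a *\<^sub>R V n + z n)\<bar> \<le> norm (a *\<^sub>R V n - (a *\<^sub>R V n + z n))"
        by (rule norm_triangle_ineq3)
      then show "norm (\<bar>a\<bar> - g n) \<le> norm (z n)" by (simp add: g_eq V1)
    qed
  qed simp
  have gpos: "0 < g n" for n using nz(1)[of n] E0[of n] by (simp add: g_def)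
  have R_eu: "R ((\<gamma> ^^ n) x) (Ac n x *v eu x) = r n" for n
    using unstable_invariant[OF good x \<Lambda>, of n] by (auto simp: r_def R_scale)
  have r_rec: "r (Suc n) = k (r n) * (E (Suc n) / E n)" for n
  proof -
    have "A ((\<gamma> ^^ n) x) *v (Ac n x *v eu x) = Ac (Suc n) x *v eu x" by (simp add: matrix_vector_mul_assoc)
    then have "R ((\<gamma> ^^ Suc n) x) (Ac (Suc n) x *v eu x) = k (R ((\<gamma> ^^ n) x) (Ac n x *v eu x)) * (E (Suc n) / E n)"
      using R_forward[OF T_space[OF x, of n] nz(2)[of n]] by (simp only: E_def funpow.simps o_apply)
    then show ?thesis by (simp only: R_eu)
  qed
  have sync: "(\<lambda>n. \<rho> n / r n) \<longlonglongrightarrow> 1"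
  proof -
    obtain c where c: "0 < c" "infinite {i. c \<le> r i}"
      using unstable_radius(2)[OF x gx \<Lambda> \<beta>] unfolding r_def by blast
    show ?thesis
    proof (rule forward_synchronization[where g=g and l="\<bar>a\<bar>" and c=c
        and p="\<lambda>n. norm (Ac (Suc n) x *v v) / norm (Ac n x *v v)" and s="\<lambda>n. E (Suc n) / E n"])
      show "0 < \<rho> n" for n unfolding \<rho>_def by (rule fit_ray(3)[OF x v0])
      show "0 < r n" for n unfolding r_def by (rule unstable_radius(1)[OF T_space[OF x] good \<Lambda> \<beta>])
      show "0 < norm (Ac (Suc n) x *v v) / norm (Ac n x *v v)" for n
        using nz(1)[of n] nz(1)[of "Suc n"] by (simp del: cocycle.simps)
      show "0 < E (Suc n) / E n" for n using E0 by simp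
      show "\<rho> (Suc n) = k (\<rho> n) * (norm (Ac (Suc n) x *v v) / norm (Ac n x *v v))" for n
        unfolding \<rho>_def by (rule fit_ray(2)[OF x v0])
      show "norm (Ac (Suc n) x *v v) / norm (Ac n x *v v) * g n = E (Suc n) / E n * g (Suc n)" for n
        using nz(1)[of n] E0[of "Suc n"] by (simp add: g_def del: cocycle.simps)
      show "\<rho> (Suc n) \<le> 1" for n unfolding \<rho>_def by (rule fit_Suc_le_1[OF x])
      show "r n \<le> 1" for n unfolding r_def by (rule R_le_1)
    qed (use gpos a0 r_rec glim c in auto)
  qed
  \<comment> \<open>The sign of the unstable component selects which of the two points is
    approached; orientation flips of the cocycle are contained in \<open>V\<close>.\<close>
  define \<sigma> where "\<sigma> = a / \<bar>a\<bar>"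
  have \<sigma>: "\<sigma> = 1 \<or> \<sigma> = -1" using a0 by (auto simp: \<sigma>_def abs_if)
  have UV: "(\<lambda>n. U n - \<sigma> *\<^sub>R V n) \<longlonglongrightarrow> 0"
  proof -
    have eq: "U n - \<sigma> *\<^sub>R V n = (a / g n - \<sigma>) *\<^sub>R V n + (1 / g n) *\<^sub>R z n" for n
    proof -
      have "U n = (1 / g n) *\<^sub>R ((1 / E n) *\<^sub>R (Ac n x *v v))"
        using E0[of n] by (simp add: U_def g_def sgn_div_norm divide_inverse)
      also have "\<dots> = (a / g n) *\<^sub>R V n + (1 / g n) *\<^sub>R z n"
        unfolding decomp by (simp add: scaleR_add_right)
      finally show ?thesis by (simp add: scaleR_diff_left)
    qed
    have ga: "(\<lambda>n. a / g n - \<sigma>) \<longlonglongrightarrow> a / \<bar>a\<bar> - \<sigma>" using a0 by (intro tendsto_intros glim) simp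
    have "(\<lambda>n. (a / g n - \<sigma>) *\<^sub>R V n) \<longlonglongrightarrow> 0"
    proof (rule tendsto_norm_zero_cancel)
      have "(\<lambda>n. norm (a / g n - \<sigma>)) \<longlonglongrightarrow> 0" using ga by (intro tendsto_norm_zero) (simp add: \<sigma>_def)
      then show "(\<lambda>n. norm ((a / g n - \<sigma>) *\<^sub>R V n)) \<longlonglongrightarrow> 0" by (simp add: V1)
    qed
    moreover have "(\<lambda>n. (1 / g n) *\<^sub>R z n) \<longlonglongrightarrow> (1 / \<bar>a\<bar>) *\<^sub>R 0"
      using a0 by (intro tendsto_intros glim zlim) simp
    ultimately show ?thesis unfolding eq using tendsto_add by fastforce
  qed
  \<comment> \<open>Radial and angular errors are separated; r n \<le> 1 removes the radius from
    both.\<close>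
  have bound: "infdist (fit n x v) {r n *\<^sub>R eu ((\<gamma> ^^ n) x), - (r n *\<^sub>R eu ((\<gamma> ^^ n) x))} \<le>
      \<bar>\<rho> n / r n - 1\<bar> + norm (U n - \<sigma> *\<^sub>R V n)" for n
  proof -
    obtain t where t: "t \<noteq> 0" "Ac n x *v eu x = t *\<^sub>R eu ((\<gamma> ^^ n) x)"
      using unstable_invariant[OF good x \<Lambda>] by blast
    have "V n = sgn t *\<^sub>R eu ((\<gamma> ^^ n) x)" using t by (simp add: V_def sgn_scaleR sgn_div_norm[of "eu ((\<gamma> ^^ n) x)"])
    then have V: "V n = eu ((\<gamma> ^^ n) x) \<or> V n = - eu ((\<gamma> ^^ n) x)" using t(1) by (cases "0 < t") auto
    define p where "p = (r n * \<sigma>) *\<^sub>R V n"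
    have "p \<in> {r n *\<^sub>R eu ((\<gamma> ^^ n) x), - (r n *\<^sub>R eu ((\<gamma> ^^ n) x))}"
      using V \<sigma> unfolding p_def by auto
    then have le: "infdist (fit n x v) {r n *\<^sub>R eu ((\<gamma> ^^ n) x), - (r n *\<^sub>R eu ((\<gamma> ^^ n) x))} \<le> dist (fit n x v) p"
      by (rule infdist_le)
    have fitU: "fit n x v = \<rho> n *\<^sub>R U n" unfolding \<rho>_def U_def by (rule fit_ray(1)[OF x v0])
    have "dist (\<rho> n *\<^sub>R U n) p = norm ((\<rho> n - r n) *\<^sub>R U n + r n *\<^sub>R (U n - \<sigma> *\<^sub>R V n))"
      by (simp add: dist_norm p_def algebra_simps)
    also have "\<dots> \<le> norm ((\<rho> n - r n) *\<^sub>R U n) + norm (r n *\<^sub>R (U n - \<sigma> *\<^sub>R V n))"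
      by (rule norm_triangle_ineq)
    also have "\<dots> = \<bar>\<rho> n - r n\<bar> + r n * norm (U n - \<sigma> *\<^sub>R V n)"
      using nz(1)[of n] R_nonneg by (simp add: U_def norm_sgn r_def)
    also have "\<dots> \<le> \<bar>\<rho> n / r n - 1\<bar> + 1 * norm (U n - \<sigma> *\<^sub>R V n)"
    proof (intro add_mono mult_right_mono)
      have rp: "0 < r n" unfolding r_def by (rule unstable_radius(1)[OF T_space[OF x] good \<Lambda> \<beta>])
      have r1: "r n \<le> 1" unfolding r_def by (rule R_le_1)
      have "\<rho> n - r n = r n * (\<rho> n / r n - 1)" using rp by (simp add: field_simps)
      then have "\<bar>\<rho> n - r n\<bar> = r n * \<bar>\<rho> n / r n - 1\<bar>" using rp by (simp add: abs_mult)
      also have "\<dots> \<le> \<bar>\<rho> n / r n - 1\<bar>" using rp r1 by (intro mult_left_le_one_le) auto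
      finally show "\<bar>\<rho> n - r n\<bar> \<le> \<bar>\<rho> n / r n - 1\<bar>" .
      show "r n \<le> 1" by (rule r1)
    qed simp
    finally show ?thesis using le fitU by simp
  qed
  have "(\<lambda>n. \<rho> n / r n - 1) \<longlonglongrightarrow> 1 - 1" by (intro tendsto_diff sync tendsto_const)
  then have "(\<lambda>n. \<rho> n / r n - 1) \<longlonglongrightarrow> 0" by simp
  then have "(\<lambda>n. \<bar>\<rho> n / r n - 1\<bar>) \<longlonglongrightarrow> 0" by (rule tendsto_rabs_zero)
  then have lim: "(\<lambda>n. \<bar>\<rho> n / r n - 1\<bar> + norm (U n - \<sigma> *\<^sub>R V n)) \<longlonglongrightarrow> 0"
    by (rule tendsto_add_zero[OF _ tendsto_norm_zero[OF UV]])
  show ?thesis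
    unfolding r_def[symmetric]
    by (rule Lim_null_comparison[OF _ lim], rule always_eventually, rule allI) (simp add: bound infdist_nonneg)
qed

lemma measurable_R:
  assumes "w \<in> borel_measurable M" shows "(\<lambda>x. R x (w x)) \<in> borel_measurable M"
  unfolding R_def
  by (rule borel_measurable_cINF[OF _ borel_measurable_rad[OF assms] bdd_below_rad]) simp_all

lemma psi_attractor:
  assumes S: "S \<in> sets M" "\<gamma> ` S = S" "\<And>x. x \<in> S \<Longrightarrow> good x" and \<Lambda>: "0 < \<Lambda>" and \<beta>: "exp (- \<Lambda>) < \<beta>"
  shows "random_two_point_forward_attractor M \<gamma> A h \<beta> S (Psi M \<gamma> A h bk.stable_angle \<beta>)
    (attraction_domain S stable_angle)"
proof -
  have sp: "x \<in> space M" if "x \<in> S" for x using that sets.sets_into_space[OF S(1)] by blast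
  have Psi: "Psi M \<gamma> A h bk.stable_angle \<beta> x = {R x (eu x) *\<^sub>R eu x, - (R x (eu x) *\<^sub>R eu x)}"
    if "x \<in> space M" for x using that by (simp add: Psi_def radius_eq_R)
  have pos: "0 < R x (eu x)" if "x \<in> S" for x by (rule unstable_radius(1)[OF sp[OF that] S(3)[OF that] \<Lambda> \<beta>])
  have fib: "fibre (Sigma S (Psi M \<gamma> A h bk.stable_angle \<beta>)) x = Psi M \<gamma> A h bk.stable_angle \<beta> x" if "x \<in> S" for x
    using that by (auto simp: fibre_def)
  have space_restr: "space (restrict_space M S) = S" using sp by (auto simp: space_restrict_space)
  have euM [measurable]: "eu \<in> borel_measurable M" by measurable
  have "random_compact_set (restrict_space M S) (Sigma S (Psi M \<gamma> A h bk.stable_angle \<beta>))"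
    unfolding random_compact_set_def
  proof (intro conjI allI)
    show "Sigma S (Psi M \<gamma> A h bk.stable_angle \<beta>) \<subseteq> space (restrict_space M S) \<times> UNIV"
      unfolding space_restr by auto
    show "AE x in restrict_space M S. compact (fibre (Sigma S (Psi M \<gamma> A h bk.stable_angle \<beta>)) x)"
      by (rule AE_I2) (simp add: space_restr fib Psi sp)
    fix y :: "real^2"
    have [measurable]: "(\<lambda>x. R x (eu x)) \<in> borel_measurable M" by (rule measurable_R[OF euM])
    have "(\<lambda>x. min (dist y (R x (eu x) *\<^sub>R eu x)) (dist y (- (R x (eu x) *\<^sub>R eu x)))) \<in> borel_measurable M"
      by measurable
    then have m: "(\<lambda>x. min (dist y (R x (eu x) *\<^sub>R eu x)) (dist y (- (R x (eu x) *\<^sub>R eu x)))) \<in>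
        borel_measurable (restrict_space M S)"
      by (rule measurable_restrict_space1)
    have eq: "infdist y (fibre (Sigma S (Psi M \<gamma> A h bk.stable_angle \<beta>)) x) =
        min (dist y (R x (eu x) *\<^sub>R eu x)) (dist y (- (R x (eu x) *\<^sub>R eu x)))"
      if "x \<in> space (restrict_space M S)" for x
    proof -
      have "x \<in> S" using that by (simp add: space_restr)
      then show ?thesis by (simp add: fib Psi sp infdist_notempty cInf_insert_If inf_min image_insert)
    qed
    show "(\<lambda>x. infdist y (fibre (Sigma S (Psi M \<gamma> A h bk.stable_angle \<beta>)) x)) \<in> borel_measurable (restrict_space M S)"
      by (subst measurable_cong[OF eq]) (assumption, rule m)
  qed
  moreover have "\<forall>x\<in>S. card (Psi M \<gamma> A h bk.stable_angle \<beta> x) = 2"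
  proof
    fix x assume x: "x \<in> S"
    define p where "p = R x (eu x) *\<^sub>R eu x"
    have p: "p \<noteq> 0" using pos[OF x] by (simp add: p_def)
    have "p \<noteq> - p"
    proof
      assume "p = - p"
      then have "p + p = 0" by (simp add: add_eq_0_iff)
      then have "(2::real) *\<^sub>R p = 0" by (simp add: scaleR_2)
      then show False using p by simp
    qed
    then show "card (Psi M \<gamma> A h bk.stable_angle \<beta> x) = 2" unfolding Psi[OF sp[OF x]] p_def[symmetric] by simp
  qed
  moreover have "(\<lambda>n. infdist (fit n x v) (Psi M \<gamma> A h bk.stable_angle \<beta> ((\<gamma> ^^ n) x))) \<longlonglongrightarrow> 0"
    if "(x, v) \<in> attraction_domain S stable_angle" for x v
  proof -
    have x: "x \<in> S" and v: "v \<notin> range (\<lambda>t. t *\<^sub>R es x)" using that by (auto simp: attraction_domain_def)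
    have good: "good ((\<gamma> ^^ i) x)" for i using gamma_pow_mem[OF S(2) x] S(3) by blast
    show ?thesis
      unfolding Psi[OF T_space[OF sp[OF x]]] by (rule forward_attraction[OF good sp[OF x] \<Lambda> \<beta> v])
  qed
  ultimately show ?thesis unfolding random_two_point_forward_attractor_def by auto
qed

end

context skew_system
begin

lemma frontier_eq_pullback_Kset:
  assumes x: "x \<in> space M" "good x" and \<beta>: "exp \<Lambda> < \<beta>" and r: "0 < r" "r \<le> 1"
  shows "frontier (attr x) = (\<Inter>n. fit n ((ginv ^^ n) x) ` fibre (Kset r) ((ginv ^^ n) x))"
proof -
  have "pull h \<beta> n x = fit n ((ginv ^^ n) x)" for n by (rule ext) (rule pull_def)
  moreover have "fibre (Kset r) ((ginv ^^ n) x) = absorb r ((ginv ^^ n) x)" for n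
    unfolding fibre_Kset using bk.T_space[OF x(1)] by (rule if_P)
  ultimately show ?thesis using frontier_eq_pullback[OF x \<beta> r] by presburger
qed

end

theorem theorem1p3:
  fixes M :: "'a measure"
    and \<gamma> :: "'a \<Rightarrow> 'a"
    and A :: "'a \<Rightarrow> real^2^2"
    and h h' h'' :: "real \<Rightarrow> real"
  assumes "prob_space M"
    and "bimeasurable_bij M \<gamma>"
    and "invariant_ergodic M \<gamma>"
    and "A \<in> borel_measurable M"
    and "\<forall>\<theta>\<in>space M. det (A \<theta>) = 1"
    and "bdd_above ((\<lambda>\<theta>. opnorm (A \<theta>)) ` space M)"
    and "\<forall>x\<ge>0. h x \<ge> 0"
    and "\<forall>x\<ge>0. (h has_real_derivative h' x) (at x within {0..})"
    and "\<forall>x\<ge>0. (h' has_real_derivative h'' x) (at x within {0..})"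
    and "continuous_on {0..} h''"
    and "strict_mono_on {0..} h"
    and "strictly_concave_on {0..} h"
    and "bounded (h ` {0..})"
    and "h 0 = 0"
    and "h' 0 = 1"
    and "(SUP x\<in>{0..}. h x) \<le> inverse (SUP \<theta>\<in>space M. opnorm (A \<theta>))"
  shows "\<exists>\<Theta>\<^sub>0 \<alpha>\<^sub>u \<alpha>\<^sub>s.
    \<Theta>\<^sub>0 \<in> sets M \<and> \<gamma> ` \<Theta>\<^sub>0 = \<Theta>\<^sub>0 \<and> measure M \<Theta>\<^sub>0 = 1 \<and>
    \<alpha>\<^sub>u \<in> borel_measurable (restrict_space M \<Theta>\<^sub>0) \<and> \<alpha>\<^sub>u ` \<Theta>\<^sub>0 \<subseteq> {0..<1/2} \<and>
    \<alpha>\<^sub>s \<in> borel_measurable (restrict_space M \<Theta>\<^sub>0) \<and> \<alpha>\<^sub>s ` \<Theta>\<^sub>0 \<subseteq> {0..<1/2} \<and>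
    \<comment> \<open>(a)\<close>
    (\<forall>\<beta>\<ge>0. \<beta> < exp (- lyapunov M \<gamma> A) \<longrightarrow>
      (\<forall>\<theta>\<in>\<Theta>\<^sub>0. fibre (attractor M \<gamma> A h \<beta>) \<theta> = {0} \<and>
        (\<forall>v. (\<lambda>n. fibre_iter \<gamma> A h \<beta> n \<theta> v) \<longlonglongrightarrow> 0))) \<and>
    \<comment> \<open>(b)\<close>
    (\<forall>\<beta>\<ge>0. exp (- lyapunov M \<gamma> A) < \<beta> \<and> \<beta> < exp (lyapunov M \<gamma> A) \<longrightarrow>
      (\<forall>\<theta>\<in>\<Theta>\<^sub>0.
        (\<exists>a b. a \<noteq> b \<and> fibre (attractor M \<gamma> A h \<beta>) \<theta> = closed_segment a b) \<and>
        (\<forall>\<alpha>\<in>{0..<1/2}. radius M \<gamma> A h \<beta> \<theta> \<alpha> > 0 \<longleftrightarrow> \<alpha> = \<alpha>\<^sub>u \<theta>) \<and>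
        fibre (attractor M \<gamma> A h \<beta>) \<theta> =
          {r *\<^sub>R dir (\<alpha>\<^sub>u \<theta>) | r. \<bar>r\<bar> \<le> radius M \<gamma> A h \<beta> \<theta> (\<alpha>\<^sub>u \<theta>)}) \<and>
      random_two_point_forward_attractor M \<gamma> A h \<beta> \<Theta>\<^sub>0
        (Psi M \<gamma> A h \<alpha>\<^sub>u \<beta>) (attraction_domain \<Theta>\<^sub>0 \<alpha>\<^sub>s)) \<and>
    \<comment> \<open>(c)\<close>
    (\<forall>\<beta>\<ge>0. exp (lyapunov M \<gamma> A) < \<beta> \<longrightarrow>
      (\<forall>\<theta>\<in>\<Theta>\<^sub>0.
        (\<forall>\<alpha>. radius M \<gamma> A h \<beta> \<theta> \<alpha> > 0) \<and>
        continuous_on UNIV (radius M \<gamma> A h \<beta> \<theta>) \<and>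
        frontier (fibre (attractor M \<gamma> A h \<beta>) \<theta>) =
          {radius M \<gamma> A h \<beta> \<theta> \<alpha> *\<^sub>R dir \<alpha> | \<alpha>. \<alpha> \<in> {0..<1}}) \<and>
      (\<forall>\<delta>>0. \<exists>K.
        random_compact_set M K \<and> forward_invariant M \<gamma> A h \<beta> K \<and>
        \<Theta>\<^sub>0 \<times> (cball 0 1 - ball 0 \<delta>) \<subseteq> K \<and>
        (\<forall>\<theta>\<in>\<Theta>\<^sub>0. frontier (fibre (attractor M \<gamma> A h \<beta>) \<theta>) =
          (\<Inter>n. let \<theta>' = (inv_into (space M) \<gamma> ^^ n) \<theta>
               in fibre_iter \<gamma> A h \<beta> n \<theta>' ` fibre K \<theta>'))) \<and>
      (lyapunov M \<gamma> A > 0 \<longrightarrow>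
        random_two_point_forward_attractor M \<gamma> A h \<beta> \<Theta>\<^sub>0
          (Psi M \<gamma> A h \<alpha>\<^sub>u \<beta>) (attraction_domain \<Theta>\<^sub>0 \<alpha>\<^sub>s) \<and>
        (\<forall>\<theta>\<in>\<Theta>\<^sub>0. Psi M \<gamma> A h \<alpha>\<^sub>u \<beta> \<theta> \<subseteq> frontier (fibre (attractor M \<gamma> A h \<beta>) \<theta>))))"
proof -
  interpret prob_space M by fact
  define C where "C = (SUP \<theta>\<in>space M. opnorm (A \<theta>))"
  have opC: "opnorm (A \<theta>) \<le> C" if "\<theta> \<in> space M" for \<theta>
    unfolding C_def using assms(6) that by (intro cSUP_upper)
  interpret S: sl2_system M \<gamma> A C
    by unfold_locales (use assms opC in auto)
  \<comment> \<open>Determinant 1 forces \<open>C \<ge> 1\<close>, so the \<open>inverse\<close> in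
    the hypothesis is a genuine reciprocal.\<close>
  have hC: "h t * C \<le> 1" if "0 \<le> t" for t
  proof -
    have "bdd_above (h ` {0..})" using assms(13) by (rule bounded_imp_bdd_above)
    then have "h t \<le> (SUP x\<in>{0..}. h x)" using that by (intro cSUP_upper) auto
    then have "h t \<le> inverse C" using assms(16) unfolding C_def by linarith
    then show ?thesis using S.C_ge_1 by (simp add: field_simps)
  qed
  have radial: "radial_map (\<lambda>t. h (\<beta> * t)) \<beta>" if "0 < \<beta>" for \<beta>
    by (rule strictly_concave_radial_map[OF assms(8,15,14,11,12) that])
  \<comment> \<open>The parameter value 1 in \<open>k_le\<close> removes the scaling; this form
    serves (a), where \<beta> may be 0.\<close>
  have h01: "0 \<le> h t \<and> h t \<le> t" if "0 \<le> t" for t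
    using radial_map.k_le[OF radial[of 1], of t] assms(7) that by simp
  have skew: "skew_system M \<gamma> A C h \<beta>" if "0 < \<beta>" for \<beta>
    by (intro skew_system.intro skew_system_axioms.intro S.sl2_system_axioms radial that hC)
  obtain \<Theta>\<^sub>0 where \<Theta>\<^sub>0: "\<Theta>\<^sub>0 \<in> sets M" "\<gamma> ` \<Theta>\<^sub>0 = \<Theta>\<^sub>0" "measure M \<Theta>\<^sub>0 = 1"
    and good: "\<And>\<theta>. \<theta> \<in> \<Theta>\<^sub>0 \<Longrightarrow> S.good \<theta>"
    using S.invariant_full_set[OF S.AE_good] by blast
  have sp: "\<theta> \<in> space M" if "\<theta> \<in> \<Theta>\<^sub>0" for \<theta> using that sets.sets_into_space[OF \<Theta>\<^sub>0(1)] by blast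
  define \<alpha>\<^sub>u where "\<alpha>\<^sub>u = S.bk.stable_angle"
  define \<alpha>\<^sub>s where "\<alpha>\<^sub>s = S.stable_angle"
  let ?\<Lambda> = "lyapunov M \<gamma> A"
  have a: "fibre (attractor M \<gamma> A h \<beta>) \<theta> = {0} \<and> (\<forall>v. (\<lambda>n. fibre_iter \<gamma> A h \<beta> n \<theta> v) \<longlonglongrightarrow> 0)"
    if "0 \<le> \<beta>" "\<beta> < exp (- ?\<Lambda>)" "\<theta> \<in> \<Theta>\<^sub>0" for \<beta> \<theta>
    using S.subcritical[OF sp[OF that(3)] good[OF that(3)] h01 that(1,2)] by simp
  \<comment> \<open>Shared by (b) and (c), since only \<beta> > exp (- \<Lambda>) and \<Lambda> > 0
    enter.\<close>
  have forward: "random_two_point_forward_attractor M \<gamma> A h \<beta> \<Theta>\<^sub>0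
      (Psi M \<gamma> A h \<alpha>\<^sub>u \<beta>) (attraction_domain \<Theta>\<^sub>0 \<alpha>\<^sub>s)"
    if "exp (- ?\<Lambda>) < \<beta>" "0 < ?\<Lambda>" for \<beta>
  proof -
    have "0 < \<beta>" using that(1) exp_gt_zero[of "- ?\<Lambda>"] by linarith
    then interpret K: skew_system M \<gamma> A C h \<beta> by (rule skew)
    show ?thesis unfolding \<alpha>\<^sub>u_def \<alpha>\<^sub>s_def by (rule K.psi_attractor[OF \<Theta>\<^sub>0(1,2) good that(2,1)])
  qed
  have b: "(\<exists>a b. a \<noteq> b \<and> fibre (attractor M \<gamma> A h \<beta>) \<theta> = closed_segment a b) \<and>
        (\<forall>\<alpha>\<in>{0..<1/2}. radius M \<gamma> A h \<beta> \<theta> \<alpha> > 0 \<longleftrightarrow> \<alpha> = \<alpha>\<^sub>u \<theta>) \<and>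
        fibre (attractor M \<gamma> A h \<beta>) \<theta> =
          {r *\<^sub>R dir (\<alpha>\<^sub>u \<theta>) | r. \<bar>r\<bar> \<le> radius M \<gamma> A h \<beta> \<theta> (\<alpha>\<^sub>u \<theta>)}"
    if \<beta>: "exp (- ?\<Lambda>) < \<beta>" "\<beta> < exp ?\<Lambda>" and "\<theta> \<in> \<Theta>\<^sub>0" for \<beta> \<theta>
  proof -
    have "0 < \<beta>" using \<beta>(1) exp_gt_zero[of "- ?\<Lambda>"] by linarith
    then interpret K: skew_system M \<gamma> A C h \<beta> by (rule skew)
    \<comment> \<open>Positivity of the exponent is implied by the existence of a parameter in the
      interval of (b).\<close>
    have "exp (- ?\<Lambda>) < exp ?\<Lambda>" using \<beta> by (rule less_trans)
    then have \<Lambda>: "0 < ?\<Lambda>" by simp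
    note \<theta> = sp[OF \<open>\<theta> \<in> \<Theta>\<^sub>0\<close>] good[OF \<open>\<theta> \<in> \<Theta>\<^sub>0\<close>]
    let ?b = "K.R \<theta> (dir (\<alpha>\<^sub>u \<theta>))"
    have pos: "0 < ?b" unfolding \<alpha>\<^sub>u_def by (rule K.unstable_radius(1)[OF \<theta> \<Lambda> \<beta>(1)])
    have seg: "fibre (attractor M \<gamma> A h \<beta>) \<theta> = {r *\<^sub>R dir (\<alpha>\<^sub>u \<theta>) | r. \<bar>r\<bar> \<le> ?b}"
      unfolding \<alpha>\<^sub>u_def by (rule K.attr_segment[OF \<theta> \<Lambda> \<beta>(2)])
    have "- (?b *\<^sub>R dir (\<alpha>\<^sub>u \<theta>)) \<noteq> ?b *\<^sub>R dir (\<alpha>\<^sub>u \<theta>)"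
    proof
      assume "- (?b *\<^sub>R dir (\<alpha>\<^sub>u \<theta>)) = ?b *\<^sub>R dir (\<alpha>\<^sub>u \<theta>)"
      then have "(- ?b) *\<^sub>R dir (\<alpha>\<^sub>u \<theta>) = ?b *\<^sub>R dir (\<alpha>\<^sub>u \<theta>)" by simp
      then show False using pos unfolding scaleR_cancel_right by simp
    qed
    then have "\<exists>a b. a \<noteq> b \<and> fibre (attractor M \<gamma> A h \<beta>) \<theta> = closed_segment a b"
      using symmetric_segment[OF pos, of "dir (\<alpha>\<^sub>u \<theta>)"] seg by metis
    moreover have "\<forall>\<alpha>\<in>{0..<1/2}. radius M \<gamma> A h \<beta> \<theta> \<alpha> > 0 \<longleftrightarrow> \<alpha> = \<alpha>\<^sub>u \<theta>"
      using K.radius_pos_iff[OF \<theta> \<Lambda> \<beta>] by (simp add: K.radius_eq_R[OF \<theta>(1)] \<alpha>\<^sub>u_def)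
    ultimately show ?thesis using seg by (simp add: K.radius_eq_R[OF \<theta>(1)])
  qed
  have c: "(\<forall>\<theta>\<in>\<Theta>\<^sub>0.
        (\<forall>\<alpha>. radius M \<gamma> A h \<beta> \<theta> \<alpha> > 0) \<and>
        continuous_on UNIV (radius M \<gamma> A h \<beta> \<theta>) \<and>
        frontier (fibre (attractor M \<gamma> A h \<beta>) \<theta>) =
          {radius M \<gamma> A h \<beta> \<theta> \<alpha> *\<^sub>R dir \<alpha> | \<alpha>. \<alpha> \<in> {0..<1}}) \<and>
      (\<forall>\<delta>>0. \<exists>K.
        random_compact_set M K \<and> forward_invariant M \<gamma> A h \<beta> K \<and>
        \<Theta>\<^sub>0 \<times> (cball 0 1 - ball 0 \<delta>) \<subseteq> K \<and>
        (\<forall>\<theta>\<in>\<Theta>\<^sub>0. frontier (fibre (attractor M \<gamma> A h \<beta>) \<theta>) =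
          (\<Inter>n. let \<theta>' = (inv_into (space M) \<gamma> ^^ n) \<theta>
               in fibre_iter \<gamma> A h \<beta> n \<theta>' ` fibre K \<theta>'))) \<and>
      (?\<Lambda> > 0 \<longrightarrow>
        (\<forall>\<theta>\<in>\<Theta>\<^sub>0. Psi M \<gamma> A h \<alpha>\<^sub>u \<beta> \<theta> \<subseteq> frontier (fibre (attractor M \<gamma> A h \<beta>) \<theta>)))"
    if \<beta>: "exp ?\<Lambda> < \<beta>" for \<beta>
  proof -
    have "0 < \<beta>" using \<beta> exp_gt_zero[of ?\<Lambda>] by linarith
    then interpret K: skew_system M \<gamma> A C h \<beta> by (rule skew)
    have pos: "0 < K.R \<theta> (dir \<alpha>)" if \<theta>: "\<theta> \<in> \<Theta>\<^sub>0" for \<theta> \<alpha>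
    proof -
      obtain m where "0 < m" "\<And>n w. w \<noteq> 0 \<Longrightarrow> m \<le> K.rad n \<theta> w 1"
        using K.supercritical_lower_bounds(1)[OF sp[OF \<theta>] good[OF \<theta>] \<beta>, of 1] by auto
      then show ?thesis using K.le_R[of m \<theta> "dir \<alpha>"] by fastforce
    qed
    have fr: "frontier (fibre (attractor M \<gamma> A h \<beta>) \<theta>) = {v. v \<noteq> 0 \<and> norm v = K.R \<theta> v}" if "\<theta> \<in> \<Theta>\<^sub>0" for \<theta>
      by (rule K.frontier_attr[OF sp[OF that] good[OF that] \<beta>])
    have c1: "(\<forall>\<alpha>. radius M \<gamma> A h \<beta> \<theta> \<alpha> > 0) \<and> continuous_on UNIV (radius M \<gamma> A h \<beta> \<theta>) \<and>
        frontier (fibre (attractor M \<gamma> A h \<beta>) \<theta>) =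
          {radius M \<gamma> A h \<beta> \<theta> \<alpha> *\<^sub>R dir \<alpha> | \<alpha>. \<alpha> \<in> {0..<1}}" if "\<theta> \<in> \<Theta>\<^sub>0" for \<theta>
    proof -
      have "radius M \<gamma> A h \<beta> \<theta> = (\<lambda>\<alpha>. K.R \<theta> (dir \<alpha>))"
        by (rule ext) (rule K.radius_eq_R[OF sp[OF that]])
      then show ?thesis
        using K.radius_continuous[OF sp[OF that] good[OF that] \<beta>] pos[OF that] K.sphere_param[OF pos[OF that]] fr[OF that]
        by simp
    qed
    have c2: "\<exists>K. random_compact_set M K \<and> forward_invariant M \<gamma> A h \<beta> K \<and>
        \<Theta>\<^sub>0 \<times> (cball 0 1 - ball 0 \<delta>) \<subseteq> K \<and>
        (\<forall>\<theta>\<in>\<Theta>\<^sub>0. frontier (fibre (attractor M \<gamma> A h \<beta>) \<theta>) =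
          (\<Inter>n. let \<theta>' = (inv_into (space M) \<gamma> ^^ n) \<theta>
               in fibre_iter \<gamma> A h \<beta> n \<theta>' ` fibre K \<theta>'))" if \<delta>: "0 < \<delta>" for \<delta> :: real
    proof -
      \<comment> \<open>Truncation at 1 keeps the unit circle in the annulus, so that it is nonempty
        and \<open>R_in_absorb\<close> applies; the annulus for r contains the one for
        \<delta>.\<close>
      define r where "r = min \<delta> 1"
      have r: "0 < r" "r \<le> 1" "r \<le> \<delta>" using \<delta> by (auto simp: r_def)
      have "\<Theta>\<^sub>0 \<times> (cball 0 1 - ball 0 \<delta>) \<subseteq> K.Kset r"
      proof (rule subrelI)
        fix \<theta> and v :: "real^2" assume v: "(\<theta>, v) \<in> \<Theta>\<^sub>0 \<times> (cball 0 1 - ball 0 \<delta>)"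
        then have "v \<in> K.annulus r" using r by (auto simp: K.annulus_def)
        then have "v \<in> (\<Union>n. S.pull h \<beta> n \<theta> ` K.annulus r)" by (intro UN_I[of 0]) auto
        then have "v \<in> K.absorb r \<theta>" unfolding K.absorb_def by (rule subsetD[OF closure_subset])
        then show "(\<theta>, v) \<in> K.Kset r" using v sp by (auto simp: K.Kset_def)
      qed
      moreover have "frontier (fibre (attractor M \<gamma> A h \<beta>) \<theta>) =
          (\<Inter>n. let \<theta>' = (inv_into (space M) \<gamma> ^^ n) \<theta>
               in fibre_iter \<gamma> A h \<beta> n \<theta>' ` fibre (K.Kset r) \<theta>')" if "\<theta> \<in> \<Theta>\<^sub>0" for \<theta>
        unfolding Let_def S.ginv_def[symmetric]
        by (rule K.frontier_eq_pullback_Kset[OF sp[OF that] good[OF that] \<beta> r(1,2)])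
      ultimately show ?thesis
        by (intro exI[of _ "K.Kset r"] conjI ballI K.random_compact_Kset[OF r(2)] K.forward_invariant_Kset)
    qed
    have c3: "Psi M \<gamma> A h \<alpha>\<^sub>u \<beta> \<theta> \<subseteq> frontier (fibre (attractor M \<gamma> A h \<beta>) \<theta>)" if "\<theta> \<in> \<Theta>\<^sub>0" for \<theta>
    proof -
      define b where "b = K.R \<theta> (dir (\<alpha>\<^sub>u \<theta>))"
      have b: "0 < b" using pos[OF that] by (simp add: b_def)
      have "K.R \<theta> (b *\<^sub>R dir (\<alpha>\<^sub>u \<theta>)) = b" "K.R \<theta> ((- b) *\<^sub>R dir (\<alpha>\<^sub>u \<theta>)) = b"
        using b K.R_scale[of b \<theta> "dir (\<alpha>\<^sub>u \<theta>)"] K.R_scale[of "- b" \<theta> "dir (\<alpha>\<^sub>u \<theta>)"] by (simp_all add: b_def)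
      then show ?thesis
        using b by (simp add: fr[OF that] Psi_def K.radius_eq_R[OF sp[OF that]] b_def[symmetric])
    qed
    show ?thesis using c1 c2 c3 by blast
  qed
  \<comment> \<open>Nonnegativity of the exponent places every parameter of (c) in the range of
    \<open>forward\<close>.\<close>
  have "exp (- ?\<Lambda>) \<le> exp ?\<Lambda>" using S.lyapunov_limit(1) by simp
  then have d: "random_two_point_forward_attractor M \<gamma> A h \<beta> \<Theta>\<^sub>0
      (Psi M \<gamma> A h \<alpha>\<^sub>u \<beta>) (attraction_domain \<Theta>\<^sub>0 \<alpha>\<^sub>s)" if "exp ?\<Lambda> < \<beta>" "0 < ?\<Lambda>" for \<beta>
    using forward[OF _ that(2)] that(1) by (meson le_less_trans)
  have b': "random_two_point_forward_attractor M \<gamma> A h \<beta> \<Theta>\<^sub>0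
      (Psi M \<gamma> A h \<alpha>\<^sub>u \<beta>) (attraction_domain \<Theta>\<^sub>0 \<alpha>\<^sub>s)" if \<beta>: "exp (- ?\<Lambda>) < \<beta>" "\<beta> < exp ?\<Lambda>" for \<beta>
  proof -
    have "exp (- ?\<Lambda>) < exp ?\<Lambda>" using \<beta> by (rule less_trans)
    then show ?thesis by (intro forward \<beta>) simp
  qed
  have meas: "\<alpha>\<^sub>u \<in> borel_measurable (restrict_space M \<Theta>\<^sub>0)" "\<alpha>\<^sub>s \<in> borel_measurable (restrict_space M \<Theta>\<^sub>0)"
    unfolding \<alpha>\<^sub>u_def \<alpha>\<^sub>s_def
    by (intro measurable_restrict_space1 S.stable_angle_measurable S.bk.stable_angle_measurable)+
  have ranges: "\<alpha>\<^sub>u ` \<Theta>\<^sub>0 \<subseteq> {0..<1/2}" "\<alpha>\<^sub>s ` \<Theta>\<^sub>0 \<subseteq> {0..<1/2}"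
    unfolding \<alpha>\<^sub>u_def \<alpha>\<^sub>s_def by (intro image_subsetI S.stable_angle_range S.bk.stable_angle_range)+
  show ?thesis
    apply (rule exI[of _ \<Theta>\<^sub>0], rule exI[of _ \<alpha>\<^sub>u], rule exI[of _ \<alpha>\<^sub>s], intro conjI \<Theta>\<^sub>0 meas ranges)
    subgoal by (intro allI impI ballI a)
    subgoal by (intro allI impI, elim conjE, rule conjI, rule ballI, rule b, assumption+, rule b', assumption+)
    subgoal
      by (intro allI impI, rule conjI, rule c[THEN conjunct1], assumption,
          rule conjI, rule c[THEN conjunct2, THEN conjunct1], assumption, rule impI, rule conjI, rule d,
          assumption+, rule c[THEN conjunct2, THEN conjunct2, THEN mp], assumption+)
    done
qed

end
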